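(* The functions $v_i(\cdot,\cdot)\equiv v(\cdot,\cdot,i):[0,T]\times\mathbb{R}_+\to\mathbb{R}_+$, $i=0,1$ (the full information value function defined in the context) have the following properties: (1) For $i=0,1$ and $t\in[0,T]$, the map $x\mapsto v_i(t,x)$ is convex and non-decreasing. (2) For any fixed $(t,x)\in[0,T]\times\mathbb{R}_+$, $v_0(t,x)\ge v_1(t,x)$. (3) For $i=0,1$ and $x\in\mathbb{R}_+$, the map $t\mapsto v_i(t,x)$ is non-increasing.
   Context: Fix $T\in(0,\infty)$ and constants $\mu_0>\mu_1$ (real), $\sigma>0$, $\lambda\ge 0$, $r\ge 0$, $K\ge 0$, $y_0\in[0,1)$; set $\eta:=(\mu_0-\mu_1)/\sigma>0$. On a complete probability space $(\Omega,\mathcal{F},\mathbb{P})$ let $W$ be a standard Brownian motion and $\theta\ge 0$ a random time independent of $W$ with $\mathbb{P}[\theta=0]=y_0$ and $\mathbb{P}[\theta>t\mid\theta>0]=e^{-\lambda t}$. Put $Y_t:=\mathbf{1}_{\{t\ge\theta\}}$, and let $\mathbb{F}=(\mathcal{F}_t)_{t\in[0,T]}$ be the $\mathbb{P}$-augmentation of the filtration generated by $(W,Y)$. The stock price satisfies $$dX_t=(\mu_0-\sigma\eta Y_t)X_t\,dt+\sigma X_t\,dW_t,$$ so its drift rate is $\mu_0$ for $t<\theta$ and $\mu_1$ for $t\ge\theta$. Let $\mathcal{T}_{t,T}$ be the set of $\mathbb{F}$-stopping times with values in $[t,T]$. The full information value function is $$v(t,x,i):=\sup_{\tau\in\mathcal{T}_{t,T}}\mathbb{E}\left[e^{-r(\tau-t)}(X_\tau-K)^+\,\middle|\,X_t=x,Y_t=i\right],\quad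 i\in\{0,1\},$$ and $v_i(t,x):=v(t,x,i)$. Conditioning on $\{X_t=x,Y_t=i\}$ is understood in the Markov sense, i.e. the Markov process $(X,Y)$ is started from $(x,i)$ at time $t$. Here $\mathbb{R}_+=[0,\infty)$. *)

theory Defs
  imports "HOL-Probability.Probability"
begin

text \<open>
  All processes below start at a time \<open>s\<close> and are indexed by real times \<open>u \<ge> s\<close>; values
  at times before \<open>s\<close> are irrelevant.
\<close>

definition generated_sigma ::
  "'w measure \<Rightarrow> (real \<Rightarrow> 'w \<Rightarrow> real) \<Rightarrow> real set \<Rightarrow> 'w measure" where
  "generated_sigma M Z I =
     sigma (space M) (\<Union>a\<in>I. {Z a -` A \<inter> space M | A. A \<in> sets borel})"

definition brownian_motion :: "real \<Rightarrow> 'w measure \<Rightarrow> (real \<Rightarrow> 'w \<Rightarrow> real) \<Rightarrow> bool" where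
  "brownian_motion s M W \<longleftrightarrow>
     (\<forall>u\<ge>s. W u \<in> borel_measurable M) \<and>
     (AE \<omega> in M. W s \<omega> = 0) \<and>
     (AE \<omega> in M. continuous_on {s..} (\<lambda>u. W u \<omega>)) \<and>
     (\<forall>u v. s \<le> u \<and> u < v \<longrightarrow>
        distributed M lborel (\<lambda>\<omega>. W v \<omega> - W u \<omega>) (normal_density 0 (sqrt (v - u))) \<and>
        prob_space.indep_set M
          (sets (generated_sigma M W {s..u}))
          (sets (vimage_algebra (space M) (\<lambda>\<omega>. W v \<omega> - W u \<omega>) borel)))"

text \<open>
  The random time is \<open>ereal\<close>-valued: for \<open>lam = 0\<close> it is almost surely infinite on \<open>{\<theta> > s}\<close>.
  For \<open>p = 1\<close> the conditional law of \<open>\<theta>\<close> given \<open>{\<theta> > s}\<close> is void.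
\<close>

definition switching_time ::
  "real \<Rightarrow> real \<Rightarrow> real \<Rightarrow> 'w measure \<Rightarrow> ('w \<Rightarrow> ereal) \<Rightarrow> bool" where
  "switching_time lam s p M \<theta> \<longleftrightarrow>
     \<theta> \<in> borel_measurable M \<and>
     (\<forall>\<omega>\<in>space M. ereal s \<le> \<theta> \<omega>) \<and>
     \<P>(\<omega> in M. \<theta> \<omega> = ereal s) = p \<and>
     (p < 1 \<longrightarrow>
       (\<forall>u\<ge>s. \<P>(\<omega> in M. ereal u < \<theta> \<omega> \<bar> ereal s < \<theta> \<omega>) = exp (- (lam * (u - s)))))"

definition state_process :: "('w \<Rightarrow> ereal) \<Rightarrow> real \<Rightarrow> 'w \<Rightarrow> real" where
  "state_process \<theta> u \<omega> = (if \<theta> \<omega> \<le> ereal u then 1 else 0)"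

definition driving_noise ::
  "real \<Rightarrow> real \<Rightarrow> real \<Rightarrow> 'w measure \<Rightarrow> (real \<Rightarrow> 'w \<Rightarrow> real) \<Rightarrow> ('w \<Rightarrow> ereal) \<Rightarrow> bool" where
  "driving_noise lam s p M W \<theta> \<longleftrightarrow>
     prob_space M \<and> complete_measure M \<and>
     brownian_motion s M W \<and>
     switching_time lam s p M \<theta> \<and>
     prob_space.indep_set M
       (sets (generated_sigma M W {s..}))
       (sets (vimage_algebra (space M) \<theta> borel))"

text \<open>The filtration generated by \<open>(W, Y)\<close> from time \<open>s\<close> on, augmented by the null sets of \<open>M\<close>.\<close>

definition augmented_filtration ::
  "real \<Rightarrow> 'w measure \<Rightarrow> (real \<Rightarrow> 'w \<Rightarrow> real) \<Rightarrow> ('w \<Rightarrow> ereal) \<Rightarrow> real \<Rightarrow> 'w measure" where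
  "augmented_filtration s M W \<theta> u =
     sigma (space M)
       (sets (generated_sigma M W {s..u}) \<union>
        sets (generated_sigma M (state_process \<theta>) {s..u}) \<union>
        null_sets M)"

text \<open>
  For an adapted integrand with continuous paths, the Ito integral over \<open>[a, b]\<close> is the limit
  in probability of the left-endpoint sums as the mesh of the partition tends to zero. It is
  used below for such integrands only. A partition is the sorted list of its points.
\<close>

definition is_partition :: "real \<Rightarrow> real \<Rightarrow> real list \<Rightarrow> bool" where
  "is_partition a b ts \<longleftrightarrow> ts \<noteq> [] \<and> sorted ts \<and> hd ts = a \<and> last ts = b"

definition mesh_less :: "real \<Rightarrow> real list \<Rightarrow> bool" where
  "mesh_less \<delta> ts \<longleftrightarrow> (\<forall>k<length ts - 1. ts ! Suc k - ts ! k < \<delta>)"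

definition left_sum ::
  "(real \<Rightarrow> 'w \<Rightarrow> real) \<Rightarrow> (real \<Rightarrow> 'w \<Rightarrow> real) \<Rightarrow> real list \<Rightarrow> 'w \<Rightarrow> real" where
  "left_sum H W ts \<omega> =
     (\<Sum>k<length ts - 1. H (ts ! k) \<omega> * (W (ts ! Suc k) \<omega> - W (ts ! k) \<omega>))"

definition has_ito_integral ::
  "'w measure \<Rightarrow> (real \<Rightarrow> 'w \<Rightarrow> real) \<Rightarrow> (real \<Rightarrow> 'w \<Rightarrow> real) \<Rightarrow> real \<Rightarrow> real \<Rightarrow> ('w \<Rightarrow> real) \<Rightarrow> bool"
  where
  "has_ito_integral M W H a b J \<longleftrightarrow>
     J \<in> borel_measurable M \<and>
     (\<forall>\<epsilon>>0. \<forall>\<gamma>>0. \<exists>\<delta>>0. \<forall>ts. is_partition a b ts \<and> mesh_less \<delta> ts \<longrightarrow>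
        \<P>(\<omega> in M. \<epsilon> < \<bar>left_sum H W ts \<omega> - J \<omega>\<bar>) < \<gamma>)"

text \<open>\<open>X\<close> is a continuous adapted solution on \<open>[s, T]\<close> of
  \<open>dX = (\<mu>0 - \<sigma> \<eta> Y) X du + \<sigma> X dW\<close> with \<open>X s = x\<close>.\<close>

definition stock_price ::
  "real \<Rightarrow> real \<Rightarrow> real \<Rightarrow> real \<Rightarrow> real \<Rightarrow> real \<Rightarrow>
   'w measure \<Rightarrow> (real \<Rightarrow> 'w \<Rightarrow> real) \<Rightarrow> ('w \<Rightarrow> ereal) \<Rightarrow> (real \<Rightarrow> 'w \<Rightarrow> real) \<Rightarrow> bool" where
  "stock_price T \<mu>0 \<mu>1 \<sigma> s x M W \<theta> X \<longleftrightarrow>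
     (let \<eta> = (\<mu>0 - \<mu>1) / \<sigma>; Y = state_process \<theta> in
       (\<forall>u\<in>{s..T}. X u \<in> borel_measurable (augmented_filtration s M W \<theta> u)) \<and>
       (AE \<omega> in M. continuous_on {s..T} (\<lambda>u. X u \<omega>)) \<and>
       (AE \<omega> in M. X s \<omega> = x) \<and>
       (\<forall>u\<in>{s..T}. \<exists>J.
          has_ito_integral M W (\<lambda>a \<omega>. \<sigma> * X a \<omega>) s u J \<and>
          (AE \<omega> in M.
             X u \<omega> = x + (LBINT a:{s..u}. (\<mu>0 - \<sigma> * \<eta> * Y a \<omega>) * X a \<omega>) + J \<omega>)))"

definition stopping_times ::
  "real \<Rightarrow> real \<Rightarrow> 'w measure \<Rightarrow> (real \<Rightarrow> 'w \<Rightarrow> real) \<Rightarrow> ('w \<Rightarrow> ereal) \<Rightarrow> ('w \<Rightarrow> real) set" where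
  "stopping_times s T M W \<theta> =
     {\<tau>. stopping_time (augmented_filtration s M W \<theta>) \<tau> \<and> (\<forall>\<omega>\<in>space M. \<tau> \<omega> \<in> {s..T})}"

text \<open>The payoff is nonnegative, so its expectation is taken in \<open>[0, \<infinity>]\<close>.\<close>

definition stopping_value ::
  "real \<Rightarrow> real \<Rightarrow> real \<Rightarrow> real \<Rightarrow>
   'w measure \<Rightarrow> (real \<Rightarrow> 'w \<Rightarrow> real) \<Rightarrow> ('w \<Rightarrow> ereal) \<Rightarrow> (real \<Rightarrow> 'w \<Rightarrow> real) \<Rightarrow> ennreal" where
  "stopping_value r K T s M W \<theta> X =
     (SUP \<tau>\<in>stopping_times s T M W \<theta>.
        \<integral>\<^sup>+\<omega>. ennreal (exp (- r * (\<tau> \<omega> - s)) * max 0 (X (\<tau> \<omega>) \<omega> - K)) \<partial>M)"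

text \<open>
  A family of copies of the model, one for each starting point \<open>(t, x, i)\<close>: under \<open>P t x i\<close>
  the Markov process \<open>(X, Y)\<close> is started from \<open>(x, i)\<close> at time \<open>t\<close>. Starting \<open>Y\<close> in the
  state \<open>i \<in> {0, 1}\<close> at time \<open>t\<close> means that \<open>\<theta> = t\<close> has probability \<open>i\<close>.
\<close>

definition started_markov_family ::
  "real \<Rightarrow> real \<Rightarrow> real \<Rightarrow> real \<Rightarrow> real \<Rightarrow>
   (real \<Rightarrow> real \<Rightarrow> nat \<Rightarrow> 'w measure) \<Rightarrow>
   (real \<Rightarrow> real \<Rightarrow> nat \<Rightarrow> real \<Rightarrow> 'w \<Rightarrow> real) \<Rightarrow>
   (real \<Rightarrow> real \<Rightarrow> nat \<Rightarrow> 'w \<Rightarrow> ereal) \<Rightarrow>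
   (real \<Rightarrow> real \<Rightarrow> nat \<Rightarrow> real \<Rightarrow> 'w \<Rightarrow> real) \<Rightarrow> bool" where
  "started_markov_family T \<mu>0 \<mu>1 \<sigma> lam P W \<theta> X \<longleftrightarrow>
     (\<forall>t\<in>{0..T}. \<forall>x\<ge>0. \<forall>i\<in>{0, 1}.
        driving_noise lam t (real i) (P t x i) (W t x i) (\<theta> t x i) \<and>
        stock_price T \<mu>0 \<mu>1 \<sigma> t x (P t x i) (W t x i) (\<theta> t x i) (X t x i))"

definition full_info_value ::
  "real \<Rightarrow> real \<Rightarrow> real \<Rightarrow>
   (real \<Rightarrow> real \<Rightarrow> nat \<Rightarrow> 'w measure) \<Rightarrow>
   (real \<Rightarrow> real \<Rightarrow> nat \<Rightarrow> real \<Rightarrow> 'w \<Rightarrow> real) \<Rightarrow>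
   (real \<Rightarrow> real \<Rightarrow> nat \<Rightarrow> 'w \<Rightarrow> ereal) \<Rightarrow>
   (real \<Rightarrow> real \<Rightarrow> nat \<Rightarrow> real \<Rightarrow> 'w \<Rightarrow> real) \<Rightarrow>
   real \<Rightarrow> real \<Rightarrow> nat \<Rightarrow> ennreal" where
  "full_info_value r K T P W \<theta> X t x i =
     stopping_value r K T t (P t x i) (W t x i) (\<theta> t x i) (X t x i)"

end

theory Submission
  imports Defs
begin

text \<open>
  The stochastic differential equation is linear, so its solution is \<open>x\<close> times the explicit
  positive factor \<open>E u = exp (\<mu>0 (u - s) - (\<mu>0 - \<mu>1) (u - \<theta>)\<^sup>+ + \<sigma> W u - \<sigma>\<^sup>2 (u - s) / 2)\<close>,
  which does not depend on \<open>x\<close>. The value of the stopping problem for \<open>x E\<close> depends only on the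
  joint law of \<open>W\<close> and \<open>\<theta>\<close> seen from the starting time: stopping times may be replaced by
  grid-valued ones, and these are described by events that can be carried from one probability
  space to another with the same law. Hence all starting points may be put on one space.
  There the payoff of every strategy is convex and nondecreasing in \<open>x\<close>; a strategy for the
  horizon \<open>T - t'\<close> is also available for the longer horizon \<open>T - t\<close>; and a strategy that is
  based on \<open>W\<close> alone earns more when the drift drops at \<open>\<theta>\<close> instead of at once.
\<close>

section \<open>Filtrations and independence\<close>

text \<open>The price is given only as some continuous adapted solution, and its Ito integral only
  as a limit in probability at each fixed time, with a separate \<open>J\<close> for each of them.
  So the product rule for \<open>X\<close> times the reciprocal of \<open>E\<close> is derived by
  hand: the product is telescoped over a grid, and every error term is shown to vanish on almost
  every path along a subsequence. The drift jumps at \<theta>, but \<theta> is independent of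
  \<open>W\<close>; it may be revealed at the start, and the increments of \<open>W\<close> stay
  independent of the past.

  The family in the theorem has its own probability space for each (t, x, i), so two values cannot
  be compared path by path as they stand. A general stopping time consists of uncountably many
  events, each of which is a preimage under the path map only up to a null set. A rule on a grid
  needs only countably many, so the exceptional sets combine into one null set, and equality of laws
  carries the expected payoff over. Normal increments, the exponential tail of \<theta> and
  independence fix the joint law.\<close>

lemma AE_eq_vimage_sigma_sets:
  assumes A: "A \<in> sigma_sets (space M) \<G>"
    and G: "\<And>G. G \<in> \<G> \<Longrightarrow> \<exists>B\<in>sets N. AE \<omega> in M. \<omega> \<in> G \<longleftrightarrow> \<Phi> \<omega> \<in> B"
    and \<Phi>: "\<And>\<omega>. \<omega> \<in> space M \<Longrightarrow> \<Phi> \<omega> \<in> space N"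
  shows "\<exists>B\<in>sets N. AE \<omega> in M. \<omega> \<in> A \<longleftrightarrow> \<Phi> \<omega> \<in> B"
  \<comment> \<open>The sets that agree almost surely with a preimage under \<Phi> form a
    sigma-algebra, so the generators decide; a countable union merges countably many null
    sets.\<close>
  using A
proof induction
  case (Basic a)
  then show ?case by (rule G)
next
  case Empty
  show ?case by (intro bexI[of _ "{}"]) auto
next
  case (Compl a)
  then obtain B where B: "B \<in> sets N" "AE \<omega> in M. \<omega> \<in> a \<longleftrightarrow> \<Phi> \<omega> \<in> B" by blast
  have "AE \<omega> in M. \<omega> \<in> space M - a \<longleftrightarrow> \<Phi> \<omega> \<in> space N - B"
    using B(2) AE_space by eventually_elim (use \<Phi> in auto)
  then show ?case using B(1) by blast
next
  case (Union a)
  then have "\<forall>i. \<exists>B. B \<in> sets N \<and> (AE \<omega> in M. \<omega> \<in> a i \<longleftrightarrow> \<Phi> \<omega> \<in> B)" by blast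
  then obtain B where B: "\<And>i. B i \<in> sets N" "\<And>i. AE \<omega> in M. \<omega> \<in> a i \<longleftrightarrow> \<Phi> \<omega> \<in> B i"
    by metis
  have "AE \<omega> in M. \<forall>i. \<omega> \<in> a i \<longleftrightarrow> \<Phi> \<omega> \<in> B i"
    using B(2) by (simp add: AE_all_countable)
  then have "AE \<omega> in M. \<omega> \<in> (\<Union>i. a i) \<longleftrightarrow> \<Phi> \<omega> \<in> (\<Union>i. B i)"
    by eventually_elim auto
  then show ?case using B(1) by blast
qed

lemma space_generated_sigma [simp]: "space (generated_sigma M Z I) = space M"
  unfolding generated_sigma_def by (rule space_measure_of) auto

lemma sets_generated_sigma:
  "sets (generated_sigma M Z I) =
    sigma_sets (space M) (\<Union>a\<in>I. {Z a -` A \<inter> space M | A. A \<in> sets borel})"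
  unfolding generated_sigma_def by (rule sets_measure_of) auto

lemma measurable_generated_sigma: "a \<in> I \<Longrightarrow> Z a \<in> borel_measurable (generated_sigma M Z I)"
  by (rule measurableI) (auto simp: sets_generated_sigma)

lemma sets_generated_sigma_subset:
  assumes "\<And>a. a \<in> I \<Longrightarrow> Z a \<in> borel_measurable N" "space N = space M"
  shows "sets (generated_sigma M Z I) \<subseteq> sets N"
proof -
  have "sigma_sets (space N) (\<Union>a\<in>I. {Z a -` A \<inter> space M | A. A \<in> sets borel}) \<subseteq> sets N"
    using assms(1) unfolding assms(2)[symmetric]
    by (intro sets.sigma_sets_subset) (auto dest: measurable_sets)
  then show ?thesis using assms(2) by (simp add: sets_generated_sigma)
qed

lemma sets_vimage_algebra_subset:
  assumes "f \<in> measurable N L" "space N = \<Omega>"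
  shows "sets (vimage_algebra \<Omega> f L) \<subseteq> sets N"
  using assms measurable_space[OF assms(1)] by (auto simp: sets_vimage_algebra2 dest: measurable_sets)

lemma space_augmented_filtration [simp]: "space (augmented_filtration s M W \<theta> u) = space M"
  unfolding augmented_filtration_def
  by (rule space_measure_of) (use sets.sets_into_space[of _ "generated_sigma M _ _"] in
    \<open>auto dest!: sets.sets_into_space simp: null_sets_def\<close>)

lemma sets_augmented_filtration:
  "sets (augmented_filtration s M W \<theta> u) = sigma_sets (space M)
     (sets (generated_sigma M W {s..u}) \<union> sets (generated_sigma M (state_process \<theta>) {s..u}) \<union> null_sets M)"
  unfolding augmented_filtration_def
  by (rule sets_measure_of) (use sets.sets_into_space[of _ "generated_sigma M _ _"] in
    \<open>auto dest!: sets.sets_into_space simp: null_sets_def\<close>)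

lemma sets_augmented_filtration_subset:
  assumes "\<And>a. a \<in> {s..u} \<Longrightarrow> W a \<in> borel_measurable N"
    and "\<And>a. a \<in> {s..u} \<Longrightarrow> state_process \<theta> a \<in> borel_measurable N"
    and "null_sets M \<subseteq> sets N" "space N = space M"
  shows "sets (augmented_filtration s M W \<theta> u) \<subseteq> sets N"
proof -
  have "sigma_sets (space N)
     (sets (generated_sigma M W {s..u}) \<union> sets (generated_sigma M (state_process \<theta>) {s..u}) \<union> null_sets M)
    \<subseteq> sets N"
    using assms sets_generated_sigma_subset[of "{s..u}" W N M]
      sets_generated_sigma_subset[of "{s..u}" "state_process \<theta>" N M]
    by (intro sets.sigma_sets_subset) auto
  then show ?thesis using assms(4) by (simp add: sets_augmented_filtration)
qed

lemma measurable_mono_sets: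
  "f \<in> measurable N L \<Longrightarrow> sets N \<subseteq> sets N' \<Longrightarrow> space N = space N' \<Longrightarrow> f \<in> measurable N' L"
  by (auto simp: measurable_def)

lemma W_measurable_augmented:
  "a \<in> {s..u} \<Longrightarrow> W a \<in> borel_measurable (augmented_filtration s M W \<theta> u)"
  by (rule measurable_mono_sets[OF measurable_generated_sigma[of a "{s..u}" W M]])
     (auto simp: sets_augmented_filtration)

lemma state_process_measurable_augmented:
  "a \<in> {s..u} \<Longrightarrow> state_process \<theta> a \<in> borel_measurable (augmented_filtration s M W \<theta> u)"
  by (rule measurable_mono_sets[OF measurable_generated_sigma[of a "{s..u}" "state_process \<theta>" M]])
     (auto simp: sets_augmented_filtration)

lemma null_sets_augmented: "null_sets M \<subseteq> sets (augmented_filtration s M W \<theta> u)"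
  by (auto simp: sets_augmented_filtration)

lemma augmented_filtration_mono:
  "u \<le> v \<Longrightarrow> sets (augmented_filtration s M W \<theta> u) \<subseteq> sets (augmented_filtration s M W \<theta> v)"
  by (rule sets_augmented_filtration_subset)
     (auto intro: W_measurable_augmented state_process_measurable_augmented
           simp: null_sets_augmented)

lemma state_process_measurable:
  "\<theta> \<in> borel_measurable N \<Longrightarrow> state_process \<theta> a \<in> borel_measurable N"
  unfolding state_process_def by measurable

lemma (in prob_space) indep_varI_sets:
  assumes AB: "indep_set (sets A) (sets B)" and sp: "space A = space M" "space B = space M"
    and X: "X \<in> measurable A S" and Y: "Y \<in> measurable B T"
  shows "indep_var S X T Y"
proof -
  have sub: "sets A \<subseteq> events" "sets B \<subseteq> events"
    using AB by (auto dest: indep_setD_ev1 indep_setD_ev2)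
  have XM: "random_variable S X" "random_variable T Y"
    using X Y sub sp by (auto intro: measurable_mono_sets)
  have "sigma_sets (space A) {X -` C \<inter> space A | C. C \<in> sets S} \<subseteq> sets A"
    using X by (intro sets.sigma_sets_subset) (auto dest: measurable_sets)
  moreover have "sigma_sets (space B) {Y -` C \<inter> space B | C. C \<in> sets T} \<subseteq> sets B"
    using Y by (intro sets.sigma_sets_subset) (auto dest: measurable_sets)
  ultimately have "indep_set (sigma_sets (space M) {X -` C \<inter> space M | C. C \<in> sets S})
      (sigma_sets (space M) {Y -` C \<inter> space M | C. C \<in> sets T})"
    using AB unfolding sp indep_set_def
    by (elim indep_sets_mono_sets) (auto split: bool.split)
  then show ?thesis using XM by (simp add: indep_var_eq)
qed

section \<open>Enlargement of the filtration by the switching time\<close>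

locale noise = prob_space M for M :: "'w measure" +
  fixes lam s p :: real and W :: "real \<Rightarrow> 'w \<Rightarrow> real" and \<theta> :: "'w \<Rightarrow> ereal"
  assumes noise: "driving_noise lam s p M W \<theta>"
begin

text \<open>
  Enlarging the filtration by \<open>\<theta>\<close> from the start keeps the increments of \<open>W\<close> independent of the past
  and makes the drift measurable at time \<open>s\<close>.
\<close>

definition full_filtration :: "real \<Rightarrow> 'w measure" where
  "full_filtration u = sigma (space M)
     (sets (generated_sigma M W {s..u}) \<union> sets (vimage_algebra (space M) \<theta> borel) \<union> null_sets M)"

lemma W_measurable [measurable]: "s \<le> u \<Longrightarrow> W u \<in> borel_measurable M"
  and W_start: "AE \<omega> in M. W s \<omega> = 0"
  and W_continuous: "AE \<omega> in M. continuous_on {s..} (\<lambda>u. W u \<omega>)"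
  and W_increment: "s \<le> u \<Longrightarrow> u < v \<Longrightarrow>
    distributed M lborel (\<lambda>\<omega>. W v \<omega> - W u \<omega>) (normal_density 0 (sqrt (v - u)))"
  and W_indep: "s \<le> u \<Longrightarrow> u < v \<Longrightarrow> indep_set (sets (generated_sigma M W {s..u}))
    (sets (vimage_algebra (space M) (\<lambda>\<omega>. W v \<omega> - W u \<omega>) borel))"
  and \<theta>_measurable [measurable]: "\<theta> \<in> borel_measurable M"
  and \<theta>_ge: "\<omega> \<in> space M \<Longrightarrow> ereal s \<le> \<theta> \<omega>"
  and W_\<theta>_indep: "indep_set (sets (generated_sigma M W {s..}))
    (sets (vimage_algebra (space M) \<theta> borel))"
  using noise unfolding driving_noise_def brownian_motion_def switching_time_def by auto

lemma space_full_filtration [simp]: "space (full_filtration u) = space M"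
  unfolding full_filtration_def
  by (rule space_measure_of) (use sets.sets_into_space[of _ "generated_sigma M _ _"]
      sets.sets_into_space[of _ "vimage_algebra (space M) \<theta> borel"] in
    \<open>auto dest!: sets.sets_into_space simp: null_sets_def\<close>)

lemma sets_full_filtration:
  "sets (full_filtration u) = sigma_sets (space M)
     (sets (generated_sigma M W {s..u}) \<union> sets (vimage_algebra (space M) \<theta> borel) \<union> null_sets M)"
  unfolding full_filtration_def
  by (rule sets_measure_of) (use sets.sets_into_space[of _ "generated_sigma M _ _"]
      sets.sets_into_space[of _ "vimage_algebra (space M) \<theta> borel"] in
    \<open>auto dest!: sets.sets_into_space simp: null_sets_def\<close>)

lemma W_measurable_full:
  "a \<in> {s..u} \<Longrightarrow> W a \<in> borel_measurable (full_filtration u)"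
  by (rule measurable_mono_sets[OF measurable_generated_sigma[of a "{s..u}" W M]])
     (auto simp: sets_full_filtration)

lemma \<theta>_measurable_full: "\<theta> \<in> borel_measurable (full_filtration u)"
  by (rule measurable_mono_sets[OF measurable_vimage_algebra1])
     (auto simp: sets_full_filtration)

text \<open>Every \<open>state_process\<close> is a function of \<theta>, so the filtration of the
  model lies in the enlarged one; adapted prices and stopping rules can thus be handled
  there.\<close>

lemma augmented_subset_full:
  "sets (augmented_filtration s M W \<theta> u) \<subseteq> sets (full_filtration u)"
  by (rule sets_augmented_filtration_subset)
     (auto intro: W_measurable_full state_process_measurable \<theta>_measurable_full simp: sets_full_filtration)

lemma full_filtration_subset_events: "sets (full_filtration u) \<subseteq> events"
proof -
  have "sets (generated_sigma M W {s..u}) \<subseteq> events"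
    by (rule sets_generated_sigma_subset) auto
  moreover have "sets (vimage_algebra (space M) \<theta> borel) \<subseteq> events"
    by (rule sets_vimage_algebra_subset) auto
  ultimately show ?thesis
    unfolding sets_full_filtration by (intro sets.sigma_sets_subset) auto
qed

lemma full_filtration_mono: "u \<le> v \<Longrightarrow> sets (full_filtration u) \<subseteq> sets (full_filtration v)"
proof -
  assume "u \<le> v"
  then have "sets (generated_sigma M W {s..u}) \<subseteq> sets (full_filtration v)"
    by (intro sets_generated_sigma_subset) (auto intro: W_measurable_full)
  moreover have "sets (vimage_algebra (space M) \<theta> borel) \<subseteq> sets (full_filtration v)"
    by (rule sets_vimage_algebra_subset) (auto intro: \<theta>_measurable_full)
  moreover have "null_sets M \<subseteq> sets (full_filtration v)"
    by (auto simp: sets_full_filtration)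
  ultimately have "sigma_sets (space (full_filtration v)) (sets (generated_sigma M W {s..u}) \<union>
     sets (vimage_algebra (space M) \<theta> borel) \<union> null_sets M) \<subseteq> sets (full_filtration v)"
    by (intro sets.sigma_sets_subset) auto
  then show ?thesis by (simp add: sets_full_filtration[of u])
qed

lemma measurable_full_mono:
  "f \<in> measurable (full_filtration u) L \<Longrightarrow> u \<le> v \<Longrightarrow> f \<in> measurable (full_filtration v) L"
  by (erule measurable_mono_sets) (auto intro: full_filtration_mono[THEN subsetD])

lemma measurable_full_events: "f \<in> measurable (full_filtration u) L \<Longrightarrow> f \<in> measurable M L"
  by (erule measurable_mono_sets) (auto intro: full_filtration_subset_events[THEN subsetD])

text \<open>Intersections of an event of the Brownian past with an event of \<theta> form a
  pi-system that generates the enlarged past up to null sets. On it the product formula combines the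
  independence of \<open>W\<close> and \<theta> with that of the increment and the Brownian
  past.\<close>

lemma indep_full_increment:
  assumes su: "s \<le> u" and uv: "u < v"
  shows "indep_set (sets (full_filtration u))
    (sets (vimage_algebra (space M) (\<lambda>\<omega>. W v \<omega> - W u \<omega>) borel))"
    (is "indep_set _ (sets ?C)")
proof -
  let ?W = "sets (generated_sigma M W {s..u})" and ?T = "sets (vimage_algebra (space M) \<theta> borel)"
  define \<P> where "\<P> = {A \<inter> B | A B. A \<in> ?W \<and> B \<in> ?T}"
  have We: "?W \<subseteq> events" by (rule sets_generated_sigma_subset) auto
  have Te: "?T \<subseteq> events" by (rule sets_vimage_algebra_subset) auto
  have sv: "s \<le> v" using su uv by simp
  have Ce: "sets ?C \<subseteq> events"
    by (rule sets_vimage_algebra_subset) (use su sv in measurable)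
  have CW: "sets ?C \<subseteq> sets (generated_sigma M W {s..})"
    using su uv
    by (intro sets_vimage_algebra_subset borel_measurable_diff measurable_generated_sigma) auto
  have WW: "?W \<subseteq> sets (generated_sigma M W {s..})"
    by (intro sets_generated_sigma_subset measurable_generated_sigma) auto
  have \<P>e: "\<P> \<subseteq> events" using We Te by (auto simp: \<P>_def)
  have ind: "indep_set \<P> (sets ?C)"
  proof (rule indep_setI[OF \<P>e Ce])
    fix a c assume "a \<in> \<P>" "c \<in> sets ?C"
    then obtain A B where a: "a = A \<inter> B" "A \<in> ?W" "B \<in> ?T" by (auto simp: \<P>_def)
    \<comment> \<open>\<open>A\<close> and \<open>c\<close> are both events of the path of
      \<open>W\<close>, so their intersection is independent of \<open>B\<close>; after that
      \<open>A\<close> is separated from \<open>c\<close>.\<close>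
    have "prob (a \<inter> c) = prob ((A \<inter> c) \<inter> B)" by (simp add: a Int_ac)
    also have "\<dots> = prob (A \<inter> c) * prob B"
      using CW WW a \<open>c \<in> sets ?C\<close> by (intro indep_setD[OF W_\<theta>_indep]) auto
    also have "prob (A \<inter> c) = prob A * prob c"
      using a \<open>c \<in> sets ?C\<close> by (intro indep_setD[OF W_indep[OF su uv]]) auto
    also have "prob A * prob c * prob B = prob (A \<inter> B) * prob c"
      using indep_setD[OF W_\<theta>_indep, of A B] WW a by auto
    finally show "prob (a \<inter> c) = prob a * prob c" by (simp add: a)
  qed
  have "Int_stable \<P>"
  proof (rule Int_stableI)
    fix a b assume "a \<in> \<P>" "b \<in> \<P>"
    then obtain A B A' B' where "a = A \<inter> B" "A \<in> ?W" "B \<in> ?T" "b = A' \<inter> B'" "A' \<in> ?W" "B' \<in> ?T"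
      by (auto simp: \<P>_def)
    then have "a \<inter> b = (A \<inter> A') \<inter> (B \<inter> B')" "A \<inter> A' \<in> ?W" "B \<inter> B' \<in> ?T" by auto
    then show "a \<inter> b \<in> \<P>" unfolding \<P>_def by blast
  qed
  moreover have "Int_stable (sets ?C)" by (auto intro!: Int_stableI)
  ultimately have ind2: "indep_set (sigma_sets (space M) \<P>) (sets ?C)"
    using indep_set_sigma_sets[OF ind] sets.sigma_sets_eq[of ?C] by simp
  define N where "N = sigma (space M) \<P>"
  have \<P>p: "\<P> \<subseteq> Pow (space M)" using \<P>e sets.sets_into_space by auto
  have setsN: "sets N = sigma_sets (space M) \<P>" "space N = space M"
    using \<P>p by (auto simp: N_def)
  have "space M \<in> ?T" "space M \<in> ?W"
    using sets.top[of "vimage_algebra (space M) \<theta> borel"] sets.top[of "generated_sigma M W {s..u}"]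
    by auto
  then have WN: "?W \<subseteq> \<P>" "?T \<subseteq> \<P>"
    using sets.sets_into_space[of _ "generated_sigma M W {s..u}"]
      sets.sets_into_space[of _ "vimage_algebra (space M) \<theta> borel"]
    unfolding \<P>_def by auto (metis inf.absorb1 inf.absorb2)+
  show ?thesis
  proof (rule indep_setI[OF full_filtration_subset_events Ce])
    fix a c assume a: "a \<in> sets (full_filtration u)" and c: "c \<in> sets ?C"
    \<comment> \<open>An event of the augmented sigma-algebra differs by a null set from one
      generated by the pi-system alone; a null generator is matched with the empty set.\<close>
    have "\<exists>B\<in>sets N. AE \<omega> in M. \<omega> \<in> a \<longleftrightarrow> id \<omega> \<in> B"
    proof (rule AE_eq_vimage_sigma_sets)
      show "a \<in> sigma_sets (space M) (?W \<union> ?T \<union> null_sets M)"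
        using a by (simp add: sets_full_filtration)
      fix G assume "G \<in> ?W \<union> ?T \<union> null_sets M"
      then consider "G \<in> \<P>" | "G \<in> null_sets M" using WN by auto
      then show "\<exists>B\<in>sets N. AE \<omega> in M. (\<omega> \<in> G) = (id \<omega> \<in> B)"
      proof cases
        case 1 then show ?thesis by (intro bexI[of _ G]) (auto simp: setsN)
      next
        case 2 then show ?thesis
          by (intro bexI[of _ "{}"]) (auto dest: AE_not_in)
      qed
    qed (auto simp: setsN)
    then obtain B where B: "B \<in> sets N" "AE \<omega> in M. \<omega> \<in> a \<longleftrightarrow> \<omega> \<in> B" by auto
    have Be: "B \<in> events" using indep_setD_ev1[OF ind2] B setsN by auto
    have ae: "a \<in> events" using a full_filtration_subset_events by auto
    have ce: "c \<in> events" using c Ce by auto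
    have "prob (a \<inter> c) = prob (B \<inter> c)"
      by (rule finite_measure_eq_AE) (use B Be ae ce in auto)
    also have "\<dots> = prob B * prob c"
      using B c setsN by (intro indep_setD[OF ind2]) auto
    also have "prob B = prob a"
      by (rule finite_measure_eq_AE) (use B Be ae in auto)
    finally show "prob (a \<inter> c) = prob a * prob c" .
  qed
qed

lemma indep_var_increment:
  assumes "s \<le> u" "u < v" "H \<in> measurable (full_filtration u) S" "f \<in> measurable borel L"
  shows "indep_var S H L (\<lambda>\<omega>. f (W v \<omega> - W u \<omega>))"
proof (rule indep_varI_sets[OF indep_full_increment[OF assms(1,2)]])
  show "(\<lambda>\<omega>. f (W v \<omega> - W u \<omega>)) \<in> measurable (vimage_algebra (space M) (\<lambda>\<omega>. W v \<omega> - W u \<omega>) borel) L"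
    by (rule measurable_compose[OF measurable_vimage_algebra1 assms(4)]) auto
qed (use assms in auto)

end

section \<open>Uniqueness of the stock price\<close>

lemma abs_exp_minus_one_le:
  fixes y :: real
  assumes "\<bar>y\<bar> \<le> 1"
  shows "\<bar>exp y - 1\<bar> \<le> 3 * \<bar>y\<bar>"
proof -
  have "\<bar>exp y - exp 0\<bar> \<le> 3 * \<bar>y - 0\<bar>"
  proof (rule field_differentiable_bound[of "{-1..1::real}" exp exp 3, unfolded real_norm_def])
    fix z :: real assume z: "z \<in> {-1..1}"
    show "(exp has_field_derivative exp z) (at z within {-1..1})"
      by (rule DERIV_subset[OF DERIV_exp]) auto
    have "exp z \<le> exp 1" using z by simp
    also have "\<dots> \<le> 3" by (rule exp_le)
    finally show "\<bar>exp z\<bar> \<le> 3" by simp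
  qed (use assms in auto)
  then show ?thesis by simp
qed

text \<open>The derivative is - y (exp y - 1), which is of second order, so the mean value theorem
  yields a third-order bound. The factor 3 is inherited from the bound 3 for exp 1.\<close>

lemma exp_product_taylor:
  fixes y :: real
  assumes "\<bar>y\<bar> \<le> 1"
  shows "\<bar>(1 - y) * exp y - 1 + y^2 / 2\<bar> \<le> 3 * \<bar>y\<bar>^3"
proof -
  let ?f = "\<lambda>y::real. (1 - y) * exp y - 1 + y^2 / 2"
  have "\<bar>?f y - ?f 0\<bar> \<le> (3 * y^2) * \<bar>y - 0\<bar>"
  proof (rule field_differentiable_bound[of "{-\<bar>y\<bar>..\<bar>y\<bar>}" ?f "\<lambda>z. - z * (exp z - 1)" "3 * y^2",
        unfolded real_norm_def])
    fix z :: real assume z: "z \<in> {-\<bar>y\<bar>..\<bar>y\<bar>}"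
    show "(?f has_field_derivative - z * (exp z - 1)) (at z within {-\<bar>y\<bar>..\<bar>y\<bar>})"
      by (auto intro!: derivative_eq_intros simp: algebra_simps)
    have zy: "\<bar>z\<bar> \<le> \<bar>y\<bar>" using z by auto
    have "\<bar>- z * (exp z - 1)\<bar> = \<bar>z\<bar> * \<bar>exp z - 1\<bar>" by (simp add: abs_mult)
    also have "\<dots> \<le> \<bar>z\<bar> * (3 * \<bar>z\<bar>)"
      using zy assms by (intro mult_left_mono abs_exp_minus_one_le) auto
    also have "\<dots> = 3 * (\<bar>z\<bar> * \<bar>z\<bar>)" by simp
    also have "\<dots> \<le> 3 * (\<bar>y\<bar> * \<bar>y\<bar>)" using zy by (intro mult_left_mono mult_mono) auto
    finally show "\<bar>- z * (exp z - 1)\<bar> \<le> 3 * y^2" by (simp add: power2_eq_square)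
  qed auto
  also have "\<dots> = 3 * \<bar>y\<bar>^3" by (simp add: power3_eq_cube power2_eq_square)
  finally show ?thesis by simp
qed

text \<open>To be used with \<open>y\<close> the logarithmic increment of the reciprocal price
  factor, \<open>b\<close> the drift increment, \<open>z\<close> the Brownian increment times
  \<sigma>, and \<open>g\<close> the step length times \<sigma>^2 / 2. Since 1 + b + z = 1 - y + g
  and g - b = y + z, replacing y^2 / 2 by z^2 / 2 costs (g - b) (y - z) / 2, and every remainder
  carries a factor \<eta>.\<close>

lemma exp_increment_expansion:
  fixes b z g c :: real
  assumes y: "y = g - b - z" "\<bar>y\<bar> \<le> \<eta>" "\<eta> \<le> 1" and z: "\<bar>z\<bar> \<le> \<eta>"
    and g: "0 \<le> g" and gb: "\<bar>g - b\<bar> \<le> c"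
  shows "\<bar>(1 + b + z) * exp y - 1 - (g - z^2 / 2)\<bar> \<le> 3 * \<eta> * (y^2 + g + c)"
proof -
  have \<eta>: "0 \<le> \<eta>" using z by linarith
  have eq: "(1 + b + z) * exp y - 1 - (g - z^2 / 2) =
    ((1 - y) * exp y - 1 + y^2 / 2) + g * (exp y - 1) - (g - b) * (y - z) / 2"
    by (simp add: y field_simps power2_eq_square)
  have 1: "\<bar>(1 - y) * exp y - 1 + y^2 / 2\<bar> \<le> 3 * \<eta> * y^2"
  proof -
    have "\<bar>(1 - y) * exp y - 1 + y^2 / 2\<bar> \<le> 3 * \<bar>y\<bar>^3"
      using y by (intro exp_product_taylor) auto
    also have "\<dots> = 3 * \<bar>y\<bar> * y^2" by (simp add: power3_eq_cube power2_eq_square)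
    also have "\<dots> \<le> 3 * \<eta> * y^2" using y by (intro mult_right_mono) auto
    finally show ?thesis .
  qed
  have 2: "\<bar>g * (exp y - 1)\<bar> \<le> 3 * \<eta> * g"
  proof -
    have "\<bar>exp y - 1\<bar> \<le> 3 * \<bar>y\<bar>" using y by (intro abs_exp_minus_one_le) auto
    also have "\<dots> \<le> 3 * \<eta>" using y by simp
    finally have "g * \<bar>exp y - 1\<bar> \<le> g * (3 * \<eta>)" using g by (rule mult_left_mono)
    then show ?thesis using g by (simp add: abs_mult mult_ac)
  qed
  have 3: "\<bar>(g - b) * (y - z) / 2\<bar> \<le> 3 * \<eta> * c"
  proof -
    have "\<bar>y - z\<bar> \<le> 2 * \<eta>" using y z by linarith
    then have "\<bar>g - b\<bar> * \<bar>y - z\<bar> \<le> c * (2 * \<eta>)" using gb by (intro mult_mono) auto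
    then have "\<bar>(g - b) * (y - z) / 2\<bar> \<le> c * \<eta>" by (simp add: abs_mult)
    also have "\<dots> \<le> 3 * \<eta> * c"
    proof -
      have "0 \<le> c * \<eta>" using gb \<eta> by (intro mult_nonneg_nonneg) auto
      then show ?thesis by (simp add: mult_ac)
    qed
    finally show ?thesis .
  qed
  show ?thesis unfolding eq using 1 2 3 by (simp add: distrib_left)
qed

lemma uniform_grid_modulus:
  fixes f :: "real \<Rightarrow> real" and N :: "nat \<Rightarrow> nat"
  assumes f: "continuous_on {s..s+L} f" and L: "0 < L"
    and N: "filterlim N at_top sequentially" and e: "0 < e"
  shows "\<forall>\<^sub>F i in sequentially. \<forall>a\<in>{s..s+L}. \<forall>b\<in>{s..s+L}. \<bar>a - b\<bar> \<le> L / N i \<longrightarrow> \<bar>f a - f b\<bar> < e"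
proof -
  have "uniformly_continuous_on {s..s+L} f"
    using f by (rule compact_uniformly_continuous) simp
  then obtain d where d: "0 < d" "\<forall>a\<in>{s..s+L}. \<forall>b\<in>{s..s+L}. dist b a < d \<longrightarrow> dist (f b) (f a) < e"
    using e unfolding uniformly_continuous_on_def by metis
  have "(\<lambda>i. L / real (N i)) \<longlonglongrightarrow> 0"
    by (intro tendsto_divide_0[OF tendsto_const] filterlim_at_top_imp_at_infinity
        filterlim_compose[OF filterlim_real_sequentially N])
  then have "\<forall>\<^sub>F i in sequentially. L / N i < d"
    using d by (simp add: order_tendstoD)
  then show ?thesis
    by eventually_elim (use d in \<open>auto simp: dist_real_def\<close>)
qed

text \<open>
  The pathwise core of Ito's product rule for \<open>x D\<close>, where \<open>D\<close> is the reciprocal of the expected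
  solution. The drift contributes \<open>I\<close>; \<open>e\<close> is the part of the Ito integral over a grid interval
  that the left-endpoint term misses, and \<open>e'\<close> an approximation of it by a finer left sum. All
  probabilistic input is in the five limits of sums, the last two of which say that the
  quadratic variation of \<open>w\<close> is the elapsed time.
\<close>

lemma product_constant_of_euler_sums:
  fixes x w B D :: "real \<Rightarrow> real" and N :: "nat \<Rightarrow> nat" and I e e' :: "nat \<Rightarrow> nat \<Rightarrow> real"
    and \<delta> :: "nat \<Rightarrow> real" and s L c \<sigma> :: real
  defines "t \<equiv> \<lambda>i k. s + real k * (L / real (N i))"
  defines "h \<equiv> \<lambda>i. L / real (N i)"
  assumes L: "0 < L" and \<sigma>: "0 < \<sigma>" and c: "0 \<le> c"
    and N: "filterlim N at_top sequentially" and N0: "\<And>i. 0 < N i"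
    and x: "continuous_on {s..s+L} x" and w: "continuous_on {s..s+L} w"
    and B: "\<And>a b. a \<in> {s..s+L} \<Longrightarrow> b \<in> {s..s+L} \<Longrightarrow> \<bar>B a - B b\<bar> \<le> c * \<bar>a - b\<bar>"
    and D: "\<And>a. D a = exp (- B a - \<sigma> * w a + \<sigma>^2 * (a - s) / 2)"
    and incr: "\<And>i k. k < N i \<Longrightarrow>
      x (t i (Suc k)) - x (t i k) = I i k + \<sigma> * x (t i k) * (w (t i (Suc k)) - w (t i k)) + e i k"
    and I: "\<And>i k. k < N i \<Longrightarrow> \<bar>I i k - (B (t i (Suc k)) - B (t i k)) * x (t i k)\<bar> \<le> \<delta> i * h i"
    and \<delta>: "\<delta> \<longlonglongrightarrow> 0"
    and e: "(\<lambda>i. \<Sum>k<N i. \<bar>e i k - e' i k\<bar>) \<longlonglongrightarrow> 0"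
    and De: "(\<lambda>i. \<Sum>k<N i. D (t i k) * e' i k) \<longlonglongrightarrow> 0"
    and e2: "(\<lambda>i. \<Sum>k<N i. (e' i k)^2) \<longlonglongrightarrow> 0"
    and q: "(\<lambda>i. \<Sum>k<N i. (w (t i (Suc k)) - w (t i k))^2 - h i) \<longlonglongrightarrow> 0"
    and Dxq: "(\<lambda>i. \<Sum>k<N i. D (t i k) * x (t i k) * ((w (t i (Suc k)) - w (t i k))^2 - h i)) \<longlonglongrightarrow> 0"
  shows "x (s + L) * D (s + L) = x s * D s"
proof -
  define dw where "dw i k = w (t i (Suc k)) - w (t i k)" for i k
  define b where "b i k = B (t i (Suc k)) - B (t i k)" for i k
  define g where "g i = \<sigma>^2 / 2 * h i" for i
  \<comment> \<open>\<open>y\<close> is the logarithmic increment of \<open>D\<close> over one grid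
    interval, as \<open>Dstep\<close> shows; \<open>g\<close> is the Ito correction contained in
    it.\<close>
  define y where "y i k = g i - b i k - \<sigma> * dw i k" for i k
  define c' where "c' = c + \<sigma>^2 / 2"
  \<comment> \<open>\<open>m\<close> is the largest increment of \<open>w\<close> on the grid. It
    tends to 0 by uniform continuity, and so does \<eta>, which dominates both \<open>y\<close> and
    \<sigma> \<open>dw\<close>.\<close>
  define m where "m i = Max ((\<lambda>k. \<bar>dw i k\<bar>) ` {..<N i})" for i
  define \<eta> where "\<eta> i = \<sigma> * m i + c' * h i" for i
  have hpos: "0 < h i" for i using L N0[of i] by (simp add: h_def)
  have Nh: "real (N i) * h i = L" for i using N0[of i] by (simp add: h_def)
  have tmem: "t i k \<in> {s..s+L}" if "k \<le> N i" for i k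
  proof -
    have "real k * h i \<le> real (N i) * h i" using that hpos[of i] by (intro mult_right_mono) auto
    then have "real k * h i \<le> L" by (simp add: Nh)
    moreover have "0 \<le> real k * h i" using hpos[of i] by simp
    ultimately show ?thesis by (simp add: t_def h_def)
  qed
  have tS: "t i (Suc k) - t i k = h i" for i k by (simp add: t_def h_def algebra_simps add_divide_distrib)
  have t0: "t i 0 = s" "t i (N i) = s + L" for i using Nh[of i] by (auto simp: t_def h_def)
  have h0: "h \<longlonglongrightarrow> 0" unfolding h_def
    by (intro tendsto_divide_0[OF tendsto_const] filterlim_at_top_imp_at_infinity
        filterlim_compose[OF filterlim_real_sequentially N])
  have dwm: "\<bar>dw i k\<bar> \<le> m i" if "k < N i" for i k
    unfolding m_def using that by (intro Max_ge) auto
  have m0: "m \<longlonglongrightarrow> 0"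
  proof (rule LIMSEQ_I)
    fix r :: real assume r: "0 < r"
    have "\<forall>\<^sub>F i in sequentially. norm (m i - 0) < r"
      using uniform_grid_modulus[OF w L N r]
    proof eventually_elim
      case (elim i)
      have "\<bar>dw i k\<bar> < r" if "k < N i" for k
        unfolding dw_def using that tmem[of k i] tmem[of "Suc k" i] tS[of i k] hpos[of i] elim
        by (auto simp: h_def)
      then have "m i < r" unfolding m_def using N0[of i] by (subst Max_less_iff) (auto simp: lessThan_empty_iff)
      moreover have "0 \<le> m i" using dwm[OF N0[of i]] by linarith
      ultimately show ?case by simp
    qed
    then show "\<exists>no. \<forall>n\<ge>no. norm (m n - 0) < r" by (simp add: eventually_sequentially)
  qed
  have \<eta>0: "\<eta> \<longlonglongrightarrow> 0"
    unfolding \<eta>_def using tendsto_add[OF tendsto_mult_left[OF m0, of \<sigma>] tendsto_mult_left[OF h0, of c']] by simp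
  have c'0: "0 \<le> c'" using c by (simp add: c'_def)
  have mge: "0 \<le> m i" for i using dwm[OF N0[of i]] by linarith
  have gb: "\<bar>g i - b i k\<bar> \<le> c' * h i" if "k < N i" for i k
  proof -
    have "\<bar>b i k\<bar> \<le> c * h i"
      unfolding b_def using B[OF tmem[of "Suc k" i] tmem[of k i]] that hpos[of i] by (simp add: tS)
    moreover have "0 \<le> g i" using hpos[of i] by (simp add: g_def)
    ultimately show ?thesis unfolding c'_def g_def by (simp add: distrib_right)
  qed
  have \<sigma>dw: "\<bar>\<sigma> * dw i k\<bar> \<le> \<eta> i" if "k < N i" for i k
  proof -
    have "\<bar>\<sigma> * dw i k\<bar> \<le> \<sigma> * m i" using dwm[OF that] \<sigma> by (simp add: abs_mult)
    also have "\<dots> \<le> \<eta> i" unfolding \<eta>_def using c'0 hpos[of i] by simp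
    finally show ?thesis .
  qed
  have ym: "\<bar>y i k\<bar> \<le> \<eta> i" if "k < N i" for i k
  proof -
    have "\<bar>\<sigma> * dw i k\<bar> \<le> \<sigma> * m i" using dwm[OF that] \<sigma> by (simp add: abs_mult)
    then show ?thesis unfolding y_def \<eta>_def using gb[OF that] by linarith
  qed
  have Dstep: "D (t i (Suc k)) = D (t i k) * exp (y i k)" for i k
    unfolding D exp_add[symmetric]
    by (simp add: y_def g_def b_def dw_def tS[of i k, symmetric] algebra_simps add_divide_distrib diff_divide_distrib)
  have contD: "bounded (D ` {s..s+L})"
  proof -
    have "continuous_on {s..s+L} B"
    proof (rule lipschitz_on_continuous_on)
      show "c-lipschitz_on {s..s+L} B"
        by (rule lipschitz_onI) (use B c in \<open>auto simp: dist_real_def\<close>)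
    qed
    then have "continuous_on {s..s+L} (\<lambda>a. exp (- B a - \<sigma> * w a + \<sigma>^2 * (a - s) / 2))"
      by (intro continuous_intros w) auto
    then have "continuous_on {s..s+L} D" unfolding D[abs_def] .
    then show ?thesis by (intro compact_imp_bounded compact_continuous_image) auto
  qed
  then obtain Md where Md: "0 < Md" "\<And>a. a \<in> {s..s+L} \<Longrightarrow> \<bar>D a\<bar> \<le> Md"
    unfolding bounded_pos by auto
  have "bounded (x ` {s..s+L})" using x by (intro compact_imp_bounded compact_continuous_image) auto
  then obtain Mx where Mx: "0 < Mx" "\<And>a. a \<in> {s..s+L} \<Longrightarrow> \<bar>x a\<bar> \<le> Mx"
    unfolding bounded_pos by auto
  \<comment> \<open>The relative change of the product of \<open>x\<close> and \<open>D\<close> in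
    one step if the drift and the Ito integral both consisted of their left-endpoint terms
    only.\<close>
  define \<zeta> where "\<zeta> i k = (1 + b i k + \<sigma> * dw i k) * exp (y i k) - 1" for i k
  define V where "V i = (\<Sum>k<N i. (y i k)^2)" for i
  \<comment> \<open>The sum of the squares of \<open>y\<close> is bounded but need not become small:
    by (p + q)^2 \<le> 2 p^2 + 2 q^2 it is at most \<open>U\<close>, whose limit 2 \<sigma>^2 L
    comes from the quadratic variation.\<close>
  define U where "U i = 2 * \<sigma>^2 * ((\<Sum>k<N i. (dw i k)^2 - h i) + L) + 2 * c'^2 * L * h i" for i
  have VU: "V i \<le> U i" for i
  proof -
    have "V i \<le> (\<Sum>k<N i. 2 * \<sigma>^2 * (dw i k)^2 + 2 * c'^2 * (h i)^2)"
      unfolding V_def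
    proof (intro sum_mono)
      fix k assume "k \<in> {..<N i}"
      then have "\<bar>y i k\<bar> \<le> \<bar>\<sigma> * dw i k\<bar> + c' * h i" unfolding y_def using gb[of k i] by auto
      then have "(y i k)^2 \<le> (\<bar>\<sigma> * dw i k\<bar> + c' * h i)^2"
        using abs_le_square_iff[of "y i k" "\<bar>\<sigma> * dw i k\<bar> + c' * h i"] c'0 hpos[of i] by auto
      also have "\<dots> \<le> 2 * (\<bar>\<sigma> * dw i k\<bar>)^2 + 2 * (c' * h i)^2"
        by (smt (verit) power2_diff power2_sum zero_le_power2)
      finally show "(y i k)^2 \<le> 2 * \<sigma>^2 * (dw i k)^2 + 2 * c'^2 * (h i)^2"
        by (simp add: power_mult_distrib)
    qed
    also have "\<dots> = 2 * \<sigma>^2 * (\<Sum>k<N i. (dw i k)^2) + 2 * c'^2 * (real (N i) * h i) * h i"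
      by (simp add: sum.distrib sum_distrib_left power2_eq_square mult_ac)
    also have "(\<Sum>k<N i. (dw i k)^2) = (\<Sum>k<N i. (dw i k)^2 - h i) + L"
      using Nh[of i] by (simp add: sum_subtractf)
    finally show ?thesis by (simp add: U_def Nh)
  qed
  have Ulim: "U \<longlonglongrightarrow> 2 * \<sigma>^2 * L"
  proof -
    have "U \<longlonglongrightarrow> 2 * \<sigma>^2 * (0 + L) + 2 * c'^2 * L * 0"
      unfolding U_def by (intro tendsto_intros h0 q[folded dw_def])
    then show ?thesis by simp
  qed
  have V0: "0 \<le> V i" for i unfolding V_def by (intro sum_nonneg) auto
  \<comment> \<open>One summand for each of the six sums into which the telescoped product is split
    below, in the same order.\<close>
  define R where "R i = \<sigma>^2 / 2 * \<bar>\<Sum>k<N i. D (t i k) * x (t i k) * ((dw i k)^2 - h i)\<bar>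
      + Md * Mx * (3 * \<eta> i * (U i + \<sigma>^2 / 2 * L + c' * L)) + Md * (\<bar>\<delta> i\<bar> * L)
      + Md * (\<Sum>k<N i. \<bar>e i k - e' i k\<bar>) + \<bar>\<Sum>k<N i. D (t i k) * e' i k\<bar>
      + Md * (3 * sqrt (U i) * sqrt (\<Sum>k<N i. (e' i k)^2))" for i
  have R0: "R \<longlonglongrightarrow> 0"
  proof -
    have "R \<longlonglongrightarrow> \<sigma>^2 / 2 * \<bar>0\<bar> + Md * Mx * (3 * 0 * (2 * \<sigma>^2 * L + \<sigma>^2 / 2 * L + c' * L)) + Md * (\<bar>0\<bar> * L)
      + Md * 0 + \<bar>0\<bar> + Md * (3 * sqrt (2 * \<sigma>^2 * L) * sqrt 0)"
      unfolding R_def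
      by (intro tendsto_intros \<eta>0 Ulim \<delta> e De e2 Dxq[folded dw_def])
    then show ?thesis by simp
  qed
  have "\<forall>\<^sub>F i in sequentially. \<eta> i < 1" using \<eta>0 by (simp add: order_tendstoD)
  then have bound: "\<forall>\<^sub>F i in sequentially. \<bar>x (s + L) * D (s + L) - x s * D s\<bar> \<le> R i"
  proof eventually_elim
    case (elim i)
    have "x (s + L) * D (s + L) - x s * D s
      = (\<Sum>k<N i. x (t i (Suc k)) * D (t i (Suc k)) - x (t i k) * D (t i k))"
      by (subst sum_lessThan_telescope) (simp add: t0)
    \<comment> \<open>The leading part g - (\<sigma> dw)^2 / 2 is - \<sigma>^2 / 2 times the
      compensated square, whose weighted sum vanishes in the limit; this is the cancellation for
      which \<open>D\<close> is made. The contribution of \<open>e\<close> is split so that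
      \<open>e'\<close> is weighted by \<open>D\<close> at the left endpoint, where a martingale
      estimate applies.\<close>
    also have "\<dots> = (\<Sum>k<N i. - (\<sigma>^2 / 2) * (D (t i k) * x (t i k) * ((dw i k)^2 - h i))
        + D (t i k) * x (t i k) * (\<zeta> i k - (g i - (\<sigma> * dw i k)^2 / 2))
        + D (t i (Suc k)) * (I i k - b i k * x (t i k))
        + D (t i (Suc k)) * (e i k - e' i k) + D (t i k) * e' i k
        + D (t i k) * (exp (y i k) - 1) * e' i k)"
    proof (intro sum.cong refl)
      fix k assume k: "k \<in> {..<N i}"
      have x1: "x (t i (Suc k)) = x (t i k) + I i k + \<sigma> * x (t i k) * dw i k + e i k"
        using incr[of k i] k by (simp add: dw_def)
      show "x (t i (Suc k)) * D (t i (Suc k)) - x (t i k) * D (t i k) =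
        - (\<sigma>^2 / 2) * (D (t i k) * x (t i k) * ((dw i k)^2 - h i))
        + D (t i k) * x (t i k) * (\<zeta> i k - (g i - (\<sigma> * dw i k)^2 / 2))
        + D (t i (Suc k)) * (I i k - b i k * x (t i k))
        + D (t i (Suc k)) * (e i k - e' i k) + D (t i k) * e' i k
        + D (t i k) * (exp (y i k) - 1) * e' i k"
        unfolding x1 Dstep \<zeta>_def g_def by (simp add: field_simps power2_eq_square)
    qed
    also have "\<dots> = - (\<sigma>^2 / 2) * (\<Sum>k<N i. D (t i k) * x (t i k) * ((dw i k)^2 - h i))
        + (\<Sum>k<N i. D (t i k) * x (t i k) * (\<zeta> i k - (g i - (\<sigma> * dw i k)^2 / 2)))
        + (\<Sum>k<N i. D (t i (Suc k)) * (I i k - b i k * x (t i k)))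
        + (\<Sum>k<N i. D (t i (Suc k)) * (e i k - e' i k)) + (\<Sum>k<N i. D (t i k) * e' i k)
        + (\<Sum>k<N i. D (t i k) * (exp (y i k) - 1) * e' i k)" (is "_ = ?a + ?b + ?c + ?d + ?e + ?f")
      by (simp only: sum.distrib sum_distrib_left)
    finally have Z: "x (s + L) * D (s + L) - x s * D s = ?a + ?b + ?c + ?d + ?e + ?f" .
    have b': "\<bar>?b\<bar> \<le> Md * Mx * (3 * \<eta> i * (U i + \<sigma>^2 / 2 * L + c' * L))"
    proof -
      have "\<bar>?b\<bar> \<le> (\<Sum>k<N i. \<bar>D (t i k) * x (t i k) * (\<zeta> i k - (g i - (\<sigma> * dw i k)^2 / 2))\<bar>)"
        by (rule sum_abs)
      also have "\<dots> \<le> (\<Sum>k<N i. Md * Mx * (3 * \<eta> i * ((y i k)^2 + g i + c' * h i)))"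
      proof (intro sum_mono)
        fix k assume k: "k \<in> {..<N i}"
        have zz: "\<bar>\<zeta> i k - (g i - (\<sigma> * dw i k)^2 / 2)\<bar> \<le> 3 * \<eta> i * ((y i k)^2 + g i + c' * h i)"
          unfolding \<zeta>_def
          by (rule exp_increment_expansion)
             (use k ym[of k i] \<sigma>dw[of k i] gb[of k i] hpos[of i] elim in \<open>auto simp: y_def g_def\<close>)
        have dd: "\<bar>D (t i k)\<bar> * \<bar>x (t i k)\<bar> \<le> Md * Mx"
          using k Md Mx tmem[of k i] by (intro mult_mono) auto
        show "\<bar>D (t i k) * x (t i k) * (\<zeta> i k - (g i - (\<sigma> * dw i k)^2 / 2))\<bar>
          \<le> Md * Mx * (3 * \<eta> i * ((y i k)^2 + g i + c' * h i))"
          unfolding abs_mult using Md(1) Mx(1) by (intro mult_mono[OF dd zz]) auto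
      qed
      also have "\<dots> = Md * Mx * (3 * \<eta> i * (V i + \<sigma>^2 / 2 * (real (N i) * h i) + c' * (real (N i) * h i)))"
        by (simp add: V_def g_def sum_distrib_left[symmetric] sum.distrib mult_ac)
      also have "\<dots> \<le> Md * Mx * (3 * \<eta> i * (U i + \<sigma>^2 / 2 * L + c' * L))"
        using VU[of i] Md(1) Mx(1) \<sigma> c'0 hpos[of i] mge[of i]
        unfolding Nh \<eta>_def by (intro mult_left_mono add_right_mono mult_nonneg_nonneg add_nonneg_nonneg) auto
      finally show ?thesis .
    qed
    have c1: "\<bar>?c\<bar> \<le> Md * (\<bar>\<delta> i\<bar> * L)"
    proof -
      have "\<bar>?c\<bar> \<le> (\<Sum>k<N i. \<bar>D (t i (Suc k)) * (I i k - b i k * x (t i k))\<bar>)" by (rule sum_abs)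
      also have "\<dots> \<le> (\<Sum>k<N i. Md * (\<bar>\<delta> i\<bar> * h i))"
      proof (intro sum_mono)
        fix k assume k: "k \<in> {..<N i}"
        have "\<bar>I i k - b i k * x (t i k)\<bar> \<le> \<delta> i * h i" using I[of k i] k by (simp add: b_def)
        also have "\<dots> \<le> \<bar>\<delta> i\<bar> * h i" using hpos[of i] by (intro mult_right_mono) auto
        finally show "\<bar>D (t i (Suc k)) * (I i k - b i k * x (t i k))\<bar> \<le> Md * (\<bar>\<delta> i\<bar> * h i)"
          unfolding abs_mult using k Md tmem[of "Suc k" i] by (intro mult_mono) auto
      qed
      also have "\<dots> = Md * (\<bar>\<delta> i\<bar> * (real (N i) * h i))" by simp
      finally show ?thesis by (simp add: Nh)
    qed
    have d1: "\<bar>?d\<bar> \<le> Md * (\<Sum>k<N i. \<bar>e i k - e' i k\<bar>)"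
    proof -
      have "\<bar>?d\<bar> \<le> (\<Sum>k<N i. \<bar>D (t i (Suc k)) * (e i k - e' i k)\<bar>)" by (rule sum_abs)
      also have "\<dots> \<le> (\<Sum>k<N i. Md * \<bar>e i k - e' i k\<bar>)"
        unfolding abs_mult using Md tmem[of "Suc _" i] by (intro sum_mono mult_right_mono) auto
      finally show ?thesis by (simp add: sum_distrib_left)
    qed
    have f1: "\<bar>?f\<bar> \<le> Md * (3 * sqrt (U i) * sqrt (\<Sum>k<N i. (e' i k)^2))"
    proof -
      have "\<bar>?f\<bar> \<le> (\<Sum>k<N i. \<bar>D (t i k) * (exp (y i k) - 1) * e' i k\<bar>)" by (rule sum_abs)
      also have "\<dots> \<le> (\<Sum>k<N i. Md * (3 * (\<bar>y i k\<bar> * \<bar>e' i k\<bar>)))"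
      proof (intro sum_mono)
        fix k assume k: "k \<in> {..<N i}"
        have "\<bar>exp (y i k) - 1\<bar> \<le> 3 * \<bar>y i k\<bar>"
          using k ym[of k i] elim by (intro abs_exp_minus_one_le) auto
        then have "\<bar>D (t i k)\<bar> * \<bar>exp (y i k) - 1\<bar> \<le> Md * (3 * \<bar>y i k\<bar>)"
          using k Md tmem[of k i] by (intro mult_mono) auto
        then have "\<bar>D (t i k)\<bar> * \<bar>exp (y i k) - 1\<bar> * \<bar>e' i k\<bar> \<le> Md * (3 * \<bar>y i k\<bar>) * \<bar>e' i k\<bar>"
          by (rule mult_right_mono) simp
        then show "\<bar>D (t i k) * (exp (y i k) - 1) * e' i k\<bar> \<le> Md * (3 * (\<bar>y i k\<bar> * \<bar>e' i k\<bar>))"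
          by (simp add: abs_mult mult_ac)
      qed
      also have "\<dots> = Md * (3 * (\<Sum>k<N i. \<bar>y i k\<bar> * \<bar>e' i k\<bar>))" by (simp add: sum_distrib_left)
      \<comment> \<open>Cauchy-Schwarz: \<open>y\<close> is merely bounded in the Euclidean norm,
        while \<open>e'\<close> tends to 0 in it.\<close>
      also have "(\<Sum>k<N i. \<bar>y i k\<bar> * \<bar>e' i k\<bar>) \<le> sqrt (V i) * sqrt (\<Sum>k<N i. (e' i k)^2)"
        using L2_set_mult_ineq[of "y i" "e' i" "{..<N i}"] by (simp add: L2_set_def V_def)
      also have "\<dots> \<le> sqrt (U i) * sqrt (\<Sum>k<N i. (e' i k)^2)"
        using VU[of i] by (intro mult_right_mono) (auto intro: sum_nonneg)
      finally show ?thesis using Md(1) by (simp add: mult_ac)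
    qed
    have a1: "\<bar>?a\<bar> = \<sigma>^2 / 2 * \<bar>\<Sum>k<N i. D (t i k) * x (t i k) * ((dw i k)^2 - h i)\<bar>"
      by (simp add: abs_mult)
    show ?case unfolding R_def Z using a1 b' c1 d1 f1 by linarith
  qed
  have "\<bar>x (s + L) * D (s + L) - x s * D s\<bar> \<le> 0"
    by (rule tendsto_le[OF _ R0 tendsto_const bound]) simp
  then show ?thesis by simp
qed

section \<open>Mean-square estimates for sums of Brownian increments\<close>

context noise begin

lemma increment_moments:
  assumes "s \<le> u" "u < v"
  shows "integrable M (\<lambda>\<omega>. (W v \<omega> - W u \<omega>)^k)"
    and "expectation (\<lambda>\<omega>. W v \<omega> - W u \<omega>) = 0"
    and "expectation (\<lambda>\<omega>. (W v \<omega> - W u \<omega>)^2) = v - u"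
    and "expectation (\<lambda>\<omega>. (W v \<omega> - W u \<omega>)^4) = 3 * (v - u)^2"
proof -
  note d = W_increment[OF assms]
  have pos: "0 < sqrt (v - u)" using assms by simp
  show "integrable M (\<lambda>\<omega>. (W v \<omega> - W u \<omega>)^k)"
    using integrable_normal_moment[OF pos, of 0 k]
    by (subst distributed_integrable[OF d, of "\<lambda>x. x^k", symmetric]) auto
  show "expectation (\<lambda>\<omega>. W v \<omega> - W u \<omega>) = 0"
    using integral_normal_moment_odd[OF pos, of 0 0]
    by (subst distributed_integral[OF d, of "\<lambda>x. x", symmetric]) auto
  show "expectation (\<lambda>\<omega>. (W v \<omega> - W u \<omega>)^2) = v - u"
    using integral_normal_moment_even[OF pos, of 0 1] assms
    by (subst distributed_integral[OF d, of "\<lambda>x. x^2", symmetric]) auto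
  have "fact 4 / ((2 / (sqrt (v - u))^2)^2 * fact 2) = 3 * (v - u)^2"
    using assms by (simp add: fact_numeral field_simps)
  then show "expectation (\<lambda>\<omega>. (W v \<omega> - W u \<omega>)^4) = 3 * (v - u)^2"
    using integral_normal_moment_even[OF pos, of 0 2]
    by (subst distributed_integral[OF d, of "\<lambda>x. x^4", symmetric]) auto
qed

text \<open>A discrete Ito isometry. \<open>H k\<close> is known at time \<open>t k\<close>, and
  \<open>f\<close> of the next increment is centred and independent of the past, so the cross terms
  vanish. \<open>f\<close> is left open to cover both the increment and its compensated square;
  adaptedness of the partial sum is part of the induction because the cross term relies on
  it.\<close>

lemma increment_sum_L2:
  fixes t :: "nat \<Rightarrow> real" and H :: "nat \<Rightarrow> 'w \<Rightarrow> real" and f :: "real \<Rightarrow> real"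
  defines "S \<equiv> \<lambda>n \<omega>. \<Sum>k<n. H k \<omega> * f (W (t (Suc k)) \<omega> - W (t k) \<omega>)"
  assumes t0: "s \<le> t 0" and t: "\<And>k. t k < t (Suc k)"
    and H: "\<And>k. H k \<in> borel_measurable (full_filtration (t k))"
    and C: "\<And>k \<omega>. \<omega> \<in> space M \<Longrightarrow> \<bar>H k \<omega>\<bar> \<le> C"
    and f [measurable]: "f \<in> borel_measurable borel"
    and f2: "\<And>k. integrable M (\<lambda>\<omega>. (f (W (t (Suc k)) \<omega> - W (t k) \<omega>))^2)"
    and f1: "\<And>k. expectation (\<lambda>\<omega>. f (W (t (Suc k)) \<omega> - W (t k) \<omega>)) = 0"
    and q: "\<And>k. expectation (\<lambda>\<omega>. (f (W (t (Suc k)) \<omega> - W (t k) \<omega>))^2) = q k"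
  shows "S n \<in> borel_measurable (full_filtration (t n)) \<and> integrable M (\<lambda>\<omega>. (S n \<omega>)^2) \<and>
    expectation (\<lambda>\<omega>. (S n \<omega>)^2) = (\<Sum>k<n. expectation (\<lambda>\<omega>. (H k \<omega>)^2) * q k)"
proof (induction n)
  case 0
  then show ?case by (simp add: S_def)
next
  case (Suc n)
  have st: "s \<le> t k" for k by (induction k) (use t0 t in \<open>auto intro: order_trans less_imp_le\<close>)
  define Z where "Z \<omega> = f (W (t (Suc n)) \<omega> - W (t n) \<omega>)" for \<omega>
  have HF [measurable]: "H n \<in> borel_measurable (full_filtration (t n))" by (rule H)
  have SF [measurable]: "S n \<in> borel_measurable (full_filtration (t n))" using Suc by simp
  note [measurable] = HF[THEN measurable_full_events] SF[THEN measurable_full_events]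
  have ZM [measurable]: "Z \<in> borel_measurable M" unfolding Z_def using st by measurable
  have Z2: "integrable M (\<lambda>\<omega>. (Z \<omega>)^2)" using f2 by (simp add: Z_def)
  have Z1: "integrable M Z" by (rule square_integrable_imp_integrable[OF ZM Z2])
  have S2: "integrable M (\<lambda>\<omega>. (S n \<omega>)^2)" using Suc by simp
  have S1: "integrable M (S n)" by (rule square_integrable_imp_integrable[OF _ S2]) measurable
  \<comment> \<open>Boundedness of \<open>H\<close> makes the past factor of the cross term
    integrable, so that independence can split the expectation.\<close>
  have SH: "integrable M (\<lambda>\<omega>. S n \<omega> * H n \<omega>)"
    by (rule Bochner_Integration.integrable_bound[OF integrable_mult_left[OF S1, of C]])
       (use C in \<open>auto simp: abs_mult intro!: AE_I2 mult_left_mono order_trans[OF C]\<close>)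
  have H2: "integrable M (\<lambda>\<omega>. (H n \<omega>)^2)"
    by (rule integrable_const_bound[of _ "C^2"])
       (use C in \<open>auto intro!: AE_I2 simp: abs_le_square_iff[symmetric] intro: order_trans[OF C]\<close>)
  have i1: "indep_var borel (\<lambda>\<omega>. S n \<omega> * H n \<omega>) borel Z"
    unfolding Z_def by (intro indep_var_increment st t) measurable
  have i2: "indep_var borel (\<lambda>\<omega>. (H n \<omega>)^2) borel (\<lambda>\<omega>. (Z \<omega>)^2)"
    unfolding Z_def by (intro indep_var_increment[where f = "\<lambda>x. (f x)^2"] st t) measurable
  have e1: "integrable M (\<lambda>\<omega>. S n \<omega> * H n \<omega> * Z \<omega>)" "expectation (\<lambda>\<omega>. S n \<omega> * H n \<omega> * Z \<omega>) = 0"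
    using indep_var_integrable[OF i1 SH Z1] indep_var_lebesgue_integral[OF i1 SH Z1] f1[of n]
    by (simp_all add: Z_def)
  have e2: "integrable M (\<lambda>\<omega>. (H n \<omega>)^2 * (Z \<omega>)^2)"
    "expectation (\<lambda>\<omega>. (H n \<omega>)^2 * (Z \<omega>)^2) = expectation (\<lambda>\<omega>. (H n \<omega>)^2) * q n"
    using indep_var_integrable[OF i2 H2 Z2] indep_var_lebesgue_integral[OF i2 H2 Z2] q[of n]
    by (simp_all add: Z_def)
  have eq: "(S (Suc n) \<omega>)^2 = (S n \<omega>)^2 + 2 * (S n \<omega> * H n \<omega> * Z \<omega>) + (H n \<omega>)^2 * (Z \<omega>)^2" for \<omega>
    by (simp add: S_def Z_def power2_eq_square algebra_simps)
  have "(\<lambda>\<omega>. S n \<omega> + H n \<omega> * Z \<omega>) \<in> borel_measurable (full_filtration (t (Suc n)))"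
  proof -
    note [measurable] = HF[THEN measurable_full_mono, OF less_imp_le, OF t]
      SF[THEN measurable_full_mono, OF less_imp_le, OF t]
    have [measurable]: "W (t (Suc n)) \<in> borel_measurable (full_filtration (t (Suc n)))"
      "W (t n) \<in> borel_measurable (full_filtration (t (Suc n)))"
      using st[of n] st[of "Suc n"] t[of n] by (auto intro!: W_measurable_full)
    show ?thesis unfolding Z_def by measurable
  qed
  moreover have "S (Suc n) = (\<lambda>\<omega>. S n \<omega> + H n \<omega> * Z \<omega>)" by (simp add: S_def Z_def fun_eq_iff)
  ultimately show ?case
    unfolding eq using S2 e1 e2 Suc by simp
qed

end

section \<open>The time spent in the switched state, and the drift integral\<close>

definition occupation :: "('w \<Rightarrow> ereal) \<Rightarrow> real \<Rightarrow> 'w \<Rightarrow> real" where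
  "occupation \<theta> a \<omega> = (if \<theta> \<omega> \<le> ereal a then a - real_of_ereal (\<theta> \<omega>) else 0)"

lemma occupation_measurable [measurable]:
  assumes [measurable]: "\<theta> \<in> borel_measurable N"
  shows "occupation \<theta> a \<in> borel_measurable N"
  unfolding occupation_def by measurable

lemma occupation_real: "\<theta> \<omega> = ereal r \<Longrightarrow> occupation \<theta> a \<omega> = max 0 (a - r)"
  by (auto simp: occupation_def)

lemma occupation_inf: "\<theta> \<omega> = \<infinity> \<Longrightarrow> occupation \<theta> a \<omega> = 0"
  by (auto simp: occupation_def)

lemma occupation_cases:
  assumes "ereal s \<le> \<theta> \<omega>"
  obtains (real) r where "\<theta> \<omega> = ereal r" "s \<le> r" | (inf) "\<theta> \<omega> = \<infinity>"
  using assms by (cases "\<theta> \<omega>") auto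

lemma occupation_lipschitz:
  assumes "ereal s \<le> \<theta> \<omega>"
  shows "\<bar>occupation \<theta> a \<omega> - occupation \<theta> b \<omega>\<bar> \<le> \<bar>a - b\<bar>"
  using assms by (cases rule: occupation_cases) (auto simp: occupation_real occupation_inf)

lemma occupation_start: "ereal s \<le> \<theta> \<omega> \<Longrightarrow> occupation \<theta> s \<omega> = 0"
  by (erule occupation_cases) (auto simp: occupation_real occupation_inf)

lemma set_integral_state_process:
  assumes \<theta>: "ereal s \<le> \<theta> \<omega>" and ab: "a \<le> b"
  shows "(LBINT z:{a<..b}. state_process \<theta> z \<omega>) = occupation \<theta> b \<omega> - occupation \<theta> a \<omega>"
    and "set_integrable lborel {a<..b} (\<lambda>z. state_process \<theta> z \<omega>)"
proof -
  have eq: "indicator {a<..b} z *\<^sub>R state_process \<theta> z \<omega> = indicator {z. a < z \<and> z \<le> b \<and> \<theta> \<omega> \<le> ereal z} z" for z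
    by (auto simp: state_process_def indicator_def)
  have m: "{z. a < z \<and> z \<le> b \<and> \<theta> \<omega> \<le> ereal z} \<in> sets lborel" by measurable
  have f: "emeasure lborel {z. a < z \<and> z \<le> b \<and> \<theta> \<omega> \<le> ereal z} < \<infinity>"
    by (rule le_less_trans[OF emeasure_mono[of _ "{a..b}"]]) (auto simp: ab)
  show "set_integrable lborel {a<..b} (\<lambda>z. state_process \<theta> z \<omega>)"
    unfolding set_integrable_def eq using m f by simp
  have "measure lborel {z. a < z \<and> z \<le> b \<and> \<theta> \<omega> \<le> ereal z} = occupation \<theta> b \<omega> - occupation \<theta> a \<omega>"
    using \<theta>
  proof (cases rule: occupation_cases)
    case (real r)
    consider "r \<le> a" | "a < r" "r \<le> b" | "b < r" by linarith
    then show ?thesis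
    proof cases
      case 1
      then have "{z. a < z \<and> z \<le> b \<and> \<theta> \<omega> \<le> ereal z} = {a<..b}" by (auto simp: real)
      then show ?thesis using 1 ab by (simp add: occupation_real real)
    next
      case 2
      then have "{z. a < z \<and> z \<le> b \<and> \<theta> \<omega> \<le> ereal z} = {r..b}" by (auto simp: real)
      then show ?thesis using 2 ab by (simp add: occupation_real real)
    next
      case 3
      then have "{z. a < z \<and> z \<le> b \<and> \<theta> \<omega> \<le> ereal z} = {}" by (auto simp: real)
      then have "measure lborel {z. a < z \<and> z \<le> b \<and> \<theta> \<omega> \<le> ereal z} = 0"
        by (simp only: measure_empty)
      then show ?thesis using 3 ab by (simp only: occupation_real[of \<theta> \<omega>, OF real(1)])
    qed
  qed (simp add: occupation_inf)
  then show "(LBINT z:{a<..b}. state_process \<theta> z \<omega>) = occupation \<theta> b \<omega> - occupation \<theta> a \<omega>"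
    unfolding set_lebesgue_integral_def eq using m f by simp
qed

text \<open>On (a, b] the factor \<open>f\<close> is frozen at the left endpoint; the remaining
  coefficient integrates to the increment of the accumulated drift. That coefficient is at most
  \<bar>\<mu>0\<bar> + \<bar>d\<bar> in either state, so the jump at \<theta> does not spoil the
  error bound.\<close>

lemma switching_drift_increment:
  fixes f :: "real \<Rightarrow> real"
  assumes \<theta>: "ereal s \<le> \<theta> \<omega>" and ab: "s \<le> a" "a \<le> b" and f: "continuous_on {s..b} f"
    and \<eta>: "\<And>z. z \<in> {a..b} \<Longrightarrow> \<bar>f z - f a\<bar> \<le> \<eta>"
  shows "\<bar>(LBINT z:{s..b}. (\<mu>0 - d * state_process \<theta> z \<omega>) * f z)
     - (LBINT z:{s..a}. (\<mu>0 - d * state_process \<theta> z \<omega>) * f z)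
     - ((\<mu>0 * (b - s) - d * occupation \<theta> b \<omega>) - (\<mu>0 * (a - s) - d * occupation \<theta> a \<omega>)) * f a\<bar>
    \<le> (\<bar>\<mu>0\<bar> + \<bar>d\<bar>) * \<eta> * (b - a)"
proof -
  define \<phi> where "\<phi> z = \<mu>0 - d * state_process \<theta> z \<omega>" for z
  have \<phi>m [measurable]: "\<phi> \<in> borel_measurable borel"
    unfolding \<phi>_def[abs_def] state_process_def by measurable
  have \<phi>b: "\<bar>\<phi> z\<bar> \<le> \<bar>\<mu>0\<bar> + \<bar>d\<bar>" for z
    unfolding \<phi>_def state_process_def by auto
  have \<eta>0: "0 \<le> \<eta>" using \<eta>[of a] ab by simp
  have int: "set_integrable lborel {s..b} (\<lambda>z. \<phi> z * f z)"
  proof -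
    have f1: "set_integrable lborel {s..b} f" using f by (rule borel_integrable_atLeastAtMost')
    have [measurable]: "(\<lambda>z. indicator {s..b} z *\<^sub>R f z) \<in> borel_measurable borel"
      using f1 unfolding set_integrable_def by (auto dest: borel_measurable_integrable)
    have "integrable lborel (\<lambda>z. \<phi> z * (indicator {s..b} z *\<^sub>R f z))"
    proof (rule Bochner_Integration.integrable_bound)
      show "integrable lborel (\<lambda>z. (\<bar>\<mu>0\<bar> + \<bar>d\<bar>) * (indicator {s..b} z *\<^sub>R f z))"
        using f1 unfolding set_integrable_def by (rule integrable_mult_right)
      show "AE x in lborel. norm (\<phi> x * (indicator {s..b} x *\<^sub>R f x))
          \<le> norm ((\<bar>\<mu>0\<bar> + \<bar>d\<bar>) * (indicator {s..b} x *\<^sub>R f x))"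
        using \<phi>b by (auto intro!: AE_I2 mult_right_mono simp: abs_mult)
    qed measurable
    then show ?thesis unfolding set_integrable_def by (simp add: mult_ac)
  qed
  have i1: "set_integrable lborel {s..a} (\<lambda>z. \<phi> z * f z)"
    and i2: "set_integrable lborel {a<..b} (\<lambda>z. \<phi> z * f z)"
    using ab by (auto intro: set_integrable_subset[OF int])
  have "{s..b} = {s..a} \<union> {a<..b}" "{s..a} \<inter> {a<..b} = {}" using ab by auto
  then have "(LBINT z:{s..b}. \<phi> z * f z) - (LBINT z:{s..a}. \<phi> z * f z) = (LBINT z:{a<..b}. \<phi> z * f z)"
    using set_integral_Un[OF _ i1 i2] by simp
  moreover have i3: "set_integrable lborel {a<..b} \<phi>"
    unfolding \<phi>_def[abs_def] using ab set_integral_state_process(2)[of s \<theta> \<omega> a b, OF \<theta> ab(2)]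
    by (intro set_integral_diff set_integrable_mult_right) (auto simp: set_integrable_def)
  moreover have "(LBINT z:{a<..b}. \<phi> z) =
      (\<mu>0 * (b - s) - d * occupation \<theta> b \<omega>) - (\<mu>0 * (a - s) - d * occupation \<theta> a \<omega>)"
  proof -
    have "(LBINT z:{a<..b}. \<phi> z) = (LBINT z:{a<..b}. \<mu>0) - (LBINT z:{a<..b}. d * state_process \<theta> z \<omega>)"
      unfolding \<phi>_def[abs_def] using ab set_integral_state_process(2)[of s \<theta> \<omega> a b, OF \<theta> ab(2)]
      by (intro set_integral_diff set_integrable_mult_right) (auto simp: set_integrable_def)
    also have "(LBINT z:{a<..b}. \<mu>0) = \<mu>0 * (b - a)"
      using ab by (simp add: set_lebesgue_integral_def)
    also have "(LBINT z:{a<..b}. d * state_process \<theta> z \<omega>) = d * (occupation \<theta> b \<omega> - occupation \<theta> a \<omega>)"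
      using set_integral_state_process[of s \<theta> \<omega> a b, OF \<theta> ab(2)] by simp
    finally show ?thesis by (simp add: algebra_simps)
  qed
  moreover have "(LBINT z:{a<..b}. \<phi> z * f z) - (LBINT z:{a<..b}. \<phi> z) * f a
      = (LBINT z:{a<..b}. \<phi> z * f z - \<phi> z * f a)"
    using i2 i3 by (subst set_integral_diff) (auto intro: set_integrable_mult_left)
  moreover have "\<bar>LBINT z:{a<..b}. \<phi> z * f z - \<phi> z * f a\<bar> \<le> (\<bar>\<mu>0\<bar> + \<bar>d\<bar>) * \<eta> * (b - a)"
  proof -
    have i4: "set_integrable lborel {a<..b} (\<lambda>z. \<phi> z * f z - \<phi> z * f a)"
      using i2 i3 by (intro set_integral_diff) (auto intro: set_integrable_mult_left)
    have "\<bar>LBINT z:{a<..b}. \<phi> z * f z - \<phi> z * f a\<bar>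
        \<le> (\<integral>z. \<bar>indicator {a<..b} z *\<^sub>R (\<phi> z * f z - \<phi> z * f a)\<bar> \<partial>lborel)"
      unfolding set_lebesgue_integral_def by (rule integral_abs_bound)
    also have "\<dots> \<le> (\<integral>z. indicator {a<..b} z * ((\<bar>\<mu>0\<bar> + \<bar>d\<bar>) * \<eta>) \<partial>lborel)"
    proof (rule integral_mono)
      show "integrable lborel (\<lambda>z. \<bar>indicator {a<..b} z *\<^sub>R (\<phi> z * f z - \<phi> z * f a)\<bar>)"
        using i4 unfolding set_integrable_def by (rule integrable_abs)
      show "integrable lborel (\<lambda>z. indicator {a<..b} z * ((\<bar>\<mu>0\<bar> + \<bar>d\<bar>) * \<eta>))"
        using ab by (intro integrable_mult_left) simp
      fix z :: real
      have "\<bar>\<phi> z * f z - \<phi> z * f a\<bar> \<le> (\<bar>\<mu>0\<bar> + \<bar>d\<bar>) * \<eta>" if "z \<in> {a<..b}"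
        unfolding right_diff_distrib[symmetric] abs_mult using \<phi>b[of z] \<eta>[of z] that
        by (intro mult_mono) auto
      then show "\<bar>indicator {a<..b} z *\<^sub>R (\<phi> z * f z - \<phi> z * f a)\<bar> \<le> indicator {a<..b} z * ((\<bar>\<mu>0\<bar> + \<bar>d\<bar>) * \<eta>)"
        by (auto simp: indicator_def)
    qed
    also have "\<dots> = (\<bar>\<mu>0\<bar> + \<bar>d\<bar>) * \<eta> * (b - a)" using ab by simp
    finally show ?thesis .
  qed
  ultimately show ?thesis by (simp add: \<phi>_def)
qed

definition price_factor ::
  "real \<Rightarrow> real \<Rightarrow> real \<Rightarrow> real \<Rightarrow> (real \<Rightarrow> 'w \<Rightarrow> real) \<Rightarrow> ('w \<Rightarrow> ereal) \<Rightarrow> real \<Rightarrow> 'w \<Rightarrow> real" where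
  "price_factor \<mu>0 \<mu>1 \<sigma> s W \<theta> a \<omega> =
     exp (\<mu>0 * (a - s) - (\<mu>0 - \<mu>1) * occupation \<theta> a \<omega> + \<sigma> * W a \<omega> - \<sigma>^2 * (a - s) / 2)"

context noise begin

text \<open>The isometry on a uniform grid, for weights controlled only at the first
  \<open>n\<close> points. The square of a centred normal variable with variance \<eta> has variance
  3 \<eta>^2 - \<eta>^2, whence the factor 2 \<eta>^2 in the last identity.\<close>

lemma ito_sum_L2:
  fixes H :: "nat \<Rightarrow> 'w \<Rightarrow> real"
  assumes a: "s \<le> a" and \<eta>: "0 < \<eta>"
    and H: "\<And>k. k < n \<Longrightarrow> H k \<in> borel_measurable (full_filtration (a + real k * \<eta>))"
    and C: "\<And>k \<omega>. k < n \<Longrightarrow> \<omega> \<in> space M \<Longrightarrow> \<bar>H k \<omega>\<bar> \<le> C"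
  shows "integrable M (\<lambda>\<omega>. (\<Sum>k<n. H k \<omega> * (W (a + real (Suc k) * \<eta>) \<omega> - W (a + real k * \<eta>) \<omega>))^2)"
    and "expectation (\<lambda>\<omega>. (\<Sum>k<n. H k \<omega> * (W (a + real (Suc k) * \<eta>) \<omega> - W (a + real k * \<eta>) \<omega>))^2)
      = (\<Sum>k<n. expectation (\<lambda>\<omega>. (H k \<omega>)^2) * \<eta>)"
    and "k < n \<Longrightarrow> integrable M (\<lambda>\<omega>. (H k \<omega>)^2)"
    and "integrable M (\<lambda>\<omega>. (\<Sum>k<n. H k \<omega> * ((W (a + real (Suc k) * \<eta>) \<omega> - W (a + real k * \<eta>) \<omega>)^2 - \<eta>))^2)"
    and "expectation (\<lambda>\<omega>. (\<Sum>k<n. H k \<omega> * ((W (a + real (Suc k) * \<eta>) \<omega> - W (a + real k * \<eta>) \<omega>)^2 - \<eta>))^2)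
      = (\<Sum>k<n. expectation (\<lambda>\<omega>. (H k \<omega>)^2) * (2 * \<eta>^2))"
proof -
  define t where "t k = a + real k * \<eta>" for k
  \<comment> \<open>Extension by 0 makes the weights bounded and adapted at all indices.\<close>
  define H' where "H' k = (if k < n then H k else (\<lambda>_. 0))" for k
  have t0: "s \<le> t 0" using a by (simp add: t_def)
  have tS: "t k < t (Suc k)" "t (Suc k) - t k = \<eta>" for k using \<eta> by (auto simp: t_def algebra_simps)
  have st: "s \<le> t k" for k using a \<eta> by (simp add: t_def add_increasing2)
  have H': "H' k \<in> borel_measurable (full_filtration (t k))" for k
    using H by (auto simp: H'_def t_def)
  have C': "\<bar>H' k \<omega>\<bar> \<le> \<bar>C\<bar>" if "\<omega> \<in> space M" for k \<omega>
    using C[of k \<omega>] that by (auto simp: H'_def)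
  note mom = increment_moments[OF st tS(1)]
  have 1: "integrable M (\<lambda>\<omega>. (\<Sum>k<n. H' k \<omega> * (W (t (Suc k)) \<omega> - W (t k) \<omega>))^2) \<and>
    expectation (\<lambda>\<omega>. (\<Sum>k<n. H' k \<omega> * (W (t (Suc k)) \<omega> - W (t k) \<omega>))^2)
      = (\<Sum>k<n. expectation (\<lambda>\<omega>. (H' k \<omega>)^2) * \<eta>)"
    using increment_sum_L2[OF t0 tS(1) H' C', of "\<lambda>x. x" "\<lambda>_. \<eta>" n] mom by (simp add: tS)
  have f2: "(x^2 - \<eta>)^2 = x^4 - 2 * \<eta> * x^2 + \<eta>^2" for x :: real
    by (simp add: power2_eq_square power4_eq_xxxx algebra_simps)
  have 2: "integrable M (\<lambda>\<omega>. (\<Sum>k<n. H' k \<omega> * ((W (t (Suc k)) \<omega> - W (t k) \<omega>)^2 - \<eta>))^2) \<and>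
    expectation (\<lambda>\<omega>. (\<Sum>k<n. H' k \<omega> * ((W (t (Suc k)) \<omega> - W (t k) \<omega>)^2 - \<eta>))^2)
      = (\<Sum>k<n. expectation (\<lambda>\<omega>. (H' k \<omega>)^2) * (2 * \<eta>^2))"
    using increment_sum_L2[OF t0 tS(1) H' C', of "\<lambda>x. x^2 - \<eta>" "\<lambda>_. 2 * \<eta>^2" n] mom
    unfolding f2 by (simp add: tS prob_space) (simp add: power2_eq_square)
  have eq: "(\<Sum>k<n. H' k \<omega> * g k) = (\<Sum>k<n. H k \<omega> * g k)" for \<omega> and g :: "nat \<Rightarrow> real"
    by (intro sum.cong) (auto simp: H'_def)
  have eq2: "(\<Sum>k<n. expectation (\<lambda>\<omega>. (H' k \<omega>)^2) * g) = (\<Sum>k<n. expectation (\<lambda>\<omega>. (H k \<omega>)^2) * g)" for g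
    by (intro sum.cong) (auto simp: H'_def)
  show "integrable M (\<lambda>\<omega>. (\<Sum>k<n. H k \<omega> * (W (a + real (Suc k) * \<eta>) \<omega> - W (a + real k * \<eta>) \<omega>))^2)"
    "expectation (\<lambda>\<omega>. (\<Sum>k<n. H k \<omega> * (W (a + real (Suc k) * \<eta>) \<omega> - W (a + real k * \<eta>) \<omega>))^2)
      = (\<Sum>k<n. expectation (\<lambda>\<omega>. (H k \<omega>)^2) * \<eta>)"
    using 1 unfolding eq eq2 t_def by auto
  show "integrable M (\<lambda>\<omega>. (\<Sum>k<n. H k \<omega> * ((W (a + real (Suc k) * \<eta>) \<omega> - W (a + real k * \<eta>) \<omega>)^2 - \<eta>))^2)"
    "expectation (\<lambda>\<omega>. (\<Sum>k<n. H k \<omega> * ((W (a + real (Suc k) * \<eta>) \<omega> - W (a + real k * \<eta>) \<omega>)^2 - \<eta>))^2)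
      = (\<Sum>k<n. expectation (\<lambda>\<omega>. (H k \<omega>)^2) * (2 * \<eta>^2))"
    using 2 unfolding eq eq2 t_def by auto
  show "integrable M (\<lambda>\<omega>. (H k \<omega>)^2)" if "k < n"
  proof (rule integrable_const_bound[of _ "C^2"])
    show "AE \<omega> in M. norm ((H k \<omega>)^2) \<le> C^2"
      using order_trans[OF C[OF that] abs_ge_self]
      by (auto intro!: AE_I2 simp: abs_le_square_iff[symmetric])
    show "(\<lambda>\<omega>. (H k \<omega>)^2) \<in> borel_measurable M"
      using measurable_full_events[OF H[OF that]] by measurable
  qed
qed

end

lemma sum_blocks: "(\<Sum>j<n * m. f j) = (\<Sum>k<n. \<Sum>j<m. f (k * m + j))" for f :: "nat \<Rightarrow> real"
proof -
  have "(\<Sum>j<m. f (k * m + j)) = sum f {k * m..<k * m + m}" for k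
    using sum.shift_bounds_nat_ivl[of f 0 "k * m" m] by (simp add: atLeast0LessThan add_ac)
  then show ?thesis using sum.nat_group[of f m n] by (simp add: mult.commute)
qed

lemma tendsto_mult_bounded_const:
  fixes f g :: "nat \<Rightarrow> real"
  assumes "\<And>n. 0 \<le> f n" "\<And>n. f n \<le> c * g n" "g \<longlonglongrightarrow> 0"
  shows "f \<longlonglongrightarrow> 0"
proof (rule tendsto_sandwich[of "\<lambda>_. 0"])
  show "(\<lambda>n. c * g n) \<longlonglongrightarrow> 0" using tendsto_mult_left[OF assms(3), of c] by simp
qed (use assms in auto)

context noise begin

text \<open>\<open>e k\<close> is what the fine left sum over a coarse interval adds to the coarse
  left-endpoint term. The isometry reduces the first two summands of \<open>G\<close> to the
  mean-square oscillation of \<xi> within coarse intervals, and the last two to N h^2 = L^2 / N.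
  They are gathered in one \<open>G\<close> so that a single subsequence will serve for all
  four.\<close>

lemma grid_estimates:
  fixes \<xi> d :: "real \<Rightarrow> 'w \<Rightarrow> real" and N m :: nat and L \<sigma> R :: real
  defines "h \<equiv> L / real N"
  defines "\<eta> \<equiv> L / (real N * real m)"
  defines "t \<equiv> \<lambda>k. s + real k * h"
  defines "\<tau> \<equiv> \<lambda>j. s + real j * \<eta>"
  defines "dW \<equiv> \<lambda>j \<omega>. W (\<tau> (Suc j)) \<omega> - W (\<tau> j) \<omega>"
  defines "e \<equiv> \<lambda>k \<omega>. \<Sum>j<m. \<sigma> * (\<xi> (\<tau> (k * m + j)) \<omega> - \<xi> (t k) \<omega>) * dW (k * m + j) \<omega>"
  defines "G \<equiv> \<lambda>\<omega>. (\<Sum>k<N. d (t k) \<omega> * e k \<omega>)^2 + (\<Sum>k<N. (e k \<omega>)^2)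
    + (\<Sum>k<N. (W (t (Suc k)) \<omega> - W (t k) \<omega>)^2 - h)^2
    + (\<Sum>k<N. d (t k) \<omega> * \<xi> (t k) \<omega> * ((W (t (Suc k)) \<omega> - W (t k) \<omega>)^2 - h))^2"
  assumes L: "0 < L" and N: "0 < N" and m: "0 < m"
    and \<xi>: "\<And>a. a \<in> {s..s+L} \<Longrightarrow> \<xi> a \<in> borel_measurable (full_filtration a)"
    and d: "\<And>a. a \<in> {s..s+L} \<Longrightarrow> d a \<in> borel_measurable (full_filtration a)"
    and \<xi>R: "\<And>a \<omega>. \<bar>\<xi> a \<omega>\<bar> \<le> R" and dR: "\<And>a \<omega>. \<bar>d a \<omega>\<bar> \<le> R"
  shows "integrable M G"
    and "expectation G \<le> (R^2 + 1) * \<sigma>^2 *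
        expectation (\<lambda>\<omega>. \<Sum>k<N. \<Sum>j<m. (\<xi> (\<tau> (k * m + j)) \<omega> - \<xi> (t k) \<omega>)^2 * \<eta>)
      + (1 + R^4) * (2 * L^2) / real N"
proof -
  have R0: "0 \<le> R" using order_trans[OF abs_ge_zero \<xi>R] .
  have h: "0 < h" and \<eta>: "0 < \<eta>" using L N m by (auto simp: h_def \<eta>_def)
  have m\<eta>: "real m * \<eta> = h" using m by (simp add: h_def \<eta>_def)
  have t\<tau>: "t k = \<tau> (k * m)" for k
    using m\<eta> by (simp add: t_def \<tau>_def mult_ac)
  have mem: "\<tau> j \<in> {s..s+L}" if "j \<le> N * m" for j
  proof -
    have "real j * \<eta> \<le> real (N * m) * \<eta>" using that \<eta> by (intro mult_right_mono) (auto simp flip: of_nat_mult)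
    also have "\<dots> = L" using N m by (simp add: \<eta>_def)
    finally show ?thesis using \<eta> by (simp add: \<tau>_def)
  qed
  have idx: "k * m + j < N * m" if "k < N" "j < m" for k j
  proof -
    have "k * m + j < Suc k * m" using that by simp
    also have "\<dots> \<le> N * m" using that by (intro mult_le_mono1) auto
    finally show ?thesis .
  qed
  have \<xi>fm: "\<xi> (\<tau> i) \<in> borel_measurable (full_filtration (\<tau> j))" if "i \<le> j" "j \<le> N * m" for i j
    using that \<eta> by (intro measurable_full_mono[OF \<xi>] mem) (auto simp: \<tau>_def)
  have dfm: "d (\<tau> i) \<in> borel_measurable (full_filtration (\<tau> j))" if "i \<le> j" "j \<le> N * m" for i j
    using that \<eta> by (intro measurable_full_mono[OF d] mem) (auto simp: \<tau>_def)
  have d\<xi>: "\<bar>\<xi> a \<omega> - \<xi> b \<omega>\<bar> \<le> 2 * R" for a b \<omega> using \<xi>R[of a \<omega>] \<xi>R[of b \<omega>] by linarith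
  define q where "q k j \<omega> = (\<xi> (\<tau> (k * m + j)) \<omega> - \<xi> (t k) \<omega>)^2" for k j \<omega>
  have qR: "norm (q k j \<omega>) \<le> (2 * R)^2" for k j \<omega>
    unfolding q_def real_norm_def abs_power2 using d\<xi> R0 by (subst power2_le_iff_abs_le) auto
  have qi: "integrable M (q k j)" if "k < N" "j < m" for k j
  proof (rule integrable_const_bound[of _ "(2 * R)^2"])
    show "AE \<omega> in M. norm (q k j \<omega>) \<le> (2 * R)^2" using qR by (rule AE_I2)
    have le: "k * m + j \<le> N * m" "k * m \<le> N * m" using idx[OF that] that by auto
    note [measurable] = \<xi>fm[OF order_refl le(1), THEN measurable_full_events]
      \<xi>fm[OF order_refl le(2), THEN measurable_full_events]
    show "q k j \<in> borel_measurable M"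
      unfolding q_def[abs_def] t\<tau> by measurable
  qed
  define S where "S = expectation (\<lambda>\<omega>. \<Sum>k<N. \<Sum>j<m. q k j \<omega> * \<eta>)"
  have S: "S = (\<Sum>k<N. \<Sum>j<m. expectation (q k j) * \<eta>)"
    unfolding S_def using qi by (subst Bochner_Integration.integral_sum; auto)+

  have Q1: "integrable M (\<lambda>\<omega>. (\<Sum>k<N. d (t k) \<omega> * e k \<omega>)^2) \<and>
      expectation (\<lambda>\<omega>. (\<Sum>k<N. d (t k) \<omega> * e k \<omega>)^2) \<le> R^2 * \<sigma>^2 * S"
  proof -
    \<comment> \<open>The double sum is flattened to the fine grid: \<open>i div m\<close> is the
      coarse interval that contains the fine index \<open>i\<close>, so \<open>H i\<close> is known
      at the fine time \<open>i\<close>.\<close>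
    define H where "H i \<omega> = d (t (i div m)) \<omega> * (\<sigma> * (\<xi> (\<tau> i) \<omega> - \<xi> (t (i div m)) \<omega>))" for i \<omega>
    have Hm: "H i \<in> borel_measurable (full_filtration (s + real i * \<eta>))" if "i < N * m" for i
    proof -
      have le: "i div m * m \<le> i" "i \<le> N * m" using that by simp_all
      note [measurable] = \<xi>fm[OF le] dfm[OF le] \<xi>fm[OF order_refl le(2)]
      have "H i \<in> borel_measurable (full_filtration (\<tau> i))"
        unfolding H_def[abs_def] t\<tau> by measurable
      then show ?thesis by (simp add: \<tau>_def)
    qed
    have HC: "\<bar>H i \<omega>\<bar> \<le> R * (\<bar>\<sigma>\<bar> * (2 * R))" for i \<omega>
      unfolding H_def abs_mult using R0 dR d\<xi> by (intro mult_mono) auto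
    have eq: "(\<Sum>k<N. d (t k) \<omega> * e k \<omega>) = (\<Sum>i<N * m. H i \<omega> * dW i \<omega>)" for \<omega>
      unfolding sum_blocks e_def sum_distrib_left H_def
      using m by (intro sum.cong refl) (auto simp: mult_ac)
    have int: "integrable M (\<lambda>\<omega>. (\<Sum>k<N. d (t k) \<omega> * e k \<omega>)^2)"
      "expectation (\<lambda>\<omega>. (\<Sum>k<N. d (t k) \<omega> * e k \<omega>)^2) = (\<Sum>i<N * m. expectation (\<lambda>\<omega>. (H i \<omega>)^2) * \<eta>)"
      using ito_sum_L2(1,2)[OF order_refl \<eta> Hm HC] unfolding eq dW_def \<tau>_def by auto
    have "(\<Sum>i<N * m. expectation (\<lambda>\<omega>. (H i \<omega>)^2) * \<eta>)
      \<le> (\<Sum>k<N. \<Sum>j<m. R^2 * \<sigma>^2 * (expectation (q k j) * \<eta>))"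
      unfolding sum_blocks
    proof (intro sum_mono)
      fix k j assume kj: "k \<in> {..<N}" "j \<in> {..<m}"
      have "expectation (\<lambda>\<omega>. (H (k * m + j) \<omega>)^2) \<le> expectation (\<lambda>\<omega>. R^2 * \<sigma>^2 * q k j \<omega>)"
      proof (rule integral_mono)
        show "integrable M (\<lambda>\<omega>. (H (k * m + j) \<omega>)^2)"
          using ito_sum_L2(3)[OF order_refl \<eta> Hm HC] idx[of k j] kj by auto
        show "integrable M (\<lambda>\<omega>. R^2 * \<sigma>^2 * q k j \<omega>)" using qi kj by auto
        fix \<omega>
        have "(d (t k) \<omega>)^2 \<le> R^2" using dR R0 by (auto simp: power2_le_iff_abs_le)
        then have "(d (t k) \<omega>)^2 * (\<sigma>^2 * q k j \<omega>) \<le> R^2 * (\<sigma>^2 * q k j \<omega>)"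
          by (rule mult_right_mono) (auto simp: q_def)
        moreover have "(k * m + j) div m = k" using m kj by auto
        ultimately show "(H (k * m + j) \<omega>)^2 \<le> R^2 * \<sigma>^2 * q k j \<omega>"
          by (simp add: H_def q_def power_mult_distrib mult_ac)
      qed
      then show "expectation (\<lambda>\<omega>. (H (k * m + j) \<omega>)^2) * \<eta> \<le> R^2 * \<sigma>^2 * (expectation (q k j) * \<eta>)"
        using \<eta> by simp
    qed
    then show ?thesis using int by (simp add: S sum_distrib_left)
  qed
  have ek: "integrable M (\<lambda>\<omega>. (e k \<omega>)^2) \<and>
      expectation (\<lambda>\<omega>. (e k \<omega>)^2) = (\<Sum>j<m. \<sigma>^2 * (expectation (q k j) * \<eta>))" if k: "k < N" for k
  proof -
    define H where "H j \<omega> = \<sigma> * (\<xi> (\<tau> (k * m + j)) \<omega> - \<xi> (t k) \<omega>)" for j \<omega>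
    have \<tau>k: "t k + real j * \<eta> = \<tau> (k * m + j)" for j
      by (simp add: t\<tau> \<tau>_def algebra_simps)
    have stk: "s \<le> t k" using h by (simp add: t_def)
    have Hm: "H j \<in> borel_measurable (full_filtration (t k + real j * \<eta>))" if "j < m" for j
    proof -
      have le: "k * m + j \<le> N * m" using idx[OF k that] by auto
      note [measurable] = \<xi>fm[OF le_add1 le] \<xi>fm[OF order_refl le]
      have "H j \<in> borel_measurable (full_filtration (\<tau> (k * m + j)))"
        unfolding H_def[abs_def] t\<tau> by measurable
      then show ?thesis by (simp add: \<tau>k)
    qed
    have HC: "\<bar>H i \<omega>\<bar> \<le> \<bar>\<sigma>\<bar> * (2 * R)" for i \<omega>
      unfolding H_def abs_mult using R0 d\<xi> by (intro mult_mono) auto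
    have eq: "e k \<omega> = (\<Sum>j<m. H j \<omega> * (W (t k + real (Suc j) * \<eta>) \<omega> - W (t k + real j * \<eta>) \<omega>))" for \<omega>
      unfolding e_def \<tau>k H_def dW_def by simp
    have "expectation (\<lambda>\<omega>. (H j \<omega>)^2) = \<sigma>^2 * expectation (q k j)" for j
      unfolding H_def q_def power_mult_distrib by simp
    then show ?thesis
      using ito_sum_L2(1,2)[OF stk \<eta> Hm HC] unfolding eq by (simp add: mult_ac)
  qed
  have Q2: "integrable M (\<lambda>\<omega>. \<Sum>k<N. (e k \<omega>)^2)" "expectation (\<lambda>\<omega>. \<Sum>k<N. (e k \<omega>)^2) = \<sigma>^2 * S"
  proof -
    show "integrable M (\<lambda>\<omega>. \<Sum>k<N. (e k \<omega>)^2)" using ek by auto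
    have "expectation (\<lambda>\<omega>. \<Sum>k<N. (e k \<omega>)^2) = (\<Sum>k<N. expectation (\<lambda>\<omega>. (e k \<omega>)^2))"
      using ek by (intro Bochner_Integration.integral_sum) auto
    also have "\<dots> = \<sigma>^2 * S" using ek by (simp add: S sum_distrib_left)
    finally show "expectation (\<lambda>\<omega>. \<Sum>k<N. (e k \<omega>)^2) = \<sigma>^2 * S" .
  qed
  have Nh: "real N * h^2 = L^2 / real N" using N by (simp add: h_def power2_eq_square field_simps)
  \<comment> \<open>The plain quadratic variation is the case of constant weight 1.\<close>
  have Q3: "integrable M (\<lambda>\<omega>. (\<Sum>k<N. (W (t (Suc k)) \<omega> - W (t k) \<omega>)^2 - h)^2) \<and>
    expectation (\<lambda>\<omega>. (\<Sum>k<N. (W (t (Suc k)) \<omega> - W (t k) \<omega>)^2 - h)^2) = 2 * L^2 / real N"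
    using ito_sum_L2(4,5)[OF order_refl h, of N "\<lambda>_ _. 1" 1] Nh
    by (simp add: t_def prob_space mult_ac)
  have Q4: "integrable M (\<lambda>\<omega>. (\<Sum>k<N. d (t k) \<omega> * \<xi> (t k) \<omega> * ((W (t (Suc k)) \<omega> - W (t k) \<omega>)^2 - h))^2) \<and>
    expectation (\<lambda>\<omega>. (\<Sum>k<N. d (t k) \<omega> * \<xi> (t k) \<omega> * ((W (t (Suc k)) \<omega> - W (t k) \<omega>)^2 - h))^2)
      \<le> R^4 * (2 * L^2 / real N)"
  proof -
    define H where "H k \<omega> = d (t k) \<omega> * \<xi> (t k) \<omega>" for k \<omega>
    have Hm: "H k \<in> borel_measurable (full_filtration (s + real k * h))" if "k < N" for k
    proof -
      have "k * m \<le> N * m" using that by simp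
      note [measurable] = \<xi>fm[OF order_refl this] dfm[OF order_refl this]
      have "H k \<in> borel_measurable (full_filtration (t k))"
        unfolding H_def[abs_def] t\<tau> by measurable
      then show ?thesis by (simp add: t_def)
    qed
    have HC: "\<bar>H k \<omega>\<bar> \<le> R * R" for k \<omega>
      unfolding H_def abs_mult using R0 dR \<xi>R by (intro mult_mono) auto
    have "expectation (\<lambda>\<omega>. (H k \<omega>)^2) \<le> R^4" if "k < N" for k
    proof -
      have "expectation (\<lambda>\<omega>. (H k \<omega>)^2) \<le> expectation (\<lambda>\<omega>. R^4)"
      proof (rule integral_mono)
        show "integrable M (\<lambda>\<omega>. (H k \<omega>)^2)" by (rule ito_sum_L2(3)[OF order_refl h Hm HC that])
        fix \<omega>
        have "(H k \<omega>)^2 \<le> (R * R)^2" using HC[of k \<omega>] R0 by (auto simp: power2_le_iff_abs_le)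
        then show "(H k \<omega>)^2 \<le> R^4" by (simp add: power2_eq_square power4_eq_xxxx mult_ac)
      qed simp
      then show ?thesis by (simp add: prob_space)
    qed
    then have "(\<Sum>k<N. expectation (\<lambda>\<omega>. (H k \<omega>)^2) * (2 * h^2)) \<le> (\<Sum>k<N. R^4 * (2 * h^2))"
      by (intro sum_mono mult_right_mono) auto
    also have "\<dots> = 2 * R^4 * (real N * h^2)" by simp
    also have "\<dots> = R^4 * (2 * L^2 / real N)" unfolding Nh by simp
    finally show ?thesis
      using ito_sum_L2(4,5)[OF order_refl h Hm HC] unfolding t_def H_def by auto
  qed
  show "integrable M G" unfolding G_def using Q1 Q2 Q3 Q4 by auto
  have "expectation G = expectation (\<lambda>\<omega>. (\<Sum>k<N. d (t k) \<omega> * e k \<omega>)^2) + expectation (\<lambda>\<omega>. \<Sum>k<N. (e k \<omega>)^2)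
    + expectation (\<lambda>\<omega>. (\<Sum>k<N. (W (t (Suc k)) \<omega> - W (t k) \<omega>)^2 - h)^2)
    + expectation (\<lambda>\<omega>. (\<Sum>k<N. d (t k) \<omega> * \<xi> (t k) \<omega> * ((W (t (Suc k)) \<omega> - W (t k) \<omega>)^2 - h))^2)"
    unfolding G_def using Q1 Q2 Q3 Q4 by simp
  also have "\<dots> \<le> R^2 * \<sigma>^2 * S + \<sigma>^2 * S + 2 * L^2 / real N + R^4 * (2 * L^2 / real N)"
    using Q1 Q2 Q3 Q4 by (intro add_mono) auto
  also have "\<dots> = (R^2 + 1) * \<sigma>^2 * S + (1 + R^4) * (2 * L^2) / real N"
    by (simp add: algebra_simps add_divide_distrib)
  finally show "expectation G \<le> (R^2 + 1) * \<sigma>^2 *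
        expectation (\<lambda>\<omega>. \<Sum>k<N. \<Sum>j<m. (\<xi> (\<tau> (k * m + j)) \<omega> - \<xi> (t k) \<omega>)^2 * \<eta>)
      + (1 + R^4) * (2 * L^2) / real N"
    by (simp add: S_def q_def)
qed

end

section \<open>Moduli of continuity, truncation and refined grids\<close>

lemma uniform_grid_modulus_sequence:
  fixes f :: "real \<Rightarrow> real" and N :: "nat \<Rightarrow> nat"
  assumes f: "continuous_on {s..s+L} f" and L: "0 < L" and N: "filterlim N at_top sequentially"
  obtains \<delta> where "\<delta> \<longlonglongrightarrow> 0"
    and "\<And>i a b. a \<in> {s..s+L} \<Longrightarrow> b \<in> {s..s+L} \<Longrightarrow> \<bar>a - b\<bar> \<le> L / N i \<Longrightarrow> \<bar>f a - f b\<bar> \<le> \<delta> i"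
proof
  define P where "P i = {(a, b). a \<in> {s..s+L} \<and> b \<in> {s..s+L} \<and> \<bar>a - b\<bar> \<le> L / real (N i)}" for i
  \<comment> \<open>The oscillation over distances up to the mesh is itself taken as the modulus;
    boundedness of \<open>f\<close> on the interval makes the supremum meaningful.\<close>
  define \<delta> where "\<delta> i = (SUP (a, b)\<in>P i. \<bar>f a - f b\<bar>)" for i
  have "bounded (f ` {s..s+L})" using f by (intro compact_imp_bounded compact_continuous_image) auto
  then obtain K where "\<forall>x\<in>f ` {s..s+L}. \<bar>x\<bar> \<le> K" unfolding bounded_iff real_norm_def by blast
  then have K: "\<And>a. a \<in> {s..s+L} \<Longrightarrow> \<bar>f a\<bar> \<le> K" by blast
  have bdd: "bdd_above ((\<lambda>(a, b). \<bar>f a - f b\<bar>) ` P i)" for i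
  proof (rule bdd_aboveI2)
    fix p assume "p \<in> P i"
    then obtain a b where "p = (a, b)" "a \<in> {s..s+L}" "b \<in> {s..s+L}" by (auto simp: P_def)
    then show "(case p of (a, b) \<Rightarrow> \<bar>f a - f b\<bar>) \<le> 2 * K" using K[of a] K[of b] by simp
  qed
  have ne: "(s, s) \<in> P i" for i using L by (simp add: P_def)
  show le: "\<bar>f a - f b\<bar> \<le> \<delta> i" if "a \<in> {s..s+L}" "b \<in> {s..s+L}" "\<bar>a - b\<bar> \<le> L / N i" for i a b
    unfolding \<delta>_def using cSUP_upper[OF _ bdd, of "(a, b)" i] that by (auto simp: P_def)
  show "\<delta> \<longlonglongrightarrow> 0"
  proof (rule LIMSEQ_I)
    fix r :: real assume r: "0 < r"
    then have "0 < r / 2" by simp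
    from uniform_grid_modulus[OF f L N this] have "\<forall>\<^sub>F i in sequentially. norm (\<delta> i - 0) < r"
    proof eventually_elim
      case (elim i)
      have "\<delta> i \<le> r / 2" unfolding \<delta>_def
      proof (rule cSUP_least)
        show "P i \<noteq> {}" using ne by blast
        fix p assume "p \<in> P i"
        then obtain a b where "p = (a, b)" "a \<in> {s..s+L}" "b \<in> {s..s+L}" "\<bar>a - b\<bar> \<le> L / real (N i)"
          by (auto simp: P_def)
        then show "(case p of (a, b) \<Rightarrow> \<bar>f a - f b\<bar>) \<le> r / 2" using elim by (simp add: less_imp_le)
      qed
      moreover have "0 \<le> \<delta> i" using le[of s s i] L by simp
      ultimately show ?case using r by simp
    qed
    then show "\<exists>no. \<forall>n\<ge>no. norm (\<delta> n - 0) < r" by (simp add: eventually_sequentially)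
  qed
qed

text \<open>A continuous truncation, so that an adapted process with continuous paths keeps both
  properties.\<close>

definition clamp_abs :: "real \<Rightarrow> real \<Rightarrow> real" where
  "clamp_abs R x = max (- R) (min x R)"

lemma clamp_abs_bound: "0 \<le> R \<Longrightarrow> \<bar>clamp_abs R x\<bar> \<le> R"
  by (auto simp: clamp_abs_def)

lemma clamp_abs_eq: "\<bar>x\<bar> \<le> R \<Longrightarrow> clamp_abs R x = x"
  by (auto simp: clamp_abs_def)

lemma clamp_abs_measurable [measurable]: "clamp_abs R \<in> borel_measurable borel"
  unfolding clamp_abs_def[abs_def] by measurable

lemma continuous_on_clamp_abs: "continuous_on A f \<Longrightarrow> continuous_on A (\<lambda>a. clamp_abs R (f a))"
  unfolding clamp_abs_def by (intro continuous_intros)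

lemma left_sum_uniform_grid:
  "left_sum H W (map \<tau> [0..<Suc n]) \<omega> = (\<Sum>j<n. H (\<tau> j) \<omega> * (W (\<tau> (Suc j)) \<omega> - W (\<tau> j) \<omega>))"
  unfolding left_sum_def by (rule sum.cong) (auto simp del: upt_Suc)

text \<open>The increment of \<open>w\<close> over a coarse interval telescopes over the fine
  points, so the coarse left-endpoint term is a fine sum with frozen integrand; subtracting it
  leaves the increments of the integrand.\<close>

lemma block_ito_error:
  fixes X w :: "real \<Rightarrow> real"
  shows "(\<Sum>j<Suc k * m. \<sigma> * X (\<tau> j) * (w (\<tau> (Suc j)) - w (\<tau> j)))
    - (\<Sum>j<k * m. \<sigma> * X (\<tau> j) * (w (\<tau> (Suc j)) - w (\<tau> j)))
    - \<sigma> * X (\<tau> (k * m)) * (w (\<tau> (Suc k * m)) - w (\<tau> (k * m)))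
    = (\<Sum>j<m. \<sigma> * (X (\<tau> (k * m + j)) - X (\<tau> (k * m))) * (w (\<tau> (Suc (k * m + j))) - w (\<tau> (k * m + j))))"
proof -
  have "w (\<tau> (Suc k * m)) - w (\<tau> (k * m)) = (\<Sum>j<m. w (\<tau> (k * m + Suc j)) - w (\<tau> (k * m + j)))"
    by (subst sum_lessThan_telescope) (simp add: add.commute)
  then show ?thesis
    unfolding sum_blocks by (simp add: sum_distrib_left sum_subtractf[symmetric] algebra_simps)
qed

text \<open>There are only N + 1 endpoints, so the least of their mesh bounds serves for all of them
  and one refinement factor \<open>m\<close> works simultaneously. The first \<open>k * m\<close>
  fine intervals end exactly at the coarse point with index \<open>k\<close>.\<close>

lemma (in prob_space) ito_integral_uniform_grid:
  fixes H W :: "real \<Rightarrow> 'a \<Rightarrow> real" and N :: nat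
  assumes ito: "\<And>k. k \<le> N \<Longrightarrow> has_ito_integral M W H s (s + real k * (L / real N)) (J k)"
    and L: "0 < L" and N: "0 < N" and \<epsilon>: "0 < \<epsilon>" and \<gamma>: "0 < \<gamma>"
  shows "\<exists>m>0. \<forall>k\<le>N. \<P>(\<omega> in M. \<epsilon> < \<bar>(\<Sum>j<k * m. H (s + real j * (L / (real N * real m))) \<omega> *
    (W (s + real (Suc j) * (L / (real N * real m))) \<omega> - W (s + real j * (L / (real N * real m))) \<omega>))
    - J k \<omega>\<bar>) < \<gamma>"
proof -
  have "\<forall>k\<in>{..N}. \<exists>\<delta>>0. \<forall>ts. is_partition s (s + real k * (L / real N)) ts \<and> mesh_less \<delta> ts \<longrightarrow>
        \<P>(\<omega> in M. \<epsilon> < \<bar>left_sum H W ts \<omega> - J k \<omega>\<bar>) < \<gamma>"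
    using ito \<epsilon> \<gamma> unfolding has_ito_integral_def by auto
  then obtain \<delta> where \<delta>: "\<And>k. k \<le> N \<Longrightarrow> 0 < \<delta> k" "\<And>k ts. k \<le> N \<Longrightarrow>
      is_partition s (s + real k * (L / real N)) ts \<Longrightarrow> mesh_less (\<delta> k) ts \<Longrightarrow>
        \<P>(\<omega> in M. \<epsilon> < \<bar>left_sum H W ts \<omega> - J k \<omega>\<bar>) < \<gamma>"
    by (auto dest!: bchoice)
  define \<delta>0 where "\<delta>0 = Min (\<delta> ` {..N})"
  have \<delta>0: "0 < \<delta>0" "\<And>k. k \<le> N \<Longrightarrow> \<delta>0 \<le> \<delta> k" using \<delta>(1) by (auto simp: \<delta>0_def)
  \<comment> \<open>Chosen so that the fine mesh L / (N m) is below
    \<open>\<delta>0\<close>.\<close>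
  obtain m where m: "L / (real N * \<delta>0) < real m" using reals_Archimedean2 by blast
  have "0 < L / (real N * \<delta>0)" using L N \<delta>0 by simp
  then have m0: "0 < m" using m by (intro Nat.gr0I) auto
  define \<eta> where "\<eta> = L / (real N * real m)"
  define \<tau> where "\<tau> j = s + real j * \<eta>" for j
  have \<eta>: "0 < \<eta>" "\<eta> < \<delta>0" using m m0 L N \<delta>0 by (auto simp: \<eta>_def field_simps)
  have "\<P>(\<omega> in M. \<epsilon> < \<bar>(\<Sum>j<k * m. H (\<tau> j) \<omega> * (W (\<tau> (Suc j)) \<omega> - W (\<tau> j) \<omega>)) - J k \<omega>\<bar>) < \<gamma>"
    if k: "k \<le> N" for k
  proof -
    let ?ts = "map \<tau> [0..<Suc (k * m)]"
    have len: "length ?ts = Suc (k * m)" by simp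
    have nth: "?ts ! i = \<tau> i" if "i < Suc (k * m)" for i using that by (simp del: upt_Suc)
    have "sorted ?ts"
      unfolding sorted_iff_nth_mono using \<eta> by (auto simp: nth len \<tau>_def simp del: upt_Suc)
    moreover have "hd ?ts = s" by (simp add: hd_map \<tau>_def del: upt_Suc)
    moreover have "last ?ts = s + real k * (L / real N)"
      using m0 by (simp add: \<tau>_def \<eta>_def)
    ultimately have "is_partition s (s + real k * (L / real N)) ?ts"
      unfolding is_partition_def by simp
    moreover have "mesh_less (\<delta> k) ?ts"
    proof -
      have "\<tau> (Suc i) - \<tau> i < \<delta> k" for i
        using \<eta> \<delta>0(2)[OF k] by (simp add: \<tau>_def algebra_simps)
      then show ?thesis unfolding mesh_less_def by (auto simp: nth len simp del: upt_Suc)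
    qed
    ultimately show ?thesis
      using \<delta>(2)[OF k, of ?ts] unfolding left_sum_uniform_grid by simp
  qed
  then show ?thesis using m0 unfolding \<tau>_def \<eta>_def by blast
qed

context noise begin

text \<open>
  The coarse grid with \<open>Suc n\<close> intervals is refined by \<open>m n\<close> points per interval such that the fine
  left sums are within \<open>\<epsilon> n\<close> of the Ito integrals outside a summable exceptional set. The other
  errors are estimated in \<open>L\<^sup>2\<close> after truncating \<open>X\<close> and \<open>1 / E\<close> at level \<open>R\<close>, so they vanish
  almost surely along a subsequence; each path is bounded, so some \<open>R\<close> does not change it.
\<close>

lemma stock_price_explicit:
  assumes \<sigma>: "0 < \<sigma>" and sp: "stock_price T \<mu>0 \<mu>1 \<sigma> s x M W \<theta> X" and u: "u \<in> {s..T}"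
  shows "AE \<omega> in M. X u \<omega> = x * price_factor \<mu>0 \<mu>1 \<sigma> s W \<theta> u \<omega>"
proof -
  have \<sigma>\<eta>: "\<sigma> * ((\<mu>0 - \<mu>1) / \<sigma>) = \<mu>0 - \<mu>1" using \<sigma> by simp
  note sp' = sp[unfolded stock_price_def Let_def \<sigma>\<eta>]
  have Xm: "\<And>a. a \<in> {s..T} \<Longrightarrow> X a \<in> borel_measurable (full_filtration a)"
    using sp' by (intro measurable_mono_sets[OF _ augmented_subset_full]) auto
  have Xc: "AE \<omega> in M. continuous_on {s..T} (\<lambda>u. X u \<omega>)" and Xs: "AE \<omega> in M. X s \<omega> = x"
    using sp' by auto
  define A where "A v \<omega> = (LBINT a:{s..v}. (\<mu>0 - (\<mu>0 - \<mu>1) * state_process \<theta> a \<omega>) * X a \<omega>)" for v \<omega>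
  have "\<forall>v\<in>{s..T}. \<exists>J. has_ito_integral M W (\<lambda>a \<omega>. \<sigma> * X a \<omega>) s v J \<and>
      (AE \<omega> in M. X v \<omega> = x + A v \<omega> + J \<omega>)"
    using sp' unfolding A_def by auto
  \<comment> \<open>The integrals at different times are chosen separately, each with its own null
    set. Only grid times are used below, and these are countably many.\<close>
  from bchoice[OF this]
  obtain J where J: "\<And>v. v \<in> {s..T} \<Longrightarrow> has_ito_integral M W (\<lambda>a \<omega>. \<sigma> * X a \<omega>) s v (J v)"
    and XJ: "\<And>v. v \<in> {s..T} \<Longrightarrow> AE \<omega> in M. X v \<omega> = x + A v \<omega> + J v \<omega>"
    by blast
  show ?thesis
  proof (cases "u = s")
    case True
    show ?thesis using Xs W_start AE_space unfolding True
      by eventually_elim (simp add: price_factor_def occupation_start \<theta>_ge)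
  next
    case False
    define L where "L = u - s"
    have L: "0 < L" "u = s + L" using False u by (auto simp: L_def)
    have sub: "{s..s+L} \<subseteq> {s..T}" using u L by auto
    define t where "t n k = s + real k * (L / real (Suc n))" for n k
    have tmem: "t n k \<in> {s..s+L}" if "k \<le> Suc n" for n k
    proof -
      have "real k * (L / real (Suc n)) \<le> real (Suc n) * (L / real (Suc n))"
        using that L by (intro mult_right_mono) auto
      then show ?thesis using L by (simp add: t_def)
    qed
    \<comment> \<open>There are n + 2 grid points, so the union bound leaves probability at most
      (1/2)^n for a poor approximation at any of them; the errors 2 \<epsilon> on the n + 1
      intervals add up to at most 2 (1/2)^n.\<close>
    define \<epsilon> where "\<epsilon> n = (1/2)^n / (real n + 2)" for n :: nat
    have \<epsilon>0: "0 < \<epsilon> n" for n by (simp add: \<epsilon>_def)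
    have Jt: "has_ito_integral M W (\<lambda>a \<omega>. \<sigma> * X a \<omega>) s (s + real k * (L / real (Suc n))) (J (t n k))"
      if "k \<le> Suc n" for n k
      using J[of "t n k"] tmem[OF that] sub unfolding t_def by blast
    define pr where "pr n m k = \<P>(\<omega> in M. \<epsilon> n < \<bar>(\<Sum>j<k * m. \<sigma> * X (s + real j * (L / (real (Suc n) * real m))) \<omega> *
      (W (s + real (Suc j) * (L / (real (Suc n) * real m))) \<omega> - W (s + real j * (L / (real (Suc n) * real m))) \<omega>))
      - J (t n k) \<omega>\<bar>)" for n m k
    have "\<exists>m>0. \<forall>k\<le>Suc n. pr n m k < \<epsilon> n" for n
      unfolding pr_def using ito_integral_uniform_grid[OF Jt L(1) zero_less_Suc \<epsilon>0 \<epsilon>0] .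
    then obtain m where m0: "\<And>n. 0 < m n" and m: "\<And>n k. k \<le> Suc n \<Longrightarrow> pr n (m n) k < \<epsilon> n"
      by metis
    define \<tau> where "\<tau> n j = s + real j * (L / (real (Suc n) * real (m n)))" for n j
    define FS where "FS n k \<omega> = (\<Sum>j<k * m n. \<sigma> * X (\<tau> n j) \<omega> * (W (\<tau> n (Suc j)) \<omega> - W (\<tau> n j) \<omega>))" for n k \<omega>
    have t\<tau>: "t n k = \<tau> n (k * m n)" for n k using m0[of n] by (simp add: t_def \<tau>_def)
    have \<tau>mem: "\<tau> n j \<in> {s..s+L}" if "j \<le> Suc n * m n" for n j
    proof -
      have "real j * (L / (real (Suc n) * real (m n))) \<le> real (Suc n * m n) * (L / (real (Suc n) * real (m n)))"
        using that L by (intro mult_right_mono) (auto simp only: of_nat_le_iff, auto)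
      also have "\<dots> = L" unfolding of_nat_mult using m0[of n] by (simp del: of_nat_Suc)
      finally show ?thesis using L by (simp add: \<tau>_def)
    qed
    have XM: "X (\<tau> n j) \<in> borel_measurable M" if "j \<le> Suc n * m n" for n j
      using \<tau>mem[OF that] sub by (intro measurable_full_events[OF Xm]) auto
    have WM: "W (\<tau> n j) \<in> borel_measurable M" for n j
      using L by (intro W_measurable) (simp add: \<tau>_def)
    have idx: "k * m n + j < Suc n * m n" if "k < Suc n" "j < m n" for n k j
    proof -
      have "k * m n + j < Suc k * m n" using that by simp
      also have "\<dots> \<le> Suc n * m n" using that by (intro mult_le_mono1) auto
      finally show ?thesis .
    qed
    have FSM: "FS n k \<in> borel_measurable M" if k: "k \<le> Suc n" for n k
    proof -
      have "k * m n \<le> Suc n * m n" using k by (intro mult_le_mono1)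
      then show ?thesis unfolding FS_def[abs_def]
        using XM WM by (intro borel_measurable_sum borel_measurable_times borel_measurable_diff) auto
    qed
    have JM: "J (t n k) \<in> borel_measurable M" if "k \<le> Suc n" for n k
      using J[of "t n k"] tmem[OF that] sub unfolding has_ito_integral_def by auto
    define bad where "bad n = (\<Union>k\<le>Suc n. {\<omega> \<in> space M. \<epsilon> n < \<bar>FS n k \<omega> - J (t n k) \<omega>\<bar>})" for n
    have badM: "{\<omega> \<in> space M. \<epsilon> n < \<bar>FS n k \<omega> - J (t n k) \<omega>\<bar>} \<in> events" if "k \<le> Suc n" for n k
      using FSM[OF that] JM[OF that] by measurable
    have badM': "bad n \<in> events" for n unfolding bad_def using badM by auto
    have "prob (bad n) \<le> (1/2)^n" for n
    proof -
      have "prob (bad n) \<le> (\<Sum>k\<le>Suc n. prob {\<omega> \<in> space M. \<epsilon> n < \<bar>FS n k \<omega> - J (t n k) \<omega>\<bar>})"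
        unfolding bad_def using badM by (intro finite_measure_subadditive_finite) auto
      also have "\<dots> \<le> (\<Sum>k\<le>Suc n. \<epsilon> n)"
        using m unfolding FS_def \<tau>_def pr_def by (intro sum_mono less_imp_le) auto
      also have "\<dots> = (real n + 2) * \<epsilon> n" by (simp add: algebra_simps)
      also have "\<dots> = (1/2)^n"
      proof -
        have "real n + 2 \<noteq> 0" by linarith
        then show ?thesis by (simp add: \<epsilon>_def del: of_nat_Suc)
      qed
      finally show ?thesis .
    qed
    then have "summable (\<lambda>n. prob (bad n))"
      by (intro summable_comparison_test[OF _ summable_geometric[of "1/2::real"]]) auto
    \<comment> \<open>Almost every path is exceptional for only finitely many grids. The refinement
      was chosen fast enough to turn convergence in probability into pathwise convergence.\<close>
    then have BC: "AE \<omega> in M. \<forall>\<^sub>F n in sequentially. \<omega> \<in> space M - bad n"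
      by (intro borel_cantelli_AE1 badM') (auto simp: less_top[symmetric])
    \<comment> \<open>The reciprocal of \<open>price_factor\<close>.\<close>
    define Dp where "Dp a \<omega>
      = exp (- (\<mu>0 * (a - s) - (\<mu>0 - \<mu>1) * occupation \<theta> a \<omega>) - \<sigma> * W a \<omega> + \<sigma>^2 * (a - s) / 2)" for a \<omega>
    have Dm: "Dp a \<in> borel_measurable (full_filtration a)" if "a \<in> {s..s+L}" for a
    proof -
      have [measurable]: "W a \<in> borel_measurable (full_filtration a)"
        "\<theta> \<in> borel_measurable (full_filtration a)"
        using that by (auto intro: W_measurable_full \<theta>_measurable_full)
      show ?thesis unfolding Dp_def[abs_def] by measurable
    qed
    define e' where "e' Y n k \<omega> = (\<Sum>j<m n. \<sigma> * (Y (\<tau> n (k * m n + j)) \<omega> - Y (t n k) \<omega>) *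
        (W (\<tau> n (Suc (k * m n + j))) \<omega> - W (\<tau> n (k * m n + j)) \<omega>))" for Y n k \<omega>
    define dq where "dq n k \<omega> = (W (t n (Suc k)) \<omega> - W (t n k) \<omega>)^2 - L / real (Suc n)" for n k \<omega>
    define G where "G d Y n \<omega> = (\<Sum>k<Suc n. d (t n k) \<omega> * e' Y n k \<omega>)^2 + (\<Sum>k<Suc n. (e' Y n k \<omega>)^2)
      + (\<Sum>k<Suc n. dq n k \<omega>)^2 + (\<Sum>k<Suc n. d (t n k) \<omega> * Y (t n k) \<omega> * dq n k \<omega>)^2" for d Y n \<omega>
    \<comment> \<open>The subsequence may depend on the truncation level; taking natural numbers as
      levels leaves countably many exceptional sets.\<close>
    have "\<exists>r::nat \<Rightarrow> nat. strict_mono r \<and>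
        (AE \<omega> in M. (\<lambda>i. G (\<lambda>a \<omega>. clamp_abs R (Dp a \<omega>)) (\<lambda>a \<omega>. clamp_abs R (X a \<omega>)) (r i) \<omega>) \<longlonglongrightarrow> 0)" for R :: nat
    proof -
      define \<xi> where "\<xi> a \<omega> = clamp_abs R (X a \<omega>)" for a \<omega>
      define d where "d a \<omega> = clamp_abs R (Dp a \<omega>)" for a \<omega>
      have \<xi>m: "\<xi> a \<in> borel_measurable (full_filtration a)" if "a \<in> {s..s+L}" for a
        unfolding \<xi>_def[abs_def] using Xm[of a] that sub by (intro measurable_compose[OF _ clamp_abs_measurable]) auto
      have dm: "d a \<in> borel_measurable (full_filtration a)" if "a \<in> {s..s+L}" for a
        unfolding d_def[abs_def] using Dm[OF that] by (intro measurable_compose[OF _ clamp_abs_measurable])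
      have \<xi>R: "\<bar>\<xi> a \<omega>\<bar> \<le> real R" and dR: "\<bar>d a \<omega>\<bar> \<le> real R" for a \<omega>
        by (auto simp: \<xi>_def d_def intro!: clamp_abs_bound)
      define \<eta> where "\<eta> n = L / (real (Suc n) * real (m n))" for n
      have \<eta>0: "0 < \<eta> n" for n using L m0[of n] by (simp add: \<eta>_def)
      have N\<eta>: "real (Suc n) * (real (m n) * \<eta> n) = L" for n using m0[of n] by (simp add: \<eta>_def del: of_nat_Suc)
      define S where "S n \<omega> = (\<Sum>k<Suc n. \<Sum>j<m n. (\<xi> (\<tau> n (k * m n + j)) \<omega> - \<xi> (t n k) \<omega>)^2 * \<eta> n)" for n \<omega>
      have est1: "integrable M (G d \<xi> n)" for n
        unfolding G_def[abs_def] e'_def dq_def t_def \<tau>_def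
        by (rule grid_estimates(1)[OF L(1) zero_less_Suc m0 \<xi>m dm \<xi>R dR])
      have est2: "expectation (G d \<xi> n) \<le> ((real R)^2 + 1) * \<sigma>^2 * expectation (S n)
        + (1 + (real R)^4) * (2 * L^2) / real (Suc n)" for n
        unfolding G_def[abs_def] e'_def dq_def S_def[abs_def] t_def \<tau>_def \<eta>_def
        by (rule grid_estimates(2)[OF L(1) zero_less_Suc m0 \<xi>m dm \<xi>R dR])
      note est = est1 est2
      have SM: "S n \<in> borel_measurable M" for n
      proof -
        have "\<xi> (\<tau> n (k * m n + j)) \<in> borel_measurable M" "\<xi> (t n k) \<in> borel_measurable M"
          if "k < Suc n" "j < m n" for k j
          using idx[OF that] \<tau>mem[of "k * m n + j" n] tmem[of k n] that
          by (auto intro!: measurable_full_events[OF \<xi>m])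
        then show ?thesis unfolding S_def[abs_def]
          by (intro borel_measurable_sum borel_measurable_times borel_measurable_power borel_measurable_diff) auto
      qed
      have S0: "AE \<omega> in M. (\<lambda>n. S n \<omega>) \<longlonglongrightarrow> 0"
        using Xc
      proof eventually_elim
        case (elim \<omega>)
        have c: "continuous_on {s..s+L} (\<lambda>a. \<xi> a \<omega>)"
          unfolding \<xi>_def using continuous_on_subset[OF elim sub] by (rule continuous_on_clamp_abs)
        have "filterlim Suc at_top sequentially" by (rule filterlim_Suc)
        from uniform_grid_modulus_sequence[OF c L(1) this]
        obtain \<delta> where \<delta>: "\<delta> \<longlonglongrightarrow> 0" "\<And>i a b. a \<in> {s..s+L} \<Longrightarrow> b \<in> {s..s+L} \<Longrightarrow>
            \<bar>a - b\<bar> \<le> L / real (Suc i) \<Longrightarrow> \<bar>\<xi> a \<omega> - \<xi> b \<omega>\<bar> \<le> \<delta> i" by blast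
        show ?case
        proof (rule tendsto_mult_bounded_const)
          show "0 \<le> S n \<omega>" for n unfolding S_def using \<eta>0[of n] by (intro sum_nonneg mult_nonneg_nonneg) auto
          show "S n \<omega> \<le> L * (\<delta> n)^2" for n
          proof -
            have "S n \<omega> \<le> (\<Sum>k<Suc n. \<Sum>j<m n. (\<delta> n)^2 * \<eta> n)"
              unfolding S_def
            proof (intro sum_mono mult_right_mono)
              fix k j assume kj: "k \<in> {..<Suc n}" "j \<in> {..<m n}"
              have "\<tau> n (k * m n + j) - t n k = real j * \<eta> n"
                by (simp add: t\<tau> \<tau>_def \<eta>_def algebra_simps add_divide_distrib)
              moreover have "real j * \<eta> n \<le> real (m n) * \<eta> n" using kj \<eta>0[of n] by (intro mult_right_mono) auto
              moreover have "real (m n) * \<eta> n = L / real (Suc n)" using m0[of n] by (simp add: \<eta>_def)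
              ultimately have "\<bar>\<tau> n (k * m n + j) - t n k\<bar> \<le> L / real (Suc n)"
                using \<eta>0[of n] by simp
              then have "\<bar>\<xi> (\<tau> n (k * m n + j)) \<omega> - \<xi> (t n k) \<omega>\<bar> \<le> \<delta> n"
                using kj idx[of k n j] by (intro \<delta>(2) \<tau>mem tmem) auto
              then show "(\<xi> (\<tau> n (k * m n + j)) \<omega> - \<xi> (t n k) \<omega>)^2 \<le> (\<delta> n)^2"
                by (meson abs_ge_zero abs_le_square_iff order_trans abs_ge_self)
            qed (use \<eta>0[of n] in auto)
            also have "\<dots> = (real (Suc n) * (real (m n) * \<eta> n)) * (\<delta> n)^2" by simp
            finally show ?thesis by (simp only: N\<eta>)
          qed
          show "(\<lambda>n. (\<delta> n)^2) \<longlonglongrightarrow> 0" using tendsto_power[OF \<delta>(1), of 2] by simp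
        qed
      qed
      \<comment> \<open>On each path \<open>S\<close> is at most L times the squared modulus of
        continuity; the truncation supplies the dominating constant.\<close>
      have "(\<lambda>n. expectation (S n)) \<longlonglongrightarrow> expectation (\<lambda>\<omega>. 0)"
      proof (rule integral_dominated_convergence)
        show "AE \<omega> in M. norm (S n \<omega>) \<le> L * (2 * real R)^2" for n
        proof (rule AE_I2)
          fix \<omega>
          have "S n \<omega> \<le> (\<Sum>k<Suc n. \<Sum>j<m n. (2 * real R)^2 * \<eta> n)"
            unfolding S_def
          proof (intro sum_mono mult_right_mono)
            fix k j
            have "\<bar>\<xi> (\<tau> n (k * m n + j)) \<omega> - \<xi> (t n k) \<omega>\<bar> \<le> 2 * real R"
              using \<xi>R[of "\<tau> n (k * m n + j)" \<omega>] \<xi>R[of "t n k" \<omega>] by linarith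
            then show "(\<xi> (\<tau> n (k * m n + j)) \<omega> - \<xi> (t n k) \<omega>)^2 \<le> (2 * real R)^2"
              by (subst power2_le_iff_abs_le) auto
          qed (use \<eta>0[of n] in auto)
          also have "\<dots> = (real (Suc n) * (real (m n) * \<eta> n)) * (2 * real R)^2" by simp
          also have "\<dots> = L * (2 * real R)^2" by (simp only: N\<eta>)
          finally have "S n \<omega> \<le> L * (2 * real R)^2" .
          moreover have "0 \<le> S n \<omega>" unfolding S_def using \<eta>0[of n] by (intro sum_nonneg mult_nonneg_nonneg) auto
          ultimately show "norm (S n \<omega>) \<le> L * (2 * real R)^2" by simp
        qed
      qed (use SM S0 in auto)
      then have ES: "(\<lambda>n. expectation (S n)) \<longlonglongrightarrow> 0" by simp
      have G0: "0 \<le> G d \<xi> n \<omega>" for n \<omega> unfolding G_def by (intro add_nonneg_nonneg sum_nonneg) auto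
      have "(\<lambda>n. expectation (G d \<xi> n)) \<longlonglongrightarrow> 0"
      proof (rule tendsto_sandwich[of "\<lambda>_. 0"])
        have "(\<lambda>n. ((real R)^2 + 1) * \<sigma>^2 * expectation (S n) + (1 + (real R)^4) * (2 * L^2) / real (Suc n))
          \<longlonglongrightarrow> ((real R)^2 + 1) * \<sigma>^2 * 0 + 0"
          by (intro tendsto_add tendsto_mult tendsto_const ES
              tendsto_divide_0[OF tendsto_const] filterlim_at_top_imp_at_infinity
              filterlim_compose[OF filterlim_real_sequentially filterlim_Suc])
        then show "(\<lambda>n. ((real R)^2 + 1) * \<sigma>^2 * expectation (S n) + (1 + (real R)^4) * (2 * L^2) / real (Suc n)) \<longlonglongrightarrow> 0"
          by simp
      qed (use est G0 in \<open>auto intro!: always_eventually integral_nonneg\<close>)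
      then have "(\<lambda>n. \<integral>\<omega>. norm (G d \<xi> n \<omega>) \<partial>M) \<longlonglongrightarrow> 0" using G0 by simp
      from tendsto_L1_AE_subseq[OF est(1) this] show ?thesis unfolding d_def[abs_def] \<xi>_def[abs_def] .
    qed
    then obtain r :: "nat \<Rightarrow> nat \<Rightarrow> nat" where r: "\<And>R. strict_mono (r R)"
      "\<And>R. AE \<omega> in M. (\<lambda>i. G (\<lambda>a \<omega>. clamp_abs (real R) (Dp a \<omega>)) (\<lambda>a \<omega>. clamp_abs (real R) (X a \<omega>)) (r R i) \<omega>) \<longlonglongrightarrow> 0"
      by metis
    have AEG: "AE \<omega> in M. \<forall>R. (\<lambda>i. G (\<lambda>a \<omega>. clamp_abs (real R) (Dp a \<omega>))
      (\<lambda>a \<omega>. clamp_abs (real R) (X a \<omega>)) (r R i) \<omega>) \<longlonglongrightarrow> 0"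
      using r(2) by (simp add: AE_all_countable)
    have AEX: "AE \<omega> in M. \<forall>n. \<forall>k\<in>{..Suc n}. X (t n k) \<omega> = x + A (t n k) \<omega> + J (t n k) \<omega>"
    proof -
      have "AE \<omega> in M. X (t n k) \<omega> = x + A (t n k) \<omega> + J (t n k) \<omega>" if "k \<le> Suc n" for n k
        using XJ[of "t n k"] tmem[OF that] sub by blast
      then show ?thesis unfolding AE_all_countable by (auto intro!: AE_finite_allI)
    qed
    show ?thesis
      using AE_space Xc W_continuous Xs W_start BC AEG AEX
    proof eventually_elim
      case (elim \<omega>)
      have Xc': "continuous_on {s..s+L} (\<lambda>a. X a \<omega>)" using elim(2) sub by (rule continuous_on_subset)
      have Wc': "continuous_on {s..s+L} (\<lambda>a. W a \<omega>)" using elim(3) by (rule continuous_on_subset) auto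
      define B where "B a = \<mu>0 * (a - s) - (\<mu>0 - \<mu>1) * occupation \<theta> a \<omega>" for a
      define c where "c = \<bar>\<mu>0\<bar> + \<bar>\<mu>0 - \<mu>1\<bar>"
      have Blip: "\<bar>B a - B b\<bar> \<le> c * \<bar>a - b\<bar>" for a b
      proof -
        have "B a - B b = \<mu>0 * (a - b) - (\<mu>0 - \<mu>1) * (occupation \<theta> a \<omega> - occupation \<theta> b \<omega>)"
          by (simp add: B_def algebra_simps)
        then have "\<bar>B a - B b\<bar> \<le> \<bar>\<mu>0\<bar> * \<bar>a - b\<bar> + \<bar>\<mu>0 - \<mu>1\<bar> * \<bar>occupation \<theta> a \<omega> - occupation \<theta> b \<omega>\<bar>"
          by (metis abs_mult abs_triangle_ineq4)
        also have "\<dots> \<le> \<bar>\<mu>0\<bar> * \<bar>a - b\<bar> + \<bar>\<mu>0 - \<mu>1\<bar> * \<bar>a - b\<bar>"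
          by (intro add_left_mono mult_left_mono occupation_lipschitz[of s \<theta> \<omega>, OF \<theta>_ge[OF elim(1)]]) auto
        finally show ?thesis by (simp add: c_def algebra_simps)
      qed
      have Bc: "continuous_on {s..s+L} B"
      proof (rule lipschitz_on_continuous_on)
        show "c-lipschitz_on {s..s+L} B"
          by (rule lipschitz_onI) (use Blip in \<open>auto simp: dist_real_def c_def\<close>)
      qed
      have DpB: "Dp a \<omega> = exp (- B a - \<sigma> * W a \<omega> + \<sigma>^2 * (a - s) / 2)" for a
        by (simp add: Dp_def B_def)
      have "continuous_on {s..s+L} (\<lambda>a. Dp a \<omega>)"
        unfolding DpB by (intro continuous_intros Wc' Bc) auto
      then have "bounded ((\<lambda>a. Dp a \<omega>) ` {s..s+L} \<union> (\<lambda>a. X a \<omega>) ` {s..s+L})"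
        using Xc' unfolding bounded_Un by (auto intro!: compact_imp_bounded compact_continuous_image)
      then obtain K where "\<forall>y\<in>(\<lambda>a. Dp a \<omega>) ` {s..s+L} \<union> (\<lambda>a. X a \<omega>) ` {s..s+L}. \<bar>y\<bar> \<le> K"
        unfolding bounded_iff real_norm_def by blast
      then have K: "\<And>a. a \<in> {s..s+L} \<Longrightarrow> \<bar>Dp a \<omega>\<bar> \<le> K" "\<And>a. a \<in> {s..s+L} \<Longrightarrow> \<bar>X a \<omega>\<bar> \<le> K"
        by blast+
      \<comment> \<open>On this path and interval neither process exceeds \<open>R\<close> in
        modulus, so the truncated sums are the original ones.\<close>
      obtain R :: nat where R: "K \<le> real R" using real_arch_simple by blast
      define \<rho> where "\<rho> = r R"
      have \<rho>: "strict_mono \<rho>" using r(1) by (simp add: \<rho>_def)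
      have \<rho>top: "filterlim \<rho> at_top sequentially" by (rule filterlim_subseq[OF \<rho>])
      have G\<rho>: "(\<lambda>i. G Dp X (\<rho> i) \<omega>) \<longlonglongrightarrow> 0"
      proof -
        have cX: "clamp_abs (real R) (X a \<omega>) = X a \<omega>" and cD: "clamp_abs (real R) (Dp a \<omega>) = Dp a \<omega>"
          if "a \<in> {s..s+L}" for a using K[OF that] R by (auto intro!: clamp_abs_eq)
        have "e' (\<lambda>a \<omega>. clamp_abs (real R) (X a \<omega>)) n k \<omega> = e' X n k \<omega>" if "k < Suc n" for n k
          unfolding e'_def using idx[OF that] \<tau>mem[of _ n] tmem[of k n] that
          by (intro sum.cong refl) (simp add: cX less_imp_le)
        then have "G (\<lambda>a \<omega>. clamp_abs (real R) (Dp a \<omega>)) (\<lambda>a \<omega>. clamp_abs (real R) (X a \<omega>)) n \<omega> = G Dp X n \<omega>" for n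
          unfolding G_def using tmem[of _ n] by (simp add: cX cD less_imp_le cong: sum.cong_simp)
        then show ?thesis using spec[OF elim(7), of R] unfolding \<rho>_def by simp
      qed
      have nn: "0 \<le> (\<Sum>k<Suc n. (e' X n k \<omega>)^2)" for n by (intro sum_nonneg) auto
      have sq: "(\<lambda>i. f (\<rho> i)) \<longlonglongrightarrow> 0" if "\<And>n. (f n)^2 \<le> G Dp X n \<omega>" for f :: "nat \<Rightarrow> real"
      proof -
        have "(\<lambda>i. (f (\<rho> i))^2) \<longlonglongrightarrow> 0"
          using tendsto_mult_bounded_const[of "\<lambda>i. (f (\<rho> i))^2" 1 "\<lambda>i. G Dp X (\<rho> i) \<omega>"] that G\<rho> by simp
        from tendsto_real_sqrt[OF this] show ?thesis by (simp add: tendsto_rabs_zero_iff)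
      qed
      have l1: "(\<lambda>i. \<Sum>k<Suc (\<rho> i). Dp (t (\<rho> i) k) \<omega> * e' X (\<rho> i) k \<omega>) \<longlonglongrightarrow> 0"
        by (rule sq) (use nn in \<open>simp add: G_def del: sum.lessThan_Suc\<close>)
      have l2: "(\<lambda>i. \<Sum>k<Suc (\<rho> i). (e' X (\<rho> i) k \<omega>)^2) \<longlonglongrightarrow> 0"
        using tendsto_mult_bounded_const[of "\<lambda>i. \<Sum>k<Suc (\<rho> i). (e' X (\<rho> i) k \<omega>)^2" 1 "\<lambda>i. G Dp X (\<rho> i) \<omega>"] nn G\<rho>
        by (simp add: G_def del: sum.lessThan_Suc)
      have l3: "(\<lambda>i. \<Sum>k<Suc (\<rho> i). dq (\<rho> i) k \<omega>) \<longlonglongrightarrow> 0"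
        by (rule sq) (use nn in \<open>simp add: G_def del: sum.lessThan_Suc\<close>)
      have l4: "(\<lambda>i. \<Sum>k<Suc (\<rho> i). Dp (t (\<rho> i) k) \<omega> * X (t (\<rho> i) k) \<omega> * dq (\<rho> i) k \<omega>) \<longlonglongrightarrow> 0"
        by (rule sq) (use nn in \<open>simp add: G_def del: sum.lessThan_Suc\<close>)
      define e where "e n k = J (t n (Suc k)) \<omega> - J (t n k) \<omega>
        - \<sigma> * X (t n k) \<omega> * (W (t n (Suc k)) \<omega> - W (t n k) \<omega>)" for n k
      have l5': "(\<lambda>n. \<Sum>k<Suc n. \<bar>e n k - e' X n k \<omega>\<bar>) \<longlonglongrightarrow> 0"
      proof (rule tendsto_sandwich[of "\<lambda>_. 0"])
        show "\<forall>\<^sub>F n in sequentially. (\<Sum>k<Suc n. \<bar>e n k - e' X n k \<omega>\<bar>) \<le> 2 * (1/2)^n"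
          using elim(6)
        proof eventually_elim
          case (elim n)
          have good: "\<bar>FS n k \<omega> - J (t n k) \<omega>\<bar> \<le> \<epsilon> n" if "k \<le> Suc n" for k
            using elim that unfolding bad_def by (auto simp: not_less[symmetric])
          have "(\<Sum>k<Suc n. \<bar>e n k - e' X n k \<omega>\<bar>) \<le> (\<Sum>k<Suc n. 2 * \<epsilon> n)"
          proof (intro sum_mono)
            fix k assume k: "k \<in> {..<Suc n}"
            have "FS n (Suc k) \<omega> - FS n k \<omega> - \<sigma> * X (t n k) \<omega> * (W (t n (Suc k)) \<omega> - W (t n k) \<omega>) = e' X n k \<omega>"
              unfolding FS_def e'_def t\<tau> by (rule block_ito_error)
            then have "e n k - e' X n k \<omega> = (FS n k \<omega> - J (t n k) \<omega>) - (FS n (Suc k) \<omega> - J (t n (Suc k)) \<omega>)"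
              by (simp add: e_def)
            then show "\<bar>e n k - e' X n k \<omega>\<bar> \<le> 2 * \<epsilon> n" using good[of k] good[of "Suc k"] k by auto
          qed
          also have "\<dots> = 2 * (real (Suc n) / (real n + 2)) * (1/2)^n" by (simp add: \<epsilon>_def)
          also have "\<dots> \<le> 2 * 1 * (1/2)^n" by (intro mult_right_mono mult_left_mono) auto
          finally show ?case by simp
        qed
        show "(\<lambda>n. 2 * (1/2)^n :: real) \<longlonglongrightarrow> 0"
          using tendsto_mult_left[OF LIMSEQ_power_zero[of "1/2::real"], of 2] by simp
      qed (auto intro!: always_eventually sum_nonneg)
      have l5: "(\<lambda>i. \<Sum>k<Suc (\<rho> i). \<bar>e (\<rho> i) k - e' X (\<rho> i) k \<omega>\<bar>) \<longlonglongrightarrow> 0"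
        using filterlim_compose[OF l5' \<rho>top] .
      have Ntop: "filterlim (\<lambda>i. Suc (\<rho> i)) at_top sequentially"
        by (rule filterlim_compose[OF filterlim_Suc \<rho>top])
      obtain \<delta> where \<delta>: "\<delta> \<longlonglongrightarrow> 0" "\<And>i a b. a \<in> {s..s+L} \<Longrightarrow> b \<in> {s..s+L} \<Longrightarrow>
            \<bar>a - b\<bar> \<le> L / real (Suc (\<rho> i)) \<Longrightarrow> \<bar>X a \<omega> - X b \<omega>\<bar> \<le> \<delta> i"
        using uniform_grid_modulus_sequence[OF Xc' L(1) Ntop] by blast
      have "X (s + L) \<omega> * Dp (s + L) \<omega> = X s \<omega> * Dp s \<omega>"
      proof (rule product_constant_of_euler_sums[where N = "\<lambda>i. Suc (\<rho> i)" and w = "\<lambda>a. W a \<omega>"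
            and B = B and \<sigma> = \<sigma> and c = c and I = "\<lambda>i k. A (t (\<rho> i) (Suc k)) \<omega> - A (t (\<rho> i) k) \<omega>"
            and e = "\<lambda>i. e (\<rho> i)" and e' = "\<lambda>i k. e' X (\<rho> i) k \<omega>" and \<delta> = "\<lambda>i. c * \<delta> i"])
        show "X (s + real (Suc k) * (L / real (Suc (\<rho> i)))) \<omega> - X (s + real k * (L / real (Suc (\<rho> i)))) \<omega> =
          A (t (\<rho> i) (Suc k)) \<omega> - A (t (\<rho> i) k) \<omega> +
          \<sigma> * X (s + real k * (L / real (Suc (\<rho> i)))) \<omega> *
          (W (s + real (Suc k) * (L / real (Suc (\<rho> i)))) \<omega> - W (s + real k * (L / real (Suc (\<rho> i)))) \<omega>) +
          e (\<rho> i) k" if "k < Suc (\<rho> i)" for i k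
        proof -
          have "X (t (\<rho> i) (Suc k)) \<omega> = x + A (t (\<rho> i) (Suc k)) \<omega> + J (t (\<rho> i) (Suc k)) \<omega>"
            "X (t (\<rho> i) k) \<omega> = x + A (t (\<rho> i) k) \<omega> + J (t (\<rho> i) k) \<omega>"
            using elim(8) that by auto
          then show ?thesis unfolding t_def[symmetric] e_def by simp
        qed
        show "\<bar>A (t (\<rho> i) (Suc k)) \<omega> - A (t (\<rho> i) k) \<omega> -
          (B (s + real (Suc k) * (L / real (Suc (\<rho> i)))) - B (s + real k * (L / real (Suc (\<rho> i))))) *
          X (s + real k * (L / real (Suc (\<rho> i)))) \<omega>\<bar> \<le> c * \<delta> i * (L / real (Suc (\<rho> i)))"
          if k: "k < Suc (\<rho> i)" for i k
        proof -
          let ?a = "t (\<rho> i) k" and ?b = "t (\<rho> i) (Suc k)"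
          have ab: "?b - ?a = L / real (Suc (\<rho> i))"
            unfolding t_def by (simp add: algebra_simps add_divide_distrib)
          have 1: "?a \<in> {s..s+L}" "?b \<in> {s..s+L}" using k tmem[of k "\<rho> i"] tmem[of "Suc k" "\<rho> i"] by auto
          have "0 \<le> L / real (Suc (\<rho> i))" using L by simp
          then have lt: "?a \<le> ?b" using ab by linarith
          have "\<bar>A ?b \<omega> - A ?a \<omega> - (B ?b - B ?a) * X ?a \<omega>\<bar> \<le> (\<bar>\<mu>0\<bar> + \<bar>\<mu>0 - \<mu>1\<bar>) * \<delta> i * (?b - ?a)"
            unfolding A_def B_def
          proof (rule switching_drift_increment[of s \<theta> \<omega>, OF \<theta>_ge[OF elim(1)] _ lt])
            show "s \<le> ?a" using 1 by simp
            show "continuous_on {s..?b} (\<lambda>z. X z \<omega>)" using Xc' 1 by (auto intro: continuous_on_subset)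
            fix z assume "z \<in> {?a..?b}"
            then show "\<bar>X z \<omega> - X ?a \<omega>\<bar> \<le> \<delta> i" using 1 ab by (intro \<delta>(2)) auto
          qed
          then show ?thesis unfolding ab unfolding t_def c_def .
        qed
        show "(\<lambda>i. c * \<delta> i) \<longlonglongrightarrow> 0" using tendsto_mult_left[OF \<delta>(1), of c] by simp
        show "(\<lambda>i. \<Sum>k<Suc (\<rho> i). Dp (s + real k * (L / real (Suc (\<rho> i)))) \<omega> * e' X (\<rho> i) k \<omega>) \<longlonglongrightarrow> 0"
          using l1 unfolding t_def .
        show "(\<lambda>i. \<Sum>k<Suc (\<rho> i). (W (s + real (Suc k) * (L / real (Suc (\<rho> i)))) \<omega> -
              W (s + real k * (L / real (Suc (\<rho> i)))) \<omega>)^2 - L / real (Suc (\<rho> i))) \<longlonglongrightarrow> 0"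
          using l3 unfolding dq_def t_def .
        show "(\<lambda>i. \<Sum>k<Suc (\<rho> i). Dp (s + real k * (L / real (Suc (\<rho> i)))) \<omega> *
            X (s + real k * (L / real (Suc (\<rho> i)))) \<omega> *
            ((W (s + real (Suc k) * (L / real (Suc (\<rho> i)))) \<omega> -
              W (s + real k * (L / real (Suc (\<rho> i)))) \<omega>)^2 - L / real (Suc (\<rho> i)))) \<longlonglongrightarrow> 0"
          using l4 unfolding dq_def t_def .
        show "0 \<le> c" by (simp add: c_def)
        show "\<bar>B a - B b\<bar> \<le> c * \<bar>a - b\<bar>" for a b by (rule Blip)
        show "Dp a \<omega> = exp (- B a - \<sigma> * W a \<omega> + \<sigma>^2 * (a - s) / 2)" for a by (rule DpB)
      qed (fact L(1) \<sigma> Ntop Xc' Wc' l2 l5 zero_less_Suc)+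
      also have "\<dots> = x"
        using elim(4,5) \<theta>_ge[OF elim(1)] by (simp add: Dp_def occupation_start)
      finally have "X u \<omega> * Dp u \<omega> = x" by (simp add: L(2))
      moreover have "Dp u \<omega> * price_factor \<mu>0 \<mu>1 \<sigma> s W \<theta> u \<omega> = 1"
        unfolding Dp_def price_factor_def exp_add[symmetric] by simp
      ultimately show ?case by (metis mult.assoc mult.right_neutral)
    qed
  qed
qed

end

section \<open>The law of the driving noise\<close>

lemma (in prob_space) indep_set_joint_law:
  assumes AB: "indep_set (sets A) (sets B)" and sp: "space A = space M" "space B = space M"
    and X: "X \<in> measurable A S" and Y: "Y \<in> measurable B T"
  shows "distr M (S \<Otimes>\<^sub>M T) (\<lambda>\<omega>. (X \<omega>, Y \<omega>)) = distr M S X \<Otimes>\<^sub>M distr M T Y"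
proof -
  have sub: "sets A \<subseteq> events" "sets B \<subseteq> events"
    using AB by (auto dest: indep_setD_ev1 indep_setD_ev2)
  have XM [measurable]: "X \<in> measurable M S" and YM [measurable]: "Y \<in> measurable M T"
    using X Y sub sp by (auto intro: measurable_mono_sets)
  interpret X: prob_space "distr M S X" by (rule prob_space_distr) measurable
  interpret Y: prob_space "distr M T Y" by (rule prob_space_distr) measurable
  show ?thesis
  proof (rule pair_measure_eqI[symmetric])
    fix C D assume "C \<in> sets (distr M S X)" "D \<in> sets (distr M T Y)"
    then have C [measurable]: "C \<in> sets S" and D [measurable]: "D \<in> sets T" by auto
    have i: "X -` C \<inter> space M \<in> sets A" "Y -` D \<inter> space M \<in> sets B"
      using measurable_sets[OF X C] measurable_sets[OF Y D] sp by auto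
    have "emeasure (distr M (S \<Otimes>\<^sub>M T) (\<lambda>\<omega>. (X \<omega>, Y \<omega>))) (C \<times> D)
      = emeasure M ((X -` C \<inter> space M) \<inter> (Y -` D \<inter> space M))"
      by (subst emeasure_distr) (auto intro!: arg_cong[where f = "emeasure M"])
    also have "\<dots> = emeasure M (X -` C \<inter> space M) * emeasure M (Y -` D \<inter> space M)"
      using indep_setD[OF AB i] by (simp add: emeasure_eq_measure ennreal_mult)
    finally show "emeasure (distr M S X) C * emeasure (distr M T Y) D
      = emeasure (distr M (S \<Otimes>\<^sub>M T) (\<lambda>\<omega>. (X \<omega>, Y \<omega>))) (C \<times> D)"
      by (simp add: emeasure_distr)
  qed (auto intro: X.sigma_finite_measure_axioms Y.sigma_finite_measure_axioms)
qed

section \<open>Tail of the switching time and finite-dimensional laws\<close>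

context noise begin

text \<open>The conditioning is undone with the probability 1 - p of a switch after s. For p = 1 the
  conditional law is void, but a switch after s is then a null event and both sides are 0.\<close>

lemma \<theta>_tail:
  assumes u: "s \<le> u"
  shows "\<P>(\<omega> in M. ereal u < \<theta> \<omega>) = (1 - p) * exp (- (lam * (u - s)))"
proof -
  have p: "\<P>(\<omega> in M. \<theta> \<omega> = ereal s) = p"
    and cond: "p < 1 \<Longrightarrow> \<P>(\<omega> in M. ereal u < \<theta> \<omega> \<bar> ereal s < \<theta> \<omega>) = exp (- (lam * (u - s)))"
    using noise u unfolding driving_noise_def switching_time_def by auto
  have "{\<omega> \<in> space M. ereal s < \<theta> \<omega>} = space M - {\<omega> \<in> space M. \<theta> \<omega> = ereal s}"
    using \<theta>_ge by (force simp: less_le)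
  then have gt: "\<P>(\<omega> in M. ereal s < \<theta> \<omega>) = 1 - p"
    using p by (simp add: prob_compl)
  have both: "{\<omega> \<in> space M. ereal u < \<theta> \<omega> \<and> ereal s < \<theta> \<omega>} = {\<omega> \<in> space M. ereal u < \<theta> \<omega>}"
    using u by (auto intro: le_less_trans[of "ereal s" "ereal u"])
  show ?thesis
  proof (cases "p < 1")
    case True
    then show ?thesis using cond gt unfolding cond_prob_def both by (simp add: field_simps)
  next
    case False
    have "\<P>(\<omega> in M. ereal u < \<theta> \<omega>) \<le> \<P>(\<omega> in M. ereal s < \<theta> \<omega>)"
      using u by (intro finite_measure_mono) (auto intro: le_less_trans[of "ereal s" "ereal u"])
    also have "\<dots> \<le> 0" using gt False by simp
    finally have "\<P>(\<omega> in M. ereal u < \<theta> \<omega>) = 0" by (simp add: measure_le_0_iff)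
    moreover have "p = 1" using False p prob_le_1[of "{\<omega> \<in> space M. \<theta> \<omega> = ereal s}"] by simp
    ultimately show ?thesis by simp
  qed
qed

text \<open>The latest time is integrated out: the value at \<open>s + b\<close> is the value at
  \<open>s + Max J\<close> plus an independent normal increment, so the factor at \<open>b\<close>
  turns into a function of the value at \<open>s + Max J\<close> and is absorbed there.\<close>

lemma gaussian_step:
  fixes f :: "real \<Rightarrow> real \<Rightarrow> ennreal"
  assumes J: "finite J" "J \<subseteq> {0..}" "0 \<in> J" and b: "Max J < b"
    and f [measurable]: "\<And>a. f a \<in> borel_measurable borel"
  shows "(\<integral>\<^sup>+\<omega>. (\<Prod>a\<in>insert b J. f a (W (s + a) \<omega>)) \<partial>M) =
    (\<integral>\<^sup>+\<omega>. (\<Prod>a\<in>J. (f(Max J := \<lambda>x. f (Max J) x *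
      (\<integral>\<^sup>+z. f b (x + z) \<partial>density lborel (normal_density 0 (sqrt (b - Max J)))))) a (W (s + a) \<omega>)) \<partial>M)"
proof -
  define m where "m = Max J"
  have mJ: "m \<in> J" unfolding m_def using J by (intro Max_in) auto
  have m0: "0 \<le> m" using mJ J by auto
  have bJ: "b \<notin> J" using Max_ge[OF J(1), of b] b by auto
  define D where "D = density lborel (\<lambda>x. ennreal (normal_density 0 (sqrt (b - m)) x))"
  interpret D: prob_space D unfolding D_def by (rule prob_space_normal_density) (use b in \<open>simp add: m_def\<close>)
  have D_sets [measurable_cong]: "sets D = sets borel" by (simp add: D_def)
  define H where "H \<omega> = (\<Prod>a\<in>J. f a (W (s + a) \<omega>))" for \<omega>
  \<comment> \<open>The pair collects all that the integrand takes from the past; independence of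
    the increment \<open>Z\<close> then gives a product law, and Fubini applies.\<close>
  define U where "U \<omega> = (H \<omega>, W (s + m) \<omega>)" for \<omega>
  define F :: "(ennreal \<times> real) \<times> real \<Rightarrow> ennreal"
    where "F q = fst (fst q) * f b (snd (fst q) + snd q)" for q
  have F [measurable]: "F \<in> borel_measurable ((borel \<Otimes>\<^sub>M borel) \<Otimes>\<^sub>M borel)"
    unfolding F_def[abs_def] by measurable
  define Z where "Z \<omega> = W (s + b) \<omega> - W (s + m) \<omega>" for \<omega>
  have Um: "U \<in> measurable (full_filtration (s + m)) (borel \<Otimes>\<^sub>M borel)"
  proof -
    have Wm: "W (s + a) \<in> borel_measurable (full_filtration (s + m))" if "a \<in> J" for a
      using that J Max_ge[OF J(1) that] by (auto intro!: W_measurable_full simp: m_def)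
    have "H \<in> borel_measurable (full_filtration (s + m))"
      unfolding H_def by (intro borel_measurable_prod_ennreal measurable_compose[OF Wm f])
    then show ?thesis unfolding U_def using Wm[OF mJ] by (intro measurable_Pair) auto
  qed
  have UM [measurable]: "U \<in> measurable M (borel \<Otimes>\<^sub>M borel)" by (rule measurable_full_events[OF Um])
  have sm: "s \<le> s + m" "s + m < s + b" using m0 b by (auto simp: m_def)
  have ZM [measurable]: "Z \<in> borel_measurable M"
    unfolding Z_def using sm by (intro borel_measurable_diff W_measurable) auto

  have DZ: "distr M lborel Z = D"
    using distributed_distr_eq_density[OF W_increment[OF sm]] by (simp add: Z_def[abs_def] D_def)
  have joint: "distr M ((borel \<Otimes>\<^sub>M borel) \<Otimes>\<^sub>M lborel) (\<lambda>\<omega>. (U \<omega>, Z \<omega>)) = distr M (borel \<Otimes>\<^sub>M borel) U \<Otimes>\<^sub>M D"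
    unfolding DZ[symmetric]
  proof (rule indep_set_joint_law[OF indep_full_increment[OF sm]])
    show "Z \<in> measurable (vimage_algebra (space M) (\<lambda>\<omega>. W (s + b) \<omega> - W (s + m) \<omega>) borel) lborel"
      unfolding Z_def using measurable_vimage_algebra1[of "\<lambda>\<omega>. W (s + b) \<omega> - W (s + m) \<omega>" "space M" borel]
      by simp
  qed (use Um in auto)
  have "(\<integral>\<^sup>+\<omega>. (\<Prod>a\<in>insert b J. f a (W (s + a) \<omega>)) \<partial>M) = (\<integral>\<^sup>+\<omega>. H \<omega> * f b (W (s + m) \<omega> + Z \<omega>) \<partial>M)"
    using J bJ by (intro nn_integral_cong) (simp add: H_def Z_def mult.commute)
  also have "\<dots> = (\<integral>\<^sup>+\<omega>. F (U \<omega>, Z \<omega>) \<partial>M)"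
    by (simp add: U_def F_def)
  also have "\<dots> = (\<integral>\<^sup>+q. F q \<partial>distr M ((borel \<Otimes>\<^sub>M borel) \<Otimes>\<^sub>M lborel) (\<lambda>\<omega>. (U \<omega>, Z \<omega>)))"
    by (rule nn_integral_distr[symmetric]) measurable
  also have "\<dots> = (\<integral>\<^sup>+q. (\<integral>\<^sup>+z. F (q, z) \<partial>D) \<partial>distr M (borel \<Otimes>\<^sub>M borel) U)"
    unfolding joint by (rule D.nn_integral_fst[symmetric]) measurable
  also have "\<dots> = (\<integral>\<^sup>+\<omega>. (\<integral>\<^sup>+z. F (U \<omega>, z) \<partial>D) \<partial>M)"
    by (rule nn_integral_distr) measurable
  also have "\<dots> = (\<integral>\<^sup>+\<omega>. (\<integral>\<^sup>+z. H \<omega> * f b (W (s + m) \<omega> + z) \<partial>D) \<partial>M)"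
    by (simp add: F_def U_def)
  also have "\<dots> = (\<integral>\<^sup>+\<omega>. (\<Prod>a\<in>J. (f(m := \<lambda>x. f m x * (\<integral>\<^sup>+z. f b (x + z) \<partial>D))) a (W (s + a) \<omega>)) \<partial>M)"
  proof (intro nn_integral_cong)
    fix \<omega>
    have "(\<Prod>a\<in>J - {m}. (f(m := \<lambda>x. f m x * (\<integral>\<^sup>+z. f b (x + z) \<partial>D))) a (W (s + a) \<omega>))
        = (\<Prod>a\<in>J - {m}. f a (W (s + a) \<omega>))"
      by (intro prod.cong) auto
    then have "(\<Prod>a\<in>J. (f(m := \<lambda>x. f m x * (\<integral>\<^sup>+z. f b (x + z) \<partial>D))) a (W (s + a) \<omega>))
      = H \<omega> * (\<integral>\<^sup>+z. f b (W (s + m) \<omega> + z) \<partial>D)"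
      unfolding H_def prod.remove[OF J(1) mJ] by (simp add: mult_ac)
    also have "\<dots> = (\<integral>\<^sup>+z. H \<omega> * f b (W (s + m) \<omega> + z) \<partial>D)"
      by (subst nn_integral_cmult) measurable
    finally show "(\<integral>\<^sup>+z. H \<omega> * f b (W (s + m) \<omega> + z) \<partial>D) =
      (\<Prod>a\<in>J. (f(m := \<lambda>x. f m x * (\<integral>\<^sup>+z. f b (x + z) \<partial>D))) a (W (s + a) \<omega>))" by simp
  qed
  finally show ?thesis unfolding m_def D_def .
qed

end

text \<open>Induction on the latest time: the Gaussian factor absorbed in
  \<open>gaussian_step\<close> depends only on a time difference, so it is the same for both
  processes. Time 0 is always kept, so that a maximum exists and the induction ends at the almost
  sure initial value 0.\<close>

lemma brownian_nn_integral_eq: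
  assumes "noise M lam s p W \<theta>" and "noise M' lam' s' p' W' \<theta>'"
    and J: "finite J" "J \<subseteq> {0<..}" and f: "\<And>a. f a \<in> borel_measurable borel"
  shows "(\<integral>\<^sup>+\<omega>. (\<Prod>a\<in>insert 0 J. f a (W (s + a) \<omega>)) \<partial>M) =
    (\<integral>\<^sup>+\<omega>. (\<Prod>a\<in>insert (0::real) J. (f a :: real \<Rightarrow> ennreal) (W' (s' + a) \<omega>)) \<partial>M')"
proof -
  interpret N: noise M lam s p W \<theta> by fact
  interpret N': noise M' lam' s' p' W' \<theta>' by fact
  show ?thesis
    using J f
  proof (induction J arbitrary: f rule: finite_linorder_max_induct)
    case empty
    have "(\<integral>\<^sup>+\<omega>. f 0 (W s \<omega>) \<partial>M) = (\<integral>\<^sup>+\<omega>. f 0 0 \<partial>M)"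
      by (rule nn_integral_cong_AE) (use N.W_start in auto)
    moreover have "(\<integral>\<^sup>+\<omega>. f 0 (W' s' \<omega>) \<partial>M') = (\<integral>\<^sup>+\<omega>. f 0 0 \<partial>M')"
      by (rule nn_integral_cong_AE) (use N'.W_start in auto)
    ultimately show ?case by (simp add: N.emeasure_space_1 N'.emeasure_space_1)
  next
    case (insert b J)
    let ?J = "insert 0 J"
    have J: "finite ?J" "?J \<subseteq> {0..}" "0 \<in> ?J" "J \<subseteq> {0<..}" "0 < b" using insert by auto
    have b: "Max ?J < b" using insert J by (subst Max_less_iff) auto
    define D where "D = density lborel (\<lambda>x. ennreal (normal_density 0 (sqrt (b - Max ?J)) x))"
    interpret D: prob_space D unfolding D_def by (rule prob_space_normal_density) (use b in simp)
    have D_sets [measurable_cong]: "sets D = sets borel" by (simp add: D_def)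
    note [measurable] = insert.prems(2)
    have f': "(f(Max ?J := \<lambda>x. f (Max ?J) x * (\<integral>\<^sup>+z. f b (x + z) \<partial>D))) a \<in> borel_measurable borel" for a
      by (cases "a = Max ?J") (simp_all, measurable)
    have "insert 0 (insert b J) = insert b ?J" by auto
    then show ?case
      using N.gaussian_step[OF J(1-3) b, of f] N'.gaussian_step[OF J(1-3) b, of f] insert.prems(2)
        insert.IH[OF J(4) f'] unfolding D_def by simp
  qed
qed

text \<open>The time origin is moved to the starting time, so that different starting times compare.\<close>

definition noise_path ::
  "real \<Rightarrow> (real \<Rightarrow> 'w \<Rightarrow> real) \<Rightarrow> ('w \<Rightarrow> ereal) \<Rightarrow> 'w \<Rightarrow> (real \<Rightarrow> real) \<times> ereal" where
  "noise_path s W \<theta> \<omega> = ((\<lambda>a\<in>{0..}. W (s + a) \<omega>), \<theta> \<omega> - ereal s)"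

definition canonical_space :: "((real \<Rightarrow> real) \<times> ereal) measure" where
  "canonical_space = (\<Pi>\<^sub>M a\<in>{0..}. borel) \<Otimes>\<^sub>M borel"

text \<open>Cylinder sets over finitely many times determine a law on the product space, and their
  probabilities are integrals of products of indicators.\<close>

lemma brownian_law_eq:
  assumes "noise M lam s p W \<theta>" and "noise M' lam' s' p' W' \<theta>'"
  shows "distr M (\<Pi>\<^sub>M a\<in>{0..}. borel) (\<lambda>\<omega>. \<lambda>a\<in>{0..}. W (s + a) \<omega>) =
    distr M' (\<Pi>\<^sub>M a\<in>{0..}. borel) (\<lambda>\<omega>. \<lambda>a\<in>{0..}. W' (s' + a) \<omega>)"
proof -
  interpret N: noise M lam s p W \<theta> by fact
  interpret N': noise M' lam' s' p' W' \<theta>' by fact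
  have m: "(\<lambda>\<omega>. \<lambda>a\<in>{0..}. W (s + a) \<omega>) \<in> measurable M (\<Pi>\<^sub>M a\<in>{0..}. borel)"
    by (intro measurable_restrict N.W_measurable) auto
  have m': "(\<lambda>\<omega>. \<lambda>a\<in>{0..}. W' (s' + a) \<omega>) \<in> measurable M' (\<Pi>\<^sub>M a\<in>{0..}. borel)"
    by (intro measurable_restrict N'.W_measurable) auto
  \<comment> \<open>Time 0 is adjoined with the factor 1 if the cylinder does not involve
    it.\<close>
  have key: "emeasure (distr L (\<Pi>\<^sub>M a\<in>{0..}. borel) (\<lambda>\<omega>. \<lambda>a\<in>{0..}. V (c + a) \<omega>))
      (prod_emb {0..} (\<lambda>_. borel) J (Pi\<^sub>E J A)) =
      (\<integral>\<^sup>+\<omega>. (\<Prod>a\<in>insert 0 (J - {0}). (if a \<in> J then indicator (A a) else (\<lambda>_. 1)) (V (c + a) \<omega>)) \<partial>L)"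
    if mV: "(\<lambda>\<omega>. \<lambda>a\<in>{0..}. V (c + a) \<omega>) \<in> measurable L (\<Pi>\<^sub>M a\<in>{0..}. borel)"
      and Vm: "\<And>a. 0 \<le> a \<Longrightarrow> V (c + a) \<in> borel_measurable L"
      and J: "finite J" "J \<subseteq> {0..}" and A: "\<And>a. a \<in> J \<Longrightarrow> A a \<in> sets borel"
    for L :: "'x measure" and V :: "real \<Rightarrow> 'x \<Rightarrow> real" and c and J :: "real set" and A
  proof -
    have e: "(\<lambda>\<omega>. \<lambda>a\<in>{0..}. V (c + a) \<omega>) -` prod_emb {0..} (\<lambda>_. borel) J (Pi\<^sub>E J A) \<inter> space L =
        {\<omega> \<in> space L. \<forall>a\<in>J. V (c + a) \<omega> \<in> A a}"
      using J by (auto simp: prod_emb_def PiE_iff subset_eq Ball_def)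
    have "emeasure (distr L (\<Pi>\<^sub>M a\<in>{0..}. borel) (\<lambda>\<omega>. \<lambda>a\<in>{0..}. V (c + a) \<omega>))
      (prod_emb {0..} (\<lambda>_. borel) J (Pi\<^sub>E J A)) = emeasure L {\<omega> \<in> space L. \<forall>a\<in>J. V (c + a) \<omega> \<in> A a}"
      using J A unfolding e[symmetric]
      by (intro emeasure_distr mV sets_PiM_I) auto
    also have "\<dots> = (\<integral>\<^sup>+\<omega>. indicator {\<omega> \<in> space L. \<forall>a\<in>J. V (c + a) \<omega> \<in> A a} \<omega> \<partial>L)"
    proof (rule nn_integral_indicator[symmetric])
      have "{\<omega> \<in> space L. V (c + a) \<omega> \<in> A a} \<in> sets L" if "a \<in> J" for a
      proof -
        have [measurable]: "V (c + a) \<in> borel_measurable L" "A a \<in> sets borel"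
          using Vm[of a] A[OF that] J that by auto
        show ?thesis by measurable
      qed
      then show "{\<omega> \<in> space L. \<forall>a\<in>J. V (c + a) \<omega> \<in> A a} \<in> sets L"
        using J by (intro sets.sets_Collect_finite_All) auto
    qed
    also have "\<dots> = (\<integral>\<^sup>+\<omega>. (\<Prod>a\<in>insert 0 (J - {0}). (if a \<in> J then indicator (A a) else (\<lambda>_. 1)) (V (c + a) \<omega>)) \<partial>L)"
    proof (intro nn_integral_cong)
      fix \<omega> assume \<omega>: "\<omega> \<in> space L"
      have "(\<Prod>a\<in>insert 0 (J - {0}). (if a \<in> J then indicator (A a) else (\<lambda>_. 1)) (V (c + a) \<omega>))
        = (\<Prod>a\<in>J. indicator (A a) (V (c + a) \<omega>) :: ennreal)"
        using J by (intro prod.mono_neutral_cong_right) auto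
      also have "\<dots> = (if \<forall>a\<in>J. V (c + a) \<omega> \<in> A a then 1 else 0)"
        using J(1) by (auto simp: indicator_def prod_zero_iff)
      finally show "indicator {\<omega> \<in> space L. \<forall>a\<in>J. V (c + a) \<omega> \<in> A a} \<omega> =
        (\<Prod>a\<in>insert 0 (J - {0}). (if a \<in> J then indicator (A a) else (\<lambda>_. 1)) (V (c + a) \<omega>) :: ennreal)"
        using \<omega> by (auto simp: indicator_def)
    qed
    finally show ?thesis .
  qed
  show ?thesis
  proof (rule measure_eqI_PiM_infinite)
    fix A :: "real \<Rightarrow> real set" and J
    assume J: "finite J" "J \<subseteq> {0::real..}" and A: "\<And>i. i \<in> J \<Longrightarrow> A i \<in> sets borel"
    have f: "(if a \<in> J then indicator (A a) else (\<lambda>_. 1)) \<in> borel_measurable (borel :: real measure)" for a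
      using A by auto
    have J': "finite (J - {0})" "J - {0} \<subseteq> {0<..}" using J by (auto simp: subset_eq less_le)
    have 1: "\<And>a. 0 \<le> a \<Longrightarrow> W (s + a) \<in> borel_measurable M" by (rule N.W_measurable) simp
    have 2: "\<And>a. 0 \<le> a \<Longrightarrow> W' (s' + a) \<in> borel_measurable M'" by (rule N'.W_measurable) simp
    show "emeasure (distr M (\<Pi>\<^sub>M a\<in>{0..}. borel) (\<lambda>\<omega>. \<lambda>a\<in>{0..}. W (s + a) \<omega>))
         (prod_emb {0..} (\<lambda>_. borel) J (Pi\<^sub>E J A)) =
      emeasure (distr M' (\<Pi>\<^sub>M a\<in>{0..}. borel) (\<lambda>\<omega>. \<lambda>a\<in>{0..}. W' (s' + a) \<omega>))
         (prod_emb {0..} (\<lambda>_. borel) J (Pi\<^sub>E J A))"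
      using key[OF m 1 J A] key[OF m' 2 J A] brownian_nn_integral_eq[OF assms J' f] by simp
  next
    show "finite_measure (distr M (\<Pi>\<^sub>M a\<in>{0..}. borel) (\<lambda>\<omega>. \<lambda>a\<in>{0..}. W (s + a) \<omega>))"
      using N.prob_space_distr[OF m] by (simp add: prob_space_def)
  qed simp_all
qed

text \<open>Open upper half-lines determine a law on \<open>ereal\<close>. The exponential tail
  covers real b \<ge> 0; for b < 0 the tail is 1 because \<theta> does not precede the start, and
  nothing lies above \<infinity>.\<close>

lemma switching_law_eq:
  assumes "noise M lam s p W \<theta>" and "noise M' lam s' p W' \<theta>'"
  shows "distr M borel (\<lambda>\<omega>. \<theta> \<omega> - ereal s) = distr M' borel (\<lambda>\<omega>. \<theta>' \<omega> - ereal s')"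
proof -
  interpret N: noise M lam s p W \<theta> by fact
  interpret N': noise M' lam s' p W' \<theta>' by fact
  \<comment> \<open>The whole space is adjoined so that it can serve as the exhausting sequence of
    the uniqueness theorem for measures.\<close>
  define E where "E = insert UNIV (range (greaterThan :: ereal \<Rightarrow> ereal set))"
  have tail: "emeasure (distr L borel (\<lambda>\<omega>. \<kappa> \<omega> - ereal c)) {b<..} =
      (if b = \<infinity> then 0 else if b < 0 then 1 else ennreal ((1 - p) * exp (- (lam * real_of_ereal b))))"
    if "noise L lam c p V \<kappa>" for L :: "'x measure" and V \<kappa> c b
  proof -
    interpret L: noise L lam c p V \<kappa> by fact
    have "emeasure (distr L borel (\<lambda>\<omega>. \<kappa> \<omega> - ereal c)) {b<..} = emeasure L {\<omega> \<in> space L. b < \<kappa> \<omega> - ereal c}"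
      by (subst emeasure_distr) (auto intro!: arg_cong[where f = "emeasure L"])
    also have "\<dots> = (if b = \<infinity> then 0 else if b < 0 then 1 else ennreal ((1 - p) * exp (- (lam * real_of_ereal b))))"
    proof (cases b)
      case (real u)
      have "b < \<kappa> \<omega> - ereal c \<longleftrightarrow> ereal (c + u) < \<kappa> \<omega>" if "\<omega> \<in> space L" for \<omega>
        using L.\<theta>_ge[OF that] by (cases "\<kappa> \<omega>") (auto simp: real)
      then have e: "{\<omega> \<in> space L. b < \<kappa> \<omega> - ereal c} = {\<omega> \<in> space L. ereal (c + u) < \<kappa> \<omega>}" by auto
      show ?thesis
      proof (cases "u < 0")
        case True
        have "ereal (c + u) < \<kappa> \<omega>" if "\<omega> \<in> space L" for \<omega>
          by (rule less_le_trans[OF _ L.\<theta>_ge[OF that]]) (use True in simp)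
        then have "{\<omega> \<in> space L. ereal (c + u) < \<kappa> \<omega>} = space L" by auto
        then show ?thesis unfolding e using True real by (simp add: L.emeasure_space_1)
      next
        case False
        then show ?thesis unfolding e using L.\<theta>_tail[of "c + u"] real
          by (simp add: L.emeasure_eq_measure)
      qed
    next
      case PInf
      then show ?thesis by simp
    next
      case MInf
      have "- \<infinity> < \<kappa> \<omega> - ereal c" if "\<omega> \<in> space L" for \<omega>
        using L.\<theta>_ge[OF that] by (cases "\<kappa> \<omega>") auto
      then have "{\<omega> \<in> space L. b < \<kappa> \<omega> - ereal c} = space L" using MInf by auto
      then show ?thesis using MInf by (simp add: L.emeasure_space_1)
    qed
    finally show ?thesis .
  qed
  show ?thesis
  proof (rule measure_eqI_generator_eq[where E = E and \<Omega> = UNIV and A = "\<lambda>_. UNIV"])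
    show "Int_stable E"
    proof (rule Int_stableI)
      have i: "{x<..} \<inter> {y<..} = {max x y<..}" for x y :: ereal by auto
      fix a b assume "a \<in> E" "b \<in> E"
      then show "a \<inter> b \<in> E" unfolding E_def using i by auto
    qed
    have "sigma_sets UNIV E = sigma_sets UNIV (range (greaterThan :: ereal \<Rightarrow> ereal set))"
      by (intro sigma_sets_eqI) (auto simp: E_def sigma_sets_top)
    then have "sigma_sets UNIV E = sets (borel :: ereal measure)"
      unfolding borel_Ioi by simp
    then show "sets (distr M borel (\<lambda>\<omega>. \<theta> \<omega> - ereal s)) = sigma_sets UNIV E"
      "sets (distr M' borel (\<lambda>\<omega>. \<theta>' \<omega> - ereal s')) = sigma_sets UNIV E" by simp_all
    fix X assume "X \<in> E"
    then consider "X = UNIV" | b where "X = {b<..}" unfolding E_def by blast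
    then show "emeasure (distr M borel (\<lambda>\<omega>. \<theta> \<omega> - ereal s)) X = emeasure (distr M' borel (\<lambda>\<omega>. \<theta>' \<omega> - ereal s')) X"
    proof cases
      case 1
      then show ?thesis by (simp add: emeasure_distr N.emeasure_space_1 N'.emeasure_space_1)
    next
      case 2
      then show ?thesis using tail[OF assms(1), of b] tail[OF assms(2), of b] by simp
    qed
  next
    show "emeasure (distr M borel (\<lambda>\<omega>. \<theta> \<omega> - ereal s)) UNIV \<noteq> \<infinity>"
      by (simp add: emeasure_distr N.emeasure_space_1)
  qed (auto simp: E_def)
qed

lemma (in noise) noise_path_law:
  "distr M canonical_space (noise_path s W \<theta>) =
    distr M (\<Pi>\<^sub>M a\<in>{0..}. borel) (\<lambda>\<omega>. \<lambda>a\<in>{0..}. W (s + a) \<omega>) \<Otimes>\<^sub>M distr M borel (\<lambda>\<omega>. \<theta> \<omega> - ereal s)"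
proof -
  have "(\<lambda>\<omega>. \<lambda>a\<in>{0..}. W (s + a) \<omega>) \<in> measurable (generated_sigma M W {s..}) (\<Pi>\<^sub>M a\<in>{0..}. borel)"
    by (intro measurable_restrict measurable_generated_sigma) auto
  moreover have "(\<lambda>\<omega>. \<theta> \<omega> - ereal s) \<in> borel_measurable (vimage_algebra (space M) \<theta> borel)"
    by (rule measurable_compose[OF measurable_vimage_algebra1]) auto
  ultimately show ?thesis
    unfolding noise_path_def[abs_def] canonical_space_def
    by (intro indep_set_joint_law[OF W_\<theta>_indep]) auto
qed

lemma noise_path_law_eq:
  assumes "noise M lam s p W \<theta>" and "noise M' lam s' p W' \<theta>'"
  shows "distr M canonical_space (noise_path s W \<theta>) = distr M' canonical_space (noise_path s' W' \<theta>')"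
  unfolding noise.noise_path_law[OF assms(1)] noise.noise_path_law[OF assms(2)]
    brownian_law_eq[OF assms] switching_law_eq[OF assms] ..

section \<open>Transport of stopping rules\<close>

lemma space_canonical: "space canonical_space = (\<Pi>\<^sub>E a\<in>{0..}. UNIV) \<times> UNIV"
  by (simp add: canonical_space_def space_pair_measure space_PiM)

lemma canonical_coordinate_measurable:
  "0 \<le> b \<Longrightarrow> (\<lambda>q. fst q b) \<in> borel_measurable canonical_space"
  unfolding canonical_space_def
  by (rule measurable_compose[OF measurable_fst measurable_component_singleton]) auto

lemma snd_canonical_measurable: "snd \<in> borel_measurable canonical_space"
  unfolding canonical_space_def by (rule measurable_snd)

text \<open>The raw filtration, without null sets: those depend on a measure, whereas a canonical
  event is to be pulled back to different probability spaces.\<close>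

definition canonical_filtration :: "real \<Rightarrow> ((real \<Rightarrow> real) \<times> ereal) measure" where
  "canonical_filtration a = sigma (space canonical_space)
     (sets (generated_sigma canonical_space (\<lambda>b q. fst q b) {0..a}) \<union>
      sets (generated_sigma canonical_space (state_process snd) {0..a}))"

lemma canonical_generators:
  "sets (generated_sigma canonical_space (\<lambda>b q. fst q b) {0..a}) \<union>
    sets (generated_sigma canonical_space (state_process snd) {0..a}) \<subseteq> Pow (space canonical_space)"
  using sets.sets_into_space[of _ "generated_sigma canonical_space _ {0..a}"] by auto

lemma space_canonical_filtration [simp]: "space (canonical_filtration a) = space canonical_space"
  unfolding canonical_filtration_def by (rule space_measure_of[OF canonical_generators])

lemma sets_canonical_filtration:
  "sets (canonical_filtration a) = sigma_sets (space canonical_space)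
     (sets (generated_sigma canonical_space (\<lambda>b q. fst q b) {0..a}) \<union>
      sets (generated_sigma canonical_space (state_process snd) {0..a}))"
  unfolding canonical_filtration_def by (rule sets_measure_of[OF canonical_generators])

lemma canonical_filtration_subset: "sets (canonical_filtration a) \<subseteq> sets canonical_space"
proof -
  have "sets (generated_sigma canonical_space (\<lambda>b q. fst q b) {0..a}) \<subseteq> sets canonical_space"
    by (intro sets_generated_sigma_subset canonical_coordinate_measurable) auto
  moreover have "sets (generated_sigma canonical_space (state_process snd) {0..a}) \<subseteq> sets canonical_space"
    by (intro sets_generated_sigma_subset state_process_measurable snd_canonical_measurable) auto
  ultimately show ?thesis
    unfolding sets_canonical_filtration by (intro sets.sigma_sets_subset) auto
qed

lemma measurable_into_generated_sigma:
  assumes "f \<in> space N \<rightarrow> space M" and "\<And>b. b \<in> I \<Longrightarrow> (\<lambda>\<omega>. Z b (f \<omega>)) \<in> borel_measurable N"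
  shows "f \<in> measurable N (generated_sigma M Z I)"
  unfolding generated_sigma_def
proof (rule measurable_measure_of)
  fix y assume "y \<in> (\<Union>a\<in>I. {Z a -` A \<inter> space M |A. A \<in> sets borel})"
  then obtain a A where a: "a \<in> I" "A \<in> sets borel" "y = Z a -` A \<inter> space M" by auto
  have "f -` y \<inter> space N = (\<lambda>\<omega>. Z a (f \<omega>)) -` A \<inter> space N"
    using assms(1) a(3) by auto
  then show "f -` y \<inter> space N \<in> sets N"
    using measurable_sets[OF assms(2)[OF a(1)] a(2)] by simp
qed (use assms(1) in auto)

lemma state_process_noise_path:
  "state_process snd b (noise_path s W \<theta> \<omega>) = state_process \<theta> (s + b) \<omega>"
  by (cases "\<theta> \<omega>") (auto simp: state_process_def noise_path_def)

lemma occupation_noise_path: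
  "ereal s \<le> \<theta> \<omega> \<Longrightarrow> occupation snd b (noise_path s W \<theta> \<omega>) = occupation \<theta> (s + b) \<omega>"
  by (cases "\<theta> \<omega>") (auto simp: occupation_def noise_path_def)

lemma price_factor_noise_path:
  assumes "ereal s \<le> \<theta> \<omega>" "0 \<le> b"
  shows "price_factor \<mu>0 \<mu>1 \<sigma> 0 (\<lambda>b q. fst q b) snd b (noise_path s W \<theta> \<omega>) =
    price_factor \<mu>0 \<mu>1 \<sigma> s W \<theta> (s + b) \<omega>"
  using occupation_noise_path[of s \<theta> \<omega> b W, OF assms(1)] assms(2)
  by (simp add: price_factor_def noise_path_def)

lemma price_factor_measurable:
  assumes [measurable]: "W a \<in> borel_measurable N" "\<theta> \<in> borel_measurable N"
  shows "price_factor \<mu>0 \<mu>1 \<sigma> s W \<theta> a \<in> borel_measurable N"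
  unfolding price_factor_def[abs_def] by measurable

text \<open>The alternative \<open>k = n\<close> is a forced stop, so the minimum exists. Any
  sequence of events defines a rule; hence replacing each \<open>A k\<close> by an almost surely
  equal event changes the rule on a null set only.\<close>

definition first_entry :: "nat \<Rightarrow> (nat \<Rightarrow> 'w set) \<Rightarrow> 'w \<Rightarrow> nat" where
  "first_entry n A \<omega> = (LEAST k. k = n \<or> \<omega> \<in> A k)"

lemma first_entry_le: "first_entry n A \<omega> \<le> n"
  unfolding first_entry_def by (rule Least_le) simp

lemma first_entry_le_if: "\<omega> \<in> A k \<Longrightarrow> first_entry n A \<omega> \<le> k"
  unfolding first_entry_def by (rule Least_le) simp

lemma first_entry_mem: "first_entry n A \<omega> = n \<or> \<omega> \<in> A (first_entry n A \<omega>)"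
  unfolding first_entry_def by (rule LeastI[of _ n]) simp

lemma first_entry_measurable:
  assumes "\<And>k. A k \<in> sets N"
  shows "first_entry n A \<in> measurable N (count_space UNIV)"
proof -
  note [measurable] = assms
  show ?thesis unfolding first_entry_def[abs_def] by measurable
qed

lemma first_entry_cong:
  "(\<And>k. \<omega> \<in> A k \<longleftrightarrow> \<omega>' \<in> B k) \<Longrightarrow> first_entry n A \<omega> = first_entry n B \<omega>'"
  by (simp add: first_entry_def)

text \<open>Dividing by \<open>Suc n\<close> avoids the division by 0 at n = 0; the indices from 0
  to \<open>Suc n\<close> run through the interval.\<close>

definition grid_time :: "real \<Rightarrow> real \<Rightarrow> nat \<Rightarrow> nat \<Rightarrow> real" where
  "grid_time s T n k = s + real k * ((T - s) / real (Suc n))"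

lemma grid_time_mono: "s \<le> T \<Longrightarrow> j \<le> k \<Longrightarrow> grid_time s T n j \<le> grid_time s T n k"
  unfolding grid_time_def by (intro add_left_mono mult_right_mono) auto

lemma grid_time_end: "grid_time s T n (Suc n) = T"
  by (simp add: grid_time_def del: of_nat_Suc)

lemma grid_time_mem: "s \<le> T \<Longrightarrow> k \<le> Suc n \<Longrightarrow> grid_time s T n k \<in> {s..T}"
  using grid_time_mono[of s T 0 k n] grid_time_mono[of s T k "Suc n" n]
  by (simp add: grid_time_end) (simp add: grid_time_def)

lemma grid_time_Suc: "grid_time s T n (Suc k) = grid_time s T n k + (T - s) / real (Suc n)"
  by (simp add: grid_time_def algebra_simps add_divide_distrib diff_divide_distrib)

definition grid_rule :: "real \<Rightarrow> real \<Rightarrow> nat \<Rightarrow> (nat \<Rightarrow> 'w set) \<Rightarrow> 'w \<Rightarrow> real" where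
  "grid_rule s T n A \<omega> = grid_time s T n (first_entry (Suc n) A \<omega>)"

definition discounted_payoff :: "real \<Rightarrow> real \<Rightarrow> real \<Rightarrow> (real \<Rightarrow> 'w \<Rightarrow> real) \<Rightarrow> real \<Rightarrow> 'w \<Rightarrow> ennreal" where
  "discounted_payoff r K s X a \<omega> = ennreal (exp (- r * (a - s)) * max 0 (X a \<omega> - K))"

lemma stopping_value_eq:
  "stopping_value r K T s M W \<theta> X =
    (SUP \<tau>\<in>stopping_times s T M W \<theta>. \<integral>\<^sup>+\<omega>. discounted_payoff r K s X (\<tau> \<omega>) \<omega> \<partial>M)"
  by (simp add: stopping_value_def discounted_payoff_def)

lemma stopping_times_mono: "T \<le> T' \<Longrightarrow> stopping_times s T M W \<theta> \<subseteq> stopping_times s T' M W \<theta>"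
  by (force simp: stopping_times_def)

text \<open>The rule has stopped by time u if and only if some \<open>A k\<close> with grid time at
  most u has occurred, or T has been reached; for the latter the final index is given the whole
  space as its event.\<close>

lemma grid_rule_stopping_time:
  assumes sT: "s \<le> T" and A: "\<And>k. A k \<in> sets (augmented_filtration s M W \<theta> (grid_time s T n k))"
  shows "grid_rule s T n A \<in> stopping_times s T M W \<theta>"
proof -
  have "stopping_time (augmented_filtration s M W \<theta>) (grid_rule s T n A)"
  proof (rule stopping_timeI)
    fix u
    let ?F = "augmented_filtration s M W \<theta> u"
    have eq: "{\<omega> \<in> space ?F. grid_rule s T n A \<omega> \<le> u} =
      (\<Union>k\<in>{k. k \<le> Suc n \<and> grid_time s T n k \<le> u}. if k = Suc n then space M else A k)" (is "?L = ?R")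
    proof (intro set_eqI iffI)
      fix \<omega> assume "\<omega> \<in> ?L"
      then show "\<omega> \<in> ?R"
        using first_entry_le[of "Suc n" A \<omega>] first_entry_mem[of "Suc n" A \<omega>]
        by (auto simp: grid_rule_def intro!: exI[of _ "first_entry (Suc n) A \<omega>"])
    next
      fix \<omega> assume "\<omega> \<in> ?R"
      then obtain k where k: "k \<le> Suc n" "grid_time s T n k \<le> u" "\<omega> \<in> (if k = Suc n then space M else A k)"
        by blast
      have "first_entry (Suc n) A \<omega> \<le> k"
        using k(1,3) first_entry_le[of "Suc n" A \<omega>] first_entry_le_if[of \<omega> A k] by (auto split: if_splits)
      then have "grid_rule s T n A \<omega> \<le> u"
        unfolding grid_rule_def using grid_time_mono[OF sT] k(2) order_trans by blast
      moreover have "\<omega> \<in> space M"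
        using k(3) sets.sets_into_space[OF A[of k]] by (auto split: if_splits)
      ultimately show "\<omega> \<in> ?L" by simp
    qed
    have "?R \<in> sets ?F"
    proof (intro sets.finite_UN)
      fix k assume k: "k \<in> {k. k \<le> Suc n \<and> grid_time s T n k \<le> u}"
      have "A k \<in> sets ?F"
        using A[of k] augmented_filtration_mono[of "grid_time s T n k" u s M W \<theta>] k by auto
      moreover have "space M \<in> sets ?F" using sets.top[of ?F] by simp
      ultimately show "(if k = Suc n then space M else A k) \<in> sets ?F" by simp
    qed simp
    then show "Measurable.pred ?F (\<lambda>\<omega>. grid_rule s T n A \<omega> \<le> u)"
      unfolding pred_def eq .
  qed
  moreover have "grid_rule s T n A \<omega> \<in> {s..T}" for \<omega>
    unfolding grid_rule_def by (rule grid_time_mem[OF sT first_entry_le])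
  ultimately show ?thesis by (simp add: stopping_times_def)
qed

section \<open>Rounding to grids, and events as preimages under the path map\<close>

context noise begin

lemma augmented_filtration_subset_events: "sets (augmented_filtration s M W \<theta> u) \<subseteq> events"
  using augmented_subset_full full_filtration_subset_events by blast

lemma grid_payoff_measurable:
  assumes sT: "s \<le> T" and A: "\<And>k. A k \<in> events"
    and X: "\<And>a. a \<in> {s..T} \<Longrightarrow> X a \<in> borel_measurable M"
  shows "(\<lambda>\<omega>. discounted_payoff r K s X (grid_rule s T n A \<omega>) \<omega>) \<in> borel_measurable M"
proof -
  have "(\<lambda>\<omega>. discounted_payoff r K s X (grid_time s T n (min (Suc n) (first_entry (Suc n) A \<omega>))) \<omega>)
      \<in> borel_measurable M"
  proof (rule measurable_compose_countable[OF _ first_entry_measurable[OF A]])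
    fix k
    have [measurable]: "X (grid_time s T n (min (Suc n) k)) \<in> borel_measurable M"
      by (intro X grid_time_mem sT) simp
    show "(\<lambda>\<omega>. discounted_payoff r K s X (grid_time s T n (min (Suc n) k)) \<omega>) \<in> borel_measurable M"
      unfolding discounted_payoff_def by measurable
  qed
  then show ?thesis
    by (simp add: grid_rule_def min.absorb2[OF first_entry_le])
qed

text \<open>
  Rounding a stopping time up to a grid and applying Fatou's lemma along ever finer grids
  shows that only grid-valued stopping rules have to be estimated.
\<close>

lemma stopping_value_leI:
  assumes sT: "s \<le> T"
    and X: "\<And>a. a \<in> {s..T} \<Longrightarrow> X a \<in> borel_measurable M"
    and Xc: "AE \<omega> in M. continuous_on {s..T} (\<lambda>a. X a \<omega>)"
    and grid: "\<And>n A. (\<And>k. A k \<in> sets (augmented_filtration s M W \<theta> (grid_time s T n k))) \<Longrightarrow>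
      (\<integral>\<^sup>+\<omega>. discounted_payoff r K s X (grid_rule s T n A \<omega>) \<omega> \<partial>M) \<le> C"
  shows "stopping_value r K T s M W \<theta> X \<le> C"
  unfolding stopping_value_eq
proof (rule SUP_least)
  fix \<tau> assume \<tau>: "\<tau> \<in> stopping_times s T M W \<theta>"
  \<comment> \<open>With these events the first entry is at the smallest grid point not before
    \<tau>. Rounding up keeps the rule non-anticipating, and \<tau> \<le> T makes the forced stop at
    T consistent with it.\<close>
  define A where "A n k = {\<omega> \<in> space M. \<tau> \<omega> \<le> grid_time s T n k}" for n k
  have \<tau>st: "stopping_time (augmented_filtration s M W \<theta>) \<tau>" and \<tau>mem: "\<And>\<omega>. \<omega> \<in> space M \<Longrightarrow> \<tau> \<omega> \<in> {s..T}"
    using \<tau> by (auto simp: stopping_times_def)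
  have A: "A n k \<in> sets (augmented_filtration s M W \<theta> (grid_time s T n k))" for n k
    using stopping_timeD[OF \<tau>st, of "grid_time s T n k"] by (simp add: A_def pred_def)
  have Ae: "A n k \<in> events" for n k using A augmented_filtration_subset_events by blast
  have close: "\<bar>grid_rule s T n (A n) \<omega> - \<tau> \<omega>\<bar> \<le> (T - s) / real (Suc n)" if \<omega>: "\<omega> \<in> space M" for n \<omega>
  proof -
    define k where "k = first_entry (Suc n) (A n) \<omega>"
    have h: "0 \<le> (T - s) / real (Suc n)" using sT by simp
    have lower: "\<tau> \<omega> \<le> grid_time s T n k"
      using first_entry_mem[of "Suc n" "A n" \<omega>] \<tau>mem[OF \<omega>]
      by (auto simp: k_def[symmetric] A_def grid_time_end)
    have upper: "grid_time s T n k \<le> \<tau> \<omega> + (T - s) / real (Suc n)"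
    proof (cases k)
      case 0
      then have "grid_time s T n k = s" by (simp add: grid_time_def)
      moreover have "s \<le> \<tau> \<omega>" using \<tau>mem[OF \<omega>] by simp
      ultimately show ?thesis using h by linarith
    next
      case (Suc j)
      have "\<omega> \<notin> A n j" using first_entry_le_if[of \<omega> "A n" j "Suc n"] Suc k_def by auto
      then show ?thesis using \<omega> by (simp add: A_def Suc grid_time_Suc)
    qed
    show ?thesis using lower upper unfolding grid_rule_def k_def[symmetric] by simp
  qed
  have lim: "AE \<omega> in M. (\<lambda>n. discounted_payoff r K s X (grid_rule s T n (A n) \<omega>) \<omega>)
      \<longlonglongrightarrow> discounted_payoff r K s X (\<tau> \<omega>) \<omega>"
    using Xc AE_space
  proof eventually_elim
    case (elim \<omega>)
    have conv: "(\<lambda>n. grid_rule s T n (A n) \<omega>) \<longlonglongrightarrow> \<tau> \<omega>"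
    proof (rule LIM_zero_cancel, rule Lim_null_comparison)
      show "\<forall>\<^sub>F n in sequentially. norm (grid_rule s T n (A n) \<omega> - \<tau> \<omega>) \<le> (T - s) / real (Suc n)"
        using close[OF elim(2)] by simp
      show "(\<lambda>n. (T - s) / real (Suc n)) \<longlonglongrightarrow> 0"
        by (intro tendsto_divide_0[OF tendsto_const] filterlim_at_top_imp_at_infinity
            filterlim_compose[OF filterlim_real_sequentially filterlim_Suc])
    qed
    have "(\<lambda>n. X (grid_rule s T n (A n) \<omega>) \<omega>) \<longlonglongrightarrow> X (\<tau> \<omega>) \<omega>"
      by (rule continuous_on_tendsto_compose[OF elim(1) conv \<tau>mem[OF elim(2)]])
         (auto simp: grid_rule_def simp del: atLeastAtMost_iff
            intro!: always_eventually grid_time_mem[OF sT first_entry_le])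
    then show ?case unfolding discounted_payoff_def
      by (intro tendsto_ennrealI tendsto_intros conv)
  qed
  have "(\<integral>\<^sup>+\<omega>. discounted_payoff r K s X (\<tau> \<omega>) \<omega> \<partial>M) =
      (\<integral>\<^sup>+\<omega>. liminf (\<lambda>n. discounted_payoff r K s X (grid_rule s T n (A n) \<omega>) \<omega>) \<partial>M)"
    by (rule nn_integral_cong_AE) (use lim in eventually_elim, simp add: lim_imp_Liminf)
  \<comment> \<open>Nonnegativity of the payoff replaces a dominating function here.\<close>
  also have "\<dots> \<le> liminf (\<lambda>n. \<integral>\<^sup>+\<omega>. discounted_payoff r K s X (grid_rule s T n (A n) \<omega>) \<omega> \<partial>M)"
    by (rule nn_integral_liminf) (rule grid_payoff_measurable[OF sT Ae X])
  also have "\<dots> \<le> liminf (\<lambda>n. C)"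
    by (intro Liminf_mono always_eventually allI grid A)
  also have "\<dots> = C" by (simp add: Liminf_const)
  finally show "(\<integral>\<^sup>+\<omega>. discounted_payoff r K s X (\<tau> \<omega>) \<omega> \<partial>M) \<le> C" .
qed

lemma noise_path_measurable: "noise_path s W \<theta> \<in> measurable M canonical_space"
  unfolding noise_path_def[abs_def] canonical_space_def
  by (intro measurable_Pair measurable_restrict W_measurable) auto

lemma noise_path_space: "\<omega> \<in> space M \<Longrightarrow> noise_path s W \<theta> \<omega> \<in> space canonical_space"
  by (auto simp: space_canonical noise_path_def)

lemma noise_path_adapted:
  "noise_path s W \<theta> \<in> measurable (augmented_filtration s M W \<theta> (s + a)) (canonical_filtration a)"
proof -
  let ?F = "augmented_filtration s M W \<theta> (s + a)"
  have sp: "noise_path s W \<theta> \<in> space ?F \<rightarrow> space canonical_space" using noise_path_space by auto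
  have 1: "noise_path s W \<theta> \<in> measurable ?F (generated_sigma canonical_space (\<lambda>b q. fst q b) {0..a})"
    using sp by (rule measurable_into_generated_sigma)
      (auto simp: noise_path_def intro!: W_measurable_augmented)
  have 2: "noise_path s W \<theta> \<in> measurable ?F (generated_sigma canonical_space (state_process snd) {0..a})"
    using sp by (rule measurable_into_generated_sigma)
      (auto simp: state_process_noise_path intro!: state_process_measurable_augmented)
  show ?thesis unfolding canonical_filtration_def
    by (rule measurable_measure_of[OF canonical_generators sp])
       (use measurable_sets[OF 1] measurable_sets[OF 2] in auto)
qed

text \<open>The generators from \<open>W\<close> and the state process up to time s + a are
  preimages of canonical events of elapsed time a. Null sets are matched with the empty set, which
  is why the correspondence holds only almost surely.\<close>

lemma augmented_set_canonical:
  assumes "A \<in> sets (augmented_filtration s M W \<theta> (s + a))"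
  shows "\<exists>B\<in>sets (canonical_filtration a). AE \<omega> in M. \<omega> \<in> A \<longleftrightarrow> noise_path s W \<theta> \<omega> \<in> B"
proof (rule AE_eq_vimage_sigma_sets)
  show "A \<in> sigma_sets (space M) (sets (generated_sigma M W {s..s+a}) \<union>
      sets (generated_sigma M (state_process \<theta>) {s..s+a}) \<union> null_sets M)"
    using assms by (simp add: sets_augmented_filtration)
  show "noise_path s W \<theta> \<omega> \<in> space (canonical_filtration a)" if "\<omega> \<in> space M" for \<omega>
    using noise_path_space[OF that] by simp
  have gen: "\<exists>B\<in>sets (canonical_filtration a). AE \<omega> in M. \<omega> \<in> G \<longleftrightarrow> noise_path s W \<theta> \<omega> \<in> B"
    if G: "G \<in> sets (generated_sigma M V {s..s+a})"
      and V: "\<And>b \<omega>. 0 \<le> b \<Longrightarrow> V (s + b) \<omega> = Z b (noise_path s W \<theta> \<omega>)"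
      and sub: "sets (generated_sigma canonical_space Z {0..a}) \<subseteq> sets (canonical_filtration a)"
    for G V Z
  proof (rule AE_eq_vimage_sigma_sets)
    show "G \<in> sigma_sets (space M) (\<Union>v\<in>{s..s+a}. {V v -` D \<inter> space M | D. D \<in> sets borel})"
      using G by (simp add: sets_generated_sigma)
    fix G' assume "G' \<in> (\<Union>v\<in>{s..s+a}. {V v -` D \<inter> space M | D. D \<in> sets borel})"
    then obtain v D where v: "v \<in> {s..s+a}" "D \<in> sets borel" "G' = V v -` D \<inter> space M" by auto
    have "Z (v - s) -` D \<inter> space canonical_space \<in> sets (generated_sigma canonical_space Z {0..a})"
      unfolding sets_generated_sigma using v by (intro sigma_sets.Basic UN_I[of "v - s"]) auto
    moreover have "AE \<omega> in M. \<omega> \<in> G' \<longleftrightarrow> noise_path s W \<theta> \<omega> \<in> Z (v - s) -` D \<inter> space canonical_space"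
      using V[of "v - s"] v noise_path_space by (intro AE_I2) auto
    ultimately show "\<exists>B\<in>sets (canonical_filtration a). AE \<omega> in M. \<omega> \<in> G' \<longleftrightarrow> noise_path s W \<theta> \<omega> \<in> B"
      using sub by blast
  qed (use noise_path_space in auto)
  fix G assume "G \<in> sets (generated_sigma M W {s..s+a}) \<union>
      sets (generated_sigma M (state_process \<theta>) {s..s+a}) \<union> null_sets M"
  then consider "G \<in> sets (generated_sigma M W {s..s+a})" |
    "G \<in> sets (generated_sigma M (state_process \<theta>) {s..s+a})" | "G \<in> null_sets M" by blast
  then show "\<exists>B\<in>sets (canonical_filtration a). AE \<omega> in M. \<omega> \<in> G \<longleftrightarrow> noise_path s W \<theta> \<omega> \<in> B"
  proof cases
    case 1
    then show ?thesis
      by (rule gen[of G W "\<lambda>b q. fst q b"]) (auto simp: noise_path_def sets_canonical_filtration)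
  next
    case 2
    then show ?thesis
      by (rule gen[of G "state_process \<theta>" "state_process snd"])
         (auto simp: state_process_noise_path sets_canonical_filtration)
  next
    case 3
    then show ?thesis by (intro bexI[of _ "{}"]) (auto dest: AE_not_in)
  qed
qed

lemma price_factor_measurable_noise: "s \<le> a \<Longrightarrow> price_factor \<mu>0 \<mu>1 \<sigma> s W \<theta> a \<in> borel_measurable M"
  by (intro price_factor_measurable W_measurable \<theta>_measurable)

lemma price_factor_continuous:
  "AE \<omega> in M. continuous_on {s..T} (\<lambda>a. price_factor \<mu>0 \<mu>1 \<sigma> s W \<theta> a \<omega>)"
  using W_continuous AE_space
proof eventually_elim
  case (elim \<omega>)
  have "continuous_on {s..T} (\<lambda>a. occupation \<theta> a \<omega>)"
  proof (rule lipschitz_on_continuous_on)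
    show "1-lipschitz_on {s..T} (\<lambda>a. occupation \<theta> a \<omega>)"
      by (rule lipschitz_onI)
         (use occupation_lipschitz[of s \<theta> \<omega>, OF \<theta>_ge[OF elim(2)]] in \<open>auto simp: dist_real_def\<close>)
  qed
  moreover have "continuous_on {s..T} (\<lambda>a. W a \<omega>)"
    using elim(1) by (rule continuous_on_subset) auto
  ultimately show ?case unfolding price_factor_def by (intro continuous_intros) auto
qed

end

text \<open>Discounting runs from the starting time, so the payoff at elapsed time b is the same
  function \<open>c b\<close> of the canonical path on both spaces. The events of a grid rule are
  replaced by canonical ones, which are pulled back to the second space; equal laws give equal
  expected payoffs. The difference of the horizons enters only through the set of admissible
  rules.\<close>

lemma stopping_value_transport:
  assumes "noise M lam s p W \<theta>" and "noise M' lam s' p W' \<theta>'"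
    and sT: "s \<le> T" and TT: "T - s \<le> T' - s'"
  shows "stopping_value r K T s M W \<theta> (\<lambda>a \<omega>. x * price_factor \<mu>0 \<mu>1 \<sigma> s W \<theta> a \<omega>) \<le>
    stopping_value r K T' s' M' W' \<theta>' (\<lambda>a \<omega>. x * price_factor \<mu>0 \<mu>1 \<sigma> s' W' \<theta>' a \<omega>)"
proof -
  interpret N: noise M lam s p W \<theta> by fact
  interpret N': noise M' lam s' p W' \<theta>' by fact
  let ?X = "\<lambda>a \<omega>. x * price_factor \<mu>0 \<mu>1 \<sigma> s W \<theta> a \<omega>"
  let ?X' = "\<lambda>a \<omega>. x * price_factor \<mu>0 \<mu>1 \<sigma> s' W' \<theta>' a \<omega>"
  let ?\<Phi> = "noise_path s W \<theta>" and ?\<Phi>' = "noise_path s' W' \<theta>'"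
  define c where "c = discounted_payoff r K 0 (\<lambda>a q. x * price_factor \<mu>0 \<mu>1 \<sigma> 0 (\<lambda>b q. fst q b) snd a q)"
  have cM: "c b \<in> borel_measurable canonical_space" if "0 \<le> b" for b
  proof -
    have [measurable]: "price_factor \<mu>0 \<mu>1 \<sigma> 0 (\<lambda>b q. fst q b) snd b \<in> borel_measurable canonical_space"
      using that by (intro price_factor_measurable canonical_coordinate_measurable snd_canonical_measurable)
    show ?thesis unfolding c_def discounted_payoff_def[abs_def] by measurable
  qed
  show ?thesis
  proof (rule N.stopping_value_leI[OF sT])
    show "?X a \<in> borel_measurable M" if "a \<in> {s..T}" for a
      using that N.price_factor_measurable_noise[of a] by auto
    show "AE \<omega> in M. continuous_on {s..T} (\<lambda>a. ?X a \<omega>)"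
      using N.price_factor_continuous[of T \<mu>0 \<mu>1 \<sigma>]
      by eventually_elim (intro continuous_intros)
    fix n and A :: "nat \<Rightarrow> 'a set"
    assume A: "\<And>k. A k \<in> sets (augmented_filtration s M W \<theta> (grid_time s T n k))"
    define b where "b k = real k * ((T - s) / real (Suc n))" for k
    \<comment> \<open>The second grid spans the same elapsed time T - s, so its rule stops by
      \<open>T''\<close> and is admissible for the horizon \<open>T'\<close>.\<close>
    define T'' where "T'' = s' + (T - s)"
    have b0: "0 \<le> b k" for k using sT by (simp add: b_def)
    have g: "grid_time s T n k = s + b k" for k by (simp add: grid_time_def b_def)
    have g': "grid_time s' T'' n k = s' + b k" for k by (simp add: grid_time_def b_def T''_def)
    have "\<exists>B. B \<in> sets (canonical_filtration (b k)) \<and> (AE \<omega> in M. \<omega> \<in> A k \<longleftrightarrow> ?\<Phi> \<omega> \<in> B)" for k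
      using N.augmented_set_canonical[of "A k" "b k"] A[of k] unfolding g by blast
    then obtain B where B: "\<And>k. B k \<in> sets (canonical_filtration (b k))"
      and AB: "\<And>k. AE \<omega> in M. \<omega> \<in> A k \<longleftrightarrow> ?\<Phi> \<omega> \<in> B k" by metis
    have BM: "B k \<in> sets canonical_space" for k using B canonical_filtration_subset by blast
    define A' where "A' k = ?\<Phi>' -` B k \<inter> space M'" for k
    have A': "A' k \<in> sets (augmented_filtration s' M' W' \<theta>' (grid_time s' T'' n k))" for k
      using measurable_sets[OF N'.noise_path_adapted B, of k] unfolding g' A'_def by simp
    \<comment> \<open>The rule and its payoff together, as a single function on path space that is
      integrated against the common law.\<close>
    define f where "f q = c (b (first_entry (Suc n) B q)) q" for q
    have fM: "f \<in> borel_measurable canonical_space"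
      unfolding f_def by (rule measurable_compose_countable[OF cM[OF b0] first_entry_measurable[OF BM]])
    have c\<Phi>: "discounted_payoff r K s ?X (s + b k) \<omega> = c (b k) (?\<Phi> \<omega>)" if "\<omega> \<in> space M" for k \<omega>
      using price_factor_noise_path[of s \<theta> \<omega> "b k" \<mu>0 \<mu>1 \<sigma> W, OF N.\<theta>_ge[OF that] b0]
      unfolding c_def discounted_payoff_def by simp
    have c\<Phi>': "discounted_payoff r K s' ?X' (s' + b k) \<omega> = c (b k) (?\<Phi>' \<omega>)" if "\<omega> \<in> space M'" for k \<omega>
      using price_factor_noise_path[of s' \<theta>' \<omega> "b k" \<mu>0 \<mu>1 \<sigma> W', OF N'.\<theta>_ge[OF that] b0]
      unfolding c_def discounted_payoff_def by simp
    have "(\<integral>\<^sup>+\<omega>. discounted_payoff r K s ?X (grid_rule s T n A \<omega>) \<omega> \<partial>M) = (\<integral>\<^sup>+\<omega>. f (?\<Phi> \<omega>) \<partial>M)"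
    proof (rule nn_integral_cong_AE)
      have "AE \<omega> in M. \<forall>k. \<omega> \<in> A k \<longleftrightarrow> ?\<Phi> \<omega> \<in> B k" using AB by (simp add: AE_all_countable)
      then show "AE \<omega> in M. discounted_payoff r K s ?X (grid_rule s T n A \<omega>) \<omega> = f (?\<Phi> \<omega>)"
        using AE_space
      proof eventually_elim
        case (elim \<omega>)
        have "first_entry (Suc n) A \<omega> = first_entry (Suc n) B (?\<Phi> \<omega>)"
          by (rule first_entry_cong) (use elim in blast)
        then show ?case using c\<Phi>[OF elim(2)] by (simp add: grid_rule_def g f_def)
      qed
    qed
    also have "\<dots> = (\<integral>\<^sup>+q. f q \<partial>distr M canonical_space ?\<Phi>)"
      by (subst nn_integral_distr) (simp_all add: fM N.noise_path_measurable)
    also have "\<dots> = (\<integral>\<^sup>+q. f q \<partial>distr M' canonical_space ?\<Phi>')"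
      by (simp only: noise_path_law_eq[OF assms(1,2)])
    also have "\<dots> = (\<integral>\<^sup>+\<omega>. f (?\<Phi>' \<omega>) \<partial>M')"
      by (subst nn_integral_distr) (simp_all add: fM N'.noise_path_measurable)
    also have "\<dots> = (\<integral>\<^sup>+\<omega>. discounted_payoff r K s' ?X' (grid_rule s' T'' n A' \<omega>) \<omega> \<partial>M')"
    proof (rule nn_integral_cong)
      fix \<omega> assume \<omega>: "\<omega> \<in> space M'"
      have "first_entry (Suc n) A' \<omega> = first_entry (Suc n) B (?\<Phi>' \<omega>)"
        by (rule first_entry_cong) (use \<omega> in \<open>simp add: A'_def\<close>)
      then show "f (?\<Phi>' \<omega>) = discounted_payoff r K s' ?X' (grid_rule s' T'' n A' \<omega>) \<omega>"
        using c\<Phi>'[OF \<omega>] by (simp add: grid_rule_def g' f_def)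
    qed
    also have "\<dots> \<le> stopping_value r K T' s' M' W' \<theta>' ?X'"
    proof -
      have "grid_rule s' T'' n A' \<in> stopping_times s' T'' M' W' \<theta>'"
        using sT by (intro grid_rule_stopping_time A') (simp add: T''_def)
      moreover have "T'' \<le> T'" using TT by (simp add: T''_def)
      ultimately have "grid_rule s' T'' n A' \<in> stopping_times s' T' M' W' \<theta>'"
        using stopping_times_mono by blast
      then show ?thesis unfolding stopping_value_eq by (intro SUP_upper)
    qed
    finally show "(\<integral>\<^sup>+\<omega>. discounted_payoff r K s ?X (grid_rule s T n A \<omega>) \<omega> \<partial>M)
      \<le> stopping_value r K T' s' M' W' \<theta>' ?X'" .
  qed
qed

section \<open>Properties of the value function\<close>

lemma (in prob_space) indep_nn_integral_mult:
  fixes U V :: "'a \<Rightarrow> ennreal"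
  assumes AB: "indep_set (sets A) (sets B)" and sp: "space A = space M" "space B = space M"
    and U: "U \<in> borel_measurable A" and V: "V \<in> borel_measurable B"
  shows "(\<integral>\<^sup>+\<omega>. U \<omega> * V \<omega> \<partial>M) = (\<integral>\<^sup>+\<omega>. U \<omega> \<partial>M) * (\<integral>\<^sup>+\<omega>. V \<omega> \<partial>M)"
proof -
  have sub: "sets A \<subseteq> events" "sets B \<subseteq> events"
    using AB by (auto dest: indep_setD_ev1 indep_setD_ev2)
  have [measurable]: "U \<in> borel_measurable M" "V \<in> borel_measurable M"
    using U V sub sp by (auto intro: measurable_mono_sets)
  interpret V: prob_space "distr M borel V" by (rule prob_space_distr) measurable
  have "(\<integral>\<^sup>+\<omega>. U \<omega> * V \<omega> \<partial>M) = (\<integral>\<^sup>+q. fst q * snd q \<partial>distr M (borel \<Otimes>\<^sub>M borel) (\<lambda>\<omega>. (U \<omega>, V \<omega>)))"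
    by (subst nn_integral_distr) simp_all
  also have "\<dots> = (\<integral>\<^sup>+q. fst q * snd q \<partial>(distr M borel U \<Otimes>\<^sub>M distr M borel V))"
    by (simp only: indep_set_joint_law[OF AB sp U V])
  also have "\<dots> = (\<integral>\<^sup>+u. \<integral>\<^sup>+v. u * v \<partial>distr M borel V \<partial>distr M borel U)"
    by (subst V.nn_integral_fst[symmetric]) simp_all
  also have "\<dots> = (\<integral>\<^sup>+u. u * (\<integral>\<^sup>+\<omega>. V \<omega> \<partial>M) \<partial>distr M borel U)"
    by (simp add: nn_integral_cmult nn_integral_distr)
  also have "\<dots> = (\<integral>\<^sup>+\<omega>. U \<omega> \<partial>M) * (\<integral>\<^sup>+\<omega>. V \<omega> \<partial>M)"
    by (simp add: nn_integral_multc nn_integral_distr)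
  finally show ?thesis .
qed

text \<open>Completing the square: the exponential weight turns the centred normal density into the
  one with mean \<sigma> d and the same variance.\<close>

lemma gaussian_exponential_integral:
  assumes d: "0 < d"
  shows "(\<integral>\<^sup>+z. ennreal (normal_density 0 (sqrt d) z) * ennreal (exp (\<sigma> * z - \<sigma>^2 * d / 2)) \<partial>lborel) = 1"
proof -
  have "normal_density 0 (sqrt d) z * exp (\<sigma> * z - \<sigma>^2 * d / 2) = normal_density (\<sigma> * d) (sqrt d) z" for z
  proof -
    have "- (z^2) / (2 * d) + (\<sigma> * z - \<sigma>^2 * d / 2) = - ((z - \<sigma> * d)^2) / (2 * d)"
      using d by (simp add: power2_eq_square field_simps)
    then have "exp (- (z^2) / (2 * d)) * exp (\<sigma> * z - \<sigma>^2 * d / 2) = exp (- ((z - \<sigma> * d)^2) / (2 * d))"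
      by (simp only: exp_add[symmetric])
    then show ?thesis using d by (simp add: normal_density_def)
  qed
  then have "(\<integral>\<^sup>+z. ennreal (normal_density 0 (sqrt d) z) * ennreal (exp (\<sigma> * z - \<sigma>^2 * d / 2)) \<partial>lborel) =
      (\<integral>\<^sup>+z. ennreal (normal_density (\<sigma> * d) (sqrt d) z) \<partial>lborel)"
    by (simp add: ennreal_mult[symmetric])
  also have "\<dots> = emeasure (density lborel (normal_density (\<sigma> * d) (sqrt d))) UNIV"
    by (simp add: emeasure_density)
  also have "\<dots> = 1"
    using prob_space.emeasure_space_1[OF prob_space_normal_density[of "sqrt d" "\<sigma> * d"]] d by simp
  finally show ?thesis .
qed

context noise begin

text \<open>Taken in \<open>ennreal\<close>, so that expectations on events and under stopping rules
  make sense before any integrability is known.\<close>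

definition exponential_martingale :: "real \<Rightarrow> real \<Rightarrow> 'w \<Rightarrow> ennreal" where
  "exponential_martingale \<sigma> a \<omega> = ennreal (exp (\<sigma> * W a \<omega> - \<sigma>^2 * (a - s) / 2))"

lemma exponential_martingale_measurable:
  "s \<le> a \<Longrightarrow> exponential_martingale \<sigma> a \<in> borel_measurable M"
  using W_measurable[of a] unfolding exponential_martingale_def[abs_def] by measurable

text \<open>The quotient of the two values is a function of the increment alone, has mean 1 and is
  independent of the enlarged past, to which \<open>E\<close> belongs.\<close>

lemma exponential_martingale_step:
  assumes a: "s \<le> a" "a \<le> b" and E: "E \<in> sets (full_filtration a)"
  shows "(\<integral>\<^sup>+\<omega>. exponential_martingale \<sigma> b \<omega> * indicator E \<omega> \<partial>M) =
    (\<integral>\<^sup>+\<omega>. exponential_martingale \<sigma> a \<omega> * indicator E \<omega> \<partial>M)"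
proof (cases "a = b")
  case False
  then have ab: "a < b" using a by simp
  define V where "V \<omega> = ennreal (exp (\<sigma> * (W b \<omega> - W a \<omega>) - \<sigma>^2 * (b - a) / 2))" for \<omega>
  define U where "U \<omega> = exponential_martingale \<sigma> a \<omega> * indicator E \<omega>" for \<omega>
  let ?B = "vimage_algebra (space M) (\<lambda>\<omega>. W b \<omega> - W a \<omega>) borel"
  have U: "U \<in> borel_measurable (full_filtration a)"
  proof -
    have [measurable]: "W a \<in> borel_measurable (full_filtration a)" using a by (intro W_measurable_full) auto
    note [measurable] = E
    show ?thesis unfolding U_def[abs_def] exponential_martingale_def by measurable
  qed
  have V: "V \<in> borel_measurable ?B"
    unfolding V_def by (rule measurable_compose[OF measurable_vimage_algebra1]) auto
  have "(\<integral>\<^sup>+\<omega>. V \<omega> \<partial>M) = (\<integral>\<^sup>+z. ennreal (normal_density 0 (sqrt (b - a)) z) *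
      ennreal (exp (\<sigma> * z - \<sigma>^2 * (b - a) / 2)) \<partial>lborel)"
    unfolding V_def
    by (rule distributed_nn_integral[OF W_increment[OF a(1) ab], symmetric]) auto
  also have "\<dots> = 1" by (rule gaussian_exponential_integral) (use ab in simp)
  finally have V1: "(\<integral>\<^sup>+\<omega>. V \<omega> \<partial>M) = 1" .
  have "exponential_martingale \<sigma> b \<omega> * indicator E \<omega> = U \<omega> * V \<omega>" for \<omega>
  proof -
    have "exp (\<sigma> * W b \<omega> - \<sigma>^2 * (b - s) / 2) = exp (\<sigma> * W a \<omega> - \<sigma>^2 * (a - s) / 2) *
        exp (\<sigma> * (W b \<omega> - W a \<omega>) - \<sigma>^2 * (b - a) / 2)"
      unfolding exp_add[symmetric] by (simp add: field_simps)
    then show ?thesis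
      unfolding U_def V_def exponential_martingale_def by (simp add: ennreal_mult mult_ac)
  qed
  then show ?thesis
    using indep_nn_integral_mult[OF indep_full_increment[OF a(1) ab] _ _ U V] V1
    by (simp add: U_def)
qed simp

text \<open>Optional sampling with finitely many times: on the event of stopping at index k the
  value there is exchanged for the value at T, and these events partition the space. The expectation
  at T equals that at s, where the value is almost surely 1.\<close>

lemma exponential_martingale_grid_rule:
  assumes sT: "s \<le> T" and A: "\<And>k. A k \<in> sets (augmented_filtration s M W \<theta> (grid_time s T n k))"
  shows "(\<integral>\<^sup>+\<omega>. exponential_martingale \<sigma> (grid_rule s T n A \<omega>) \<omega> \<partial>M) = 1"
proof -
  define E where "E k = {\<omega> \<in> space M. first_entry (Suc n) A \<omega> = k}" for k
  have split: "f \<omega> = (\<Sum>k\<le>Suc n. f \<omega> * indicator (E k) \<omega>)" if "\<omega> \<in> space M" for \<omega> and f :: "'w \<Rightarrow> ennreal"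
  proof -
    have "(\<Sum>k\<le>Suc n. f \<omega> * indicator (E k) \<omega>) = (\<Sum>k\<le>Suc n. if first_entry (Suc n) A \<omega> = k then f \<omega> else 0)"
      using that by (intro sum.cong) (auto simp: E_def)
    also have "\<dots> = f \<omega>" using first_entry_le[of "Suc n" A \<omega>] by (simp del: sum.atMost_Suc)
    finally show ?thesis by simp
  qed
  have Ef: "E k \<in> sets (full_filtration (grid_time s T n k))" if "k \<le> Suc n" for k
  proof -
    let ?F = "full_filtration (grid_time s T n k)"
    have Aj: "A j \<in> sets ?F" if "j \<le> k" for j
      using A[of j] augmented_subset_full full_filtration_mono[OF grid_time_mono[OF sT that]] by blast
    \<comment> \<open>Stopping at k means that \<open>A k\<close> occurs and no earlier event does;
      the last index is reached by default.\<close>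
    have "E k = (if k = Suc n then space M else A k) - (\<Union>j<k. A j)"
    proof (intro set_eqI iffI)
      fix \<omega> assume \<omega>: "\<omega> \<in> E k"
      have "\<omega> \<notin> A j" if "j < k" for j using first_entry_le_if[of \<omega> A j "Suc n"] \<omega> that by (auto simp: E_def)
      then show "\<omega> \<in> (if k = Suc n then space M else A k) - (\<Union>j<k. A j)"
        using \<omega> first_entry_mem[of "Suc n" A \<omega>] by (auto simp: E_def)
    next
      fix \<omega> assume \<omega>: "\<omega> \<in> (if k = Suc n then space M else A k) - (\<Union>j<k. A j)"
      have "first_entry (Suc n) A \<omega> \<le> k"
        using \<omega> first_entry_le[of "Suc n" A \<omega>] first_entry_le_if[of \<omega> A k] by (auto split: if_splits)
      moreover have "\<not> first_entry (Suc n) A \<omega> < k"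
        using \<omega> first_entry_mem[of "Suc n" A \<omega>] \<open>k \<le> Suc n\<close> by auto
      moreover have "\<omega> \<in> space M" using \<omega> sets.sets_into_space[OF A[of k]] by (auto split: if_splits)
      ultimately show "\<omega> \<in> E k" by (simp add: E_def)
    qed
    also have "\<dots> \<in> sets ?F"
      using Aj sets.top[of ?F] by (intro sets.Diff sets.finite_UN) auto
    finally show ?thesis .
  qed
  have EM [measurable]: "E k \<in> events" if "k \<le> Suc n" for k
    using Ef[OF that] full_filtration_subset_events by blast
  have mm: "(\<lambda>\<omega>. exponential_martingale \<sigma> (grid_time s T n k) \<omega> * indicator (E k) \<omega>) \<in> borel_measurable M"
    "(\<lambda>\<omega>. exponential_martingale \<sigma> T \<omega> * indicator (E k) \<omega>) \<in> borel_measurable M" if "k \<le> Suc n" for k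
    using grid_time_mem[OF sT that] EM[OF that] sT
    by (auto intro!: borel_measurable_times_ennreal exponential_martingale_measurable borel_measurable_indicator)
  have "(\<integral>\<^sup>+\<omega>. exponential_martingale \<sigma> (grid_rule s T n A \<omega>) \<omega> \<partial>M) =
    (\<integral>\<^sup>+\<omega>. (\<Sum>k\<le>Suc n. exponential_martingale \<sigma> (grid_time s T n k) \<omega> * indicator (E k) \<omega>) \<partial>M)"
  proof (rule nn_integral_cong)
    fix \<omega> assume \<omega>: "\<omega> \<in> space M"
    show "exponential_martingale \<sigma> (grid_rule s T n A \<omega>) \<omega> =
      (\<Sum>k\<le>Suc n. exponential_martingale \<sigma> (grid_time s T n k) \<omega> * indicator (E k) \<omega>)"
      by (subst split[OF \<omega>, of "\<lambda>\<omega>. exponential_martingale \<sigma> (grid_rule s T n A \<omega>) \<omega>"],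
          intro sum.cong) (auto simp: E_def grid_rule_def indicator_def)
  qed
  also have "\<dots> = (\<Sum>k\<le>Suc n. \<integral>\<^sup>+\<omega>. exponential_martingale \<sigma> (grid_time s T n k) \<omega> * indicator (E k) \<omega> \<partial>M)"
    using mm by (intro nn_integral_sum) auto
  also have "\<dots> = (\<Sum>k\<le>Suc n. \<integral>\<^sup>+\<omega>. exponential_martingale \<sigma> T \<omega> * indicator (E k) \<omega> \<partial>M)"
    using grid_time_mem[OF sT] by (intro sum.cong refl exponential_martingale_step[symmetric] Ef) auto
  also have "\<dots> = (\<integral>\<^sup>+\<omega>. (\<Sum>k\<le>Suc n. exponential_martingale \<sigma> T \<omega> * indicator (E k) \<omega>) \<partial>M)"
    using mm by (intro nn_integral_sum[symmetric]) auto
  also have "\<dots> = (\<integral>\<^sup>+\<omega>. exponential_martingale \<sigma> T \<omega> \<partial>M)"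
    by (intro nn_integral_cong split[symmetric])
  also have "\<dots> = (\<integral>\<^sup>+\<omega>. exponential_martingale \<sigma> T \<omega> * indicator (space M) \<omega> \<partial>M)"
    by (intro nn_integral_cong) simp
  also have "\<dots> = (\<integral>\<^sup>+\<omega>. exponential_martingale \<sigma> s \<omega> * indicator (space M) \<omega> \<partial>M)"
    using sT sets.top[of "full_filtration s"] by (intro exponential_martingale_step) auto
  also have "\<dots> = (\<integral>\<^sup>+\<omega>. 1 \<partial>M)"
    by (rule nn_integral_cong_AE)
       (use W_start AE_space in \<open>eventually_elim, simp add: exponential_martingale_def\<close>)
  also have "\<dots> = 1" by (simp add: emeasure_space_1)
  finally show ?thesis .
qed

text \<open>Omitting the occupation term, the discount and the strike can only increase the payoff.
  What remains is at most a constant times the exponential martingale, which has expectation 1 under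
  every grid rule; the modulus of \<mu>0 in the constant allows for either sign.\<close>

lemma price_stopping_value_finite:
  assumes sT: "s \<le> T" and \<mu>: "\<mu>1 \<le> \<mu>0" and r: "0 \<le> r" and K: "0 \<le> K" and x: "0 \<le> x"
  shows "stopping_value r K T s M W \<theta> (\<lambda>a \<omega>. x * price_factor \<mu>0 \<mu>1 \<sigma> s W \<theta> a \<omega>) < \<infinity>"
proof -
  let ?X = "\<lambda>a \<omega>. x * price_factor \<mu>0 \<mu>1 \<sigma> s W \<theta> a \<omega>"
  let ?C = "ennreal (x * exp (\<bar>\<mu>0\<bar> * (T - s)))"
  have "stopping_value r K T s M W \<theta> ?X \<le> ?C"
  proof (rule stopping_value_leI[OF sT])
    show "?X a \<in> borel_measurable M" if "a \<in> {s..T}" for a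
      using that price_factor_measurable_noise[of a] by auto
    show "AE \<omega> in M. continuous_on {s..T} (\<lambda>a. ?X a \<omega>)"
      using price_factor_continuous[of T \<mu>0 \<mu>1 \<sigma>] by eventually_elim (intro continuous_intros)
    fix n and A :: "nat \<Rightarrow> 'w set"
    assume A: "\<And>k. A k \<in> sets (augmented_filtration s M W \<theta> (grid_time s T n k))"
    have Ae: "\<And>k. A k \<in> events" using A augmented_filtration_subset_events by blast
    have bound: "discounted_payoff r K s ?X a \<omega> \<le> ?C * exponential_martingale \<sigma> a \<omega>"
      if \<omega>: "\<omega> \<in> space M" and a: "a \<in> {s..T}" for a \<omega>
    proof -
      have occ: "0 \<le> occupation \<theta> a \<omega>"
        using \<theta>_ge[OF \<omega>] by (cases rule: occupation_cases) (auto simp: occupation_real occupation_inf)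
      have "\<mu>0 * (a - s) \<le> \<bar>\<mu>0\<bar> * (a - s)" using a by (intro mult_right_mono) auto
      also have "\<dots> \<le> \<bar>\<mu>0\<bar> * (T - s)" using a by (intro mult_left_mono) auto
      finally have m: "\<mu>0 * (a - s) \<le> \<bar>\<mu>0\<bar> * (T - s)" .
      have "0 \<le> (\<mu>0 - \<mu>1) * occupation \<theta> a \<omega>" using occ \<mu> by simp
      then have "price_factor \<mu>0 \<mu>1 \<sigma> s W \<theta> a \<omega> \<le>
          exp (\<bar>\<mu>0\<bar> * (T - s)) * exp (\<sigma> * W a \<omega> - \<sigma>^2 * (a - s) / 2)"
        unfolding price_factor_def exp_add[symmetric] using m by simp
      then have "x * price_factor \<mu>0 \<mu>1 \<sigma> s W \<theta> a \<omega> \<le>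
          x * (exp (\<bar>\<mu>0\<bar> * (T - s)) * exp (\<sigma> * W a \<omega> - \<sigma>^2 * (a - s) / 2))"
        using x by (rule mult_left_mono)
      moreover have "0 \<le> x * price_factor \<mu>0 \<mu>1 \<sigma> s W \<theta> a \<omega>" using x by (simp add: price_factor_def)
      ultimately have "max 0 (x * price_factor \<mu>0 \<mu>1 \<sigma> s W \<theta> a \<omega> - K) \<le>
          x * exp (\<bar>\<mu>0\<bar> * (T - s)) * exp (\<sigma> * W a \<omega> - \<sigma>^2 * (a - s) / 2)"
        using K x by simp
      moreover have "exp (- r * (a - s)) \<le> 1" using r a by simp
      ultimately have "exp (- r * (a - s)) * max 0 (x * price_factor \<mu>0 \<mu>1 \<sigma> s W \<theta> a \<omega> - K) \<le>
          1 * (x * exp (\<bar>\<mu>0\<bar> * (T - s)) * exp (\<sigma> * W a \<omega> - \<sigma>^2 * (a - s) / 2))"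
        by (intro mult_mono) auto
      then show ?thesis
        unfolding discounted_payoff_def exponential_martingale_def using x
        by (subst ennreal_mult[symmetric]) (auto intro!: ennreal_leI)
    qed
    have mem: "grid_rule s T n A \<omega> \<in> {s..T}" for \<omega>
      unfolding grid_rule_def by (rule grid_time_mem[OF sT first_entry_le])
    have "(\<integral>\<^sup>+\<omega>. discounted_payoff r K s ?X (grid_rule s T n A \<omega>) \<omega> \<partial>M)
      \<le> (\<integral>\<^sup>+\<omega>. ?C * exponential_martingale \<sigma> (grid_rule s T n A \<omega>) \<omega> \<partial>M)"
      by (intro nn_integral_mono bound mem)
    also have "\<dots> = ?C * (\<integral>\<^sup>+\<omega>. exponential_martingale \<sigma> (grid_rule s T n A \<omega>) \<omega> \<partial>M)"
    proof (rule nn_integral_cmult)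
      have "(\<lambda>\<omega>. exponential_martingale \<sigma> (grid_time s T n (min (Suc n) (first_entry (Suc n) A \<omega>))) \<omega>)
          \<in> borel_measurable M"
      proof (rule measurable_compose_countable[OF _ first_entry_measurable[OF Ae]])
        show "exponential_martingale \<sigma> (grid_time s T n (min (Suc n) k)) \<in> borel_measurable M" for k
          using grid_time_mem[OF sT, of "min (Suc n) k" n] by (intro exponential_martingale_measurable) auto
      qed
      then show "(\<lambda>\<omega>. exponential_martingale \<sigma> (grid_rule s T n A \<omega>) \<omega>) \<in> borel_measurable M"
        by (simp add: grid_rule_def min.absorb2[OF first_entry_le])
    qed
    also have "\<dots> = ?C" by (simp add: exponential_martingale_grid_rule[OF sT A])
    finally show "(\<integral>\<^sup>+\<omega>. discounted_payoff r K s ?X (grid_rule s T n A \<omega>) \<omega> \<partial>M) \<le> ?C" .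
  qed
  also have "\<dots> < \<infinity>" by simp
  finally show ?thesis .
qed

section \<open>Dependence of the value on the initial price and on the state\<close>

lemma price_stopping_value_mono:
  assumes "x \<le> y"
  shows "stopping_value r K T s M W \<theta> (\<lambda>a \<omega>. x * price_factor \<mu>0 \<mu>1 \<sigma> s W \<theta> a \<omega>) \<le>
    stopping_value r K T s M W \<theta> (\<lambda>a \<omega>. y * price_factor \<mu>0 \<mu>1 \<sigma> s W \<theta> a \<omega>)"
proof -
  have "x * price_factor \<mu>0 \<mu>1 \<sigma> s W \<theta> a \<omega> \<le> y * price_factor \<mu>0 \<mu>1 \<sigma> s W \<theta> a \<omega>" for a \<omega>
    using assms by (intro mult_right_mono) (auto simp: price_factor_def)
  then show ?thesis
    unfolding stopping_value_eq discounted_payoff_def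
    by (intro SUP_mono' nn_integral_mono ennreal_leI mult_left_mono max.mono) auto
qed

text \<open>For a fixed rule the price is linear and the payoff convex in the initial price, and a
  supremum of convex functions is convex. Working with grid rules supplies the measurability that
  additivity of the integral uses.\<close>

lemma price_stopping_value_convex:
  assumes sT: "s \<le> T" and u: "0 \<le> u" "0 \<le> v" "u + v = 1"
  shows "stopping_value r K T s M W \<theta> (\<lambda>a \<omega>. (u * x + v * y) * price_factor \<mu>0 \<mu>1 \<sigma> s W \<theta> a \<omega>) \<le>
    ennreal u * stopping_value r K T s M W \<theta> (\<lambda>a \<omega>. x * price_factor \<mu>0 \<mu>1 \<sigma> s W \<theta> a \<omega>) +
    ennreal v * stopping_value r K T s M W \<theta> (\<lambda>a \<omega>. y * price_factor \<mu>0 \<mu>1 \<sigma> s W \<theta> a \<omega>)"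
    (is "stopping_value r K T s M W \<theta> ?Z \<le> ennreal u * ?Vx + ennreal v * ?Vy")
proof (rule stopping_value_leI[OF sT])
  let ?X = "\<lambda>x a \<omega>. x * price_factor \<mu>0 \<mu>1 \<sigma> s W \<theta> a \<omega>"
  show "?Z a \<in> borel_measurable M" if "a \<in> {s..T}" for a
    using that price_factor_measurable_noise[of a] by auto
  show "AE \<omega> in M. continuous_on {s..T} (\<lambda>a. ?Z a \<omega>)"
    using price_factor_continuous[of T \<mu>0 \<mu>1 \<sigma>] by eventually_elim (intro continuous_intros)
  fix n and A :: "nat \<Rightarrow> 'w set"
  assume A: "\<And>k. A k \<in> sets (augmented_filtration s M W \<theta> (grid_time s T n k))"
  have Ae: "\<And>k. A k \<in> events" using A augmented_filtration_subset_events by blast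
  have le: "discounted_payoff r K s ?Z a \<omega> \<le>
    ennreal u * discounted_payoff r K s (?X x) a \<omega> + ennreal v * discounted_payoff r K s (?X y) a \<omega>" for a \<omega>
  proof -
    let ?p = "price_factor \<mu>0 \<mu>1 \<sigma> s W \<theta> a \<omega>" and ?e = "exp (- r * (a - s))"
    have "u * (x * ?p - K) + v * (y * ?p - K) = (u * x + v * y) * ?p - (u + v) * K"
      by (simp add: algebra_simps)
    then have "(u * x + v * y) * ?p - K = u * (x * ?p - K) + v * (y * ?p - K)"
      using u(3) by simp
    also have "\<dots> \<le> u * max 0 (x * ?p - K) + v * max 0 (y * ?p - K)"
      using u by (intro add_mono mult_left_mono) auto
    finally have "max 0 ((u * x + v * y) * ?p - K) \<le> u * max 0 (x * ?p - K) + v * max 0 (y * ?p - K)"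
      using u by simp
    then have "?e * max 0 ((u * x + v * y) * ?p - K) \<le> ?e * (u * max 0 (x * ?p - K) + v * max 0 (y * ?p - K))"
      by (rule mult_left_mono) simp
    also have "\<dots> = u * (?e * max 0 (x * ?p - K)) + v * (?e * max 0 (y * ?p - K))"
      by (simp add: algebra_simps)
    finally show ?thesis
      unfolding discounted_payoff_def using u
      by (simp add: ennreal_mult[symmetric] ennreal_plus[symmetric] ennreal_leI del: ennreal_plus)
  qed
  have pm: "(\<lambda>\<omega>. discounted_payoff r K s (?X z) (grid_rule s T n A \<omega>) \<omega>) \<in> borel_measurable M" for z
    using price_factor_measurable_noise by (intro grid_payoff_measurable[OF sT Ae]) auto
  have V: "(\<integral>\<^sup>+\<omega>. discounted_payoff r K s (?X z) (grid_rule s T n A \<omega>) \<omega> \<partial>M)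
    \<le> stopping_value r K T s M W \<theta> (?X z)" for z
    unfolding stopping_value_eq by (intro SUP_upper grid_rule_stopping_time sT A)
  have "(\<integral>\<^sup>+\<omega>. discounted_payoff r K s ?Z (grid_rule s T n A \<omega>) \<omega> \<partial>M) \<le>
    (\<integral>\<^sup>+\<omega>. ennreal u * discounted_payoff r K s (?X x) (grid_rule s T n A \<omega>) \<omega> +
      ennreal v * discounted_payoff r K s (?X y) (grid_rule s T n A \<omega>) \<omega> \<partial>M)"
    by (intro nn_integral_mono le)
  also have "\<dots> = ennreal u * (\<integral>\<^sup>+\<omega>. discounted_payoff r K s (?X x) (grid_rule s T n A \<omega>) \<omega> \<partial>M) +
      ennreal v * (\<integral>\<^sup>+\<omega>. discounted_payoff r K s (?X y) (grid_rule s T n A \<omega>) \<omega> \<partial>M)"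
    using pm[of x] pm[of y] by (simp add: nn_integral_add nn_integral_cmult)
  also have "\<dots> \<le> ennreal u * ?Vx + ennreal v * ?Vy"
    by (intro add_mono mult_left_mono V) auto
  finally show "(\<integral>\<^sup>+\<omega>. discounted_payoff r K s ?Z (grid_rule s T n A \<omega>) \<omega> \<partial>M) \<le>
    ennreal u * ?Vx + ennreal v * ?Vy" .
qed

text \<open>A stopping time reads the price at a random time, so almost sure equality at each fixed
  time does not suffice. Equality holds simultaneously on a countable dense set of times and extends
  to all of them by continuity of both paths.\<close>

lemma stopping_value_stock_price:
  assumes \<sigma>: "0 < \<sigma>" and sT: "s \<le> T" and sp: "stock_price T \<mu>0 \<mu>1 \<sigma> s x M W \<theta> X"
  shows "stopping_value r K T s M W \<theta> X =
    stopping_value r K T s M W \<theta> (\<lambda>a \<omega>. x * price_factor \<mu>0 \<mu>1 \<sigma> s W \<theta> a \<omega>)"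
proof -
  have Xc: "AE \<omega> in M. continuous_on {s..T} (\<lambda>a. X a \<omega>)"
    using sp unfolding stock_price_def Let_def by auto
  \<comment> \<open>The endpoints settle the case s = T, in which the interval may contain no
    rational number.\<close>
  define D where "D = insert s (insert T (\<rat> \<inter> {s..T}))"
  have "countable D" unfolding D_def using countable_rat by (auto intro: countable_Int1)
  then have eqD: "AE \<omega> in M. \<forall>a\<in>D. X a \<omega> = x * price_factor \<mu>0 \<mu>1 \<sigma> s W \<theta> a \<omega>"
    using stock_price_explicit[OF \<sigma> sp] sT by (subst AE_ball_countable) (auto simp: D_def)
  have clD: "{s..T} \<subseteq> closure D"
  proof (cases "s = T")
    case True
    then show ?thesis using closure_subset[of D] by (auto simp: D_def)
  next
    case False
    then have "closure {s<..<T} = {s..T}" using sT by simp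
    moreover have "closure ({s<..<T} \<inter> \<rat>) = closure {s<..<T}"
      by (rule closure_open_Int_superset) (auto simp: Rats_closure_real)
    moreover have "closure ({s<..<T} \<inter> \<rat>) \<subseteq> closure D" by (rule closure_mono) (auto simp: D_def)
    ultimately show ?thesis by simp
  qed
  have Dsub: "D \<subseteq> {s..T}" using sT by (auto simp: D_def)
  then have clD': "closure D = {s..T}"
    using clD closure_minimal[OF Dsub] by auto
  have "AE \<omega> in M. \<forall>a\<in>{s..T}. X a \<omega> = x * price_factor \<mu>0 \<mu>1 \<sigma> s W \<theta> a \<omega>"
    using Xc price_factor_continuous[of T \<mu>0 \<mu>1 \<sigma>] eqD
  proof eventually_elim
    case (elim \<omega>)
    have "continuous_on (closure D) (\<lambda>a. X a \<omega> - x * price_factor \<mu>0 \<mu>1 \<sigma> s W \<theta> a \<omega>)"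
      unfolding clD' by (intro continuous_intros elim)
    from continuous_constant_on_closure[OF this, of 0] elim(3) show ?case
      unfolding clD' by auto
  qed
  then have eq: "AE \<omega> in M. \<forall>a\<in>{s..T}. discounted_payoff r K s X a \<omega> =
      discounted_payoff r K s (\<lambda>a \<omega>. x * price_factor \<mu>0 \<mu>1 \<sigma> s W \<theta> a \<omega>) a \<omega>"
    by eventually_elim (auto simp: discounted_payoff_def)
  show ?thesis
    unfolding stopping_value_eq
  proof (intro SUP_cong refl nn_integral_cong_AE)
    fix \<tau> assume "\<tau> \<in> stopping_times s T M W \<theta>"
    then have \<tau>: "\<And>\<omega>. \<omega> \<in> space M \<Longrightarrow> \<tau> \<omega> \<in> {s..T}" by (auto simp: stopping_times_def)
    show "AE \<omega> in M. discounted_payoff r K s X (\<tau> \<omega>) \<omega> =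
      discounted_payoff r K s (\<lambda>a \<omega>. x * price_factor \<mu>0 \<mu>1 \<sigma> s W \<theta> a \<omega>) (\<tau> \<omega>) \<omega>"
      using eq AE_space by eventually_elim (use \<tau> in auto)
  qed
qed

text \<open>Puts a model started in state 1 on the space of the given one, with the same
  \<open>W\<close>. A constant time generates the trivial sigma-algebra, so its independence of
  \<open>W\<close> is immediate.\<close>

lemma noise_switched_at_start: "noise M lam s 1 W (\<lambda>_. ereal s)"
proof (rule noise.intro[OF prob_space_axioms], rule noise_axioms.intro)
  have sets: "A = {} \<or> A = space M" if "A \<in> sets (vimage_algebra (space M) (\<lambda>_. ereal s) borel)" for A
    using that by (subst (asm) sets_vimage_algebra2) (auto split: if_splits)
  have "indep_set (sets (generated_sigma M W {s..})) (sets (vimage_algebra (space M) (\<lambda>_. ereal s) borel))"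
  proof (rule indep_setI)
    show "sets (generated_sigma M W {s..}) \<subseteq> events" by (rule sets_generated_sigma_subset) auto
    show "sets (vimage_algebra (space M) (\<lambda>_. ereal s) borel) \<subseteq> events"
      by (rule sets_vimage_algebra_subset) auto
    fix a b assume a: "a \<in> sets (generated_sigma M W {s..})"
      and b: "b \<in> sets (vimage_algebra (space M) (\<lambda>_. ereal s) borel)"
    have "a \<subseteq> space M" using sets.sets_into_space[OF a] by simp
    then show "prob (a \<inter> b) = prob a * prob b"
      using sets[OF b] by (auto simp: prob_space Int_absorb2)
  qed
  then show "driving_noise lam s 1 M W (\<lambda>_. ereal s)"
    using noise unfolding driving_noise_def switching_time_def by (auto simp: prob_space)
qed

text \<open>With a constant switching time the state carries no information, so the filtration is
  contained in that of \<theta> and every rule stays admissible. On each path the earlier switch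
  means a longer time at the lower drift, hence a smaller price factor.\<close>

lemma stopping_value_switched_le:
  assumes \<mu>: "\<mu>1 \<le> \<mu>0" and x: "0 \<le> x"
  shows "stopping_value r K T s M W (\<lambda>_. ereal s) (\<lambda>a \<omega>. x * price_factor \<mu>0 \<mu>1 \<sigma> s W (\<lambda>_. ereal s) a \<omega>) \<le>
    stopping_value r K T s M W \<theta> (\<lambda>a \<omega>. x * price_factor \<mu>0 \<mu>1 \<sigma> s W \<theta> a \<omega>)"
  unfolding stopping_value_eq
proof (rule SUP_mono)
  fix \<tau> assume \<tau>: "\<tau> \<in> stopping_times s T M W (\<lambda>_. ereal s)"
  have sub: "sets (augmented_filtration s M W (\<lambda>_. ereal s) u) \<subseteq> sets (augmented_filtration s M W \<theta> u)" for u
    by (rule sets_augmented_filtration_subset)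
       (auto intro: W_measurable_augmented state_process_measurable simp: null_sets_augmented)
  have "Measurable.pred (augmented_filtration s M W \<theta> u) (\<lambda>\<omega>. \<tau> \<omega> \<le> u)" for u
    using \<tau> sub[of u] by (auto simp: stopping_times_def stopping_time_def pred_def)
  then have \<tau>': "\<tau> \<in> stopping_times s T M W \<theta>"
    using \<tau> by (auto simp: stopping_times_def stopping_time_def)
  have "price_factor \<mu>0 \<mu>1 \<sigma> s W (\<lambda>_. ereal s) a \<omega> \<le> price_factor \<mu>0 \<mu>1 \<sigma> s W \<theta> a \<omega>"
    if "\<omega> \<in> space M" "s \<le> a" for a \<omega>
  proof -
    have "occupation \<theta> a \<omega> \<le> occupation (\<lambda>_. ereal s) a \<omega>"
      using \<theta>_ge[OF that(1)] that(2)
      by (cases rule: occupation_cases) (auto simp: occupation_real occupation_inf)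
    then have "(\<mu>0 - \<mu>1) * occupation \<theta> a \<omega> \<le> (\<mu>0 - \<mu>1) * occupation (\<lambda>_. ereal s) a \<omega>"
      using \<mu> by (intro mult_left_mono) auto
    then show ?thesis by (simp add: price_factor_def)
  qed
  then have "discounted_payoff r K s (\<lambda>a \<omega>. x * price_factor \<mu>0 \<mu>1 \<sigma> s W (\<lambda>_. ereal s) a \<omega>) (\<tau> \<omega>) \<omega> \<le>
      discounted_payoff r K s (\<lambda>a \<omega>. x * price_factor \<mu>0 \<mu>1 \<sigma> s W \<theta> a \<omega>) (\<tau> \<omega>) \<omega>" if "\<omega> \<in> space M" for \<omega>
    using that \<tau> x unfolding discounted_payoff_def stopping_times_def
    by (intro ennreal_leI mult_left_mono max.mono diff_right_mono) auto
  then show "\<exists>\<tau>'\<in>stopping_times s T M W \<theta>.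
      (\<integral>\<^sup>+\<omega>. discounted_payoff r K s (\<lambda>a \<omega>. x * price_factor \<mu>0 \<mu>1 \<sigma> s W (\<lambda>_. ereal s) a \<omega>) (\<tau> \<omega>) \<omega> \<partial>M)
      \<le> (\<integral>\<^sup>+\<omega>. discounted_payoff r K s (\<lambda>a \<omega>. x * price_factor \<mu>0 \<mu>1 \<sigma> s W \<theta> a \<omega>) (\<tau>' \<omega>) \<omega> \<partial>M)"
    using \<tau>' by (intro bexI[of _ \<tau>] nn_integral_mono) auto
qed

end

text \<open>Values are suprema in \<open>ennreal\<close>. Finiteness is therefore asserted as well:
  it ensures that \<open>enn2real\<close> in the convexity claim returns the value itself and not
  the default 0 for \<infinity>.\<close>

theorem lemma3p1:
  fixes T \<mu>0 \<mu>1 \<sigma> lam r K y0 x0 :: real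
    and P0 :: "'v measure" and W0 :: "real \<Rightarrow> 'v \<Rightarrow> real" and \<theta>0 :: "'v \<Rightarrow> ereal"
    and X0 :: "real \<Rightarrow> 'v \<Rightarrow> real"
    and P :: "real \<Rightarrow> real \<Rightarrow> nat \<Rightarrow> 'w measure"
    and W :: "real \<Rightarrow> real \<Rightarrow> nat \<Rightarrow> real \<Rightarrow> 'w \<Rightarrow> real"
    and \<theta> :: "real \<Rightarrow> real \<Rightarrow> nat \<Rightarrow> 'w \<Rightarrow> ereal"
    and X :: "real \<Rightarrow> real \<Rightarrow> nat \<Rightarrow> real \<Rightarrow> 'w \<Rightarrow> real"
    and v :: "nat \<Rightarrow> real \<Rightarrow> real \<Rightarrow> ennreal"
  assumes "0 < T" and "\<mu>1 < \<mu>0" and "0 < \<sigma>" and "0 \<le> lam" and "0 \<le> r" and "0 \<le> K"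
    and "0 \<le> y0" and "y0 < 1" and "0 \<le> x0"
    and "driving_noise lam 0 y0 P0 W0 \<theta>0"
    and "stock_price T \<mu>0 \<mu>1 \<sigma> 0 x0 P0 W0 \<theta>0 X0"
    and "started_markov_family T \<mu>0 \<mu>1 \<sigma> lam P W \<theta> X"
    and v: "\<And>i t x. v i t x = full_info_value r K T P W \<theta> X t x i"
  shows "(\<forall>i\<in>{0, 1}. \<forall>t\<in>{0..T}. \<forall>x\<ge>0. v i t x < \<infinity>) \<and>
    (\<forall>i\<in>{0, 1}. \<forall>t\<in>{0..T}.
       convex_on {0..} (\<lambda>x. enn2real (v i t x)) \<and> mono_on {0..} (\<lambda>x. v i t x)) \<and>
    (\<forall>t\<in>{0..T}. \<forall>x\<ge>0. v 1 t x \<le> v 0 t x) \<and>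
    (\<forall>i\<in>{0, 1}. \<forall>x\<ge>0. antimono_on {0..T} (\<lambda>t. v i t x))"
proof -
  have \<mu>: "\<mu>1 \<le> \<mu>0" using \<open>\<mu>1 < \<mu>0\<close> by simp
  have noise: "noise (P t x i) lam t (real i) (W t x i) (\<theta> t x i)"
    and sp: "stock_price T \<mu>0 \<mu>1 \<sigma> t x (P t x i) (W t x i) (\<theta> t x i) (X t x i)"
    if "t \<in> {0..T}" "0 \<le> x" "i \<in> {0, 1}" for t x i
  proof -
    have "driving_noise lam t (real i) (P t x i) (W t x i) (\<theta> t x i) \<and>
        stock_price T \<mu>0 \<mu>1 \<sigma> t x (P t x i) (W t x i) (\<theta> t x i) (X t x i)"
      using \<open>started_markov_family T \<mu>0 \<mu>1 \<sigma> lam P W \<theta> X\<close> that unfolding started_markov_family_def by blast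
    moreover from this have "prob_space (P t x i)" unfolding driving_noise_def by blast
    ultimately show "noise (P t x i) lam t (real i) (W t x i) (\<theta> t x i)"
      "stock_price T \<mu>0 \<mu>1 \<sigma> t x (P t x i) (W t x i) (\<theta> t x i) (X t x i)"
      by (blast intro: noise.intro noise_axioms.intro)+
  qed
  \<comment> \<open>Separates two roles of the initial price: \<open>z\<close> selects the copy of
    the model, \<open>x\<close> scales the price factor that lives on it.\<close>
  define V where "V i t z x = stopping_value r K T t (P t z i) (W t z i) (\<theta> t z i)
      (\<lambda>a \<omega>. x * price_factor \<mu>0 \<mu>1 \<sigma> t (W t z i) (\<theta> t z i) a \<omega>)" for i t z x
  \<comment> \<open>Transport changes the copy and the starting time at once; t \<le> t' means that
    at least as much time remains from t on.\<close>
  have tr: "V i t' z' x \<le> V i t z x"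
    if "t \<in> {0..T}" "t' \<in> {0..T}" "t \<le> t'" "0 \<le> z" "0 \<le> z'" "i \<in> {0, 1}" for i t t' z z' x
    unfolding V_def
    by (rule stopping_value_transport[OF noise noise]) (use that in auto)
  have vV: "v i t x = V i t 0 x" if "t \<in> {0..T}" "0 \<le> x" "i \<in> {0, 1}" for t x i
  proof -
    have "v i t x = V i t x x"
      unfolding v full_info_value_def V_def
      by (rule noise.stopping_value_stock_price[OF noise[OF that] \<open>0 < \<sigma>\<close> _ sp[OF that]])
         (use that in auto)
    \<comment> \<open>Transport in both directions moves every initial price to the copy with price
      0; its noise serves for all x, and the dependence on x becomes explicit.\<close>
    also have "\<dots> = V i t 0 x"
      using that by (intro antisym tr) auto
    finally show ?thesis .
  qed
  have fin: "V i t 0 x < \<infinity>" if "t \<in> {0..T}" "0 \<le> x" "i \<in> {0, 1}" for t x i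
    unfolding V_def
    by (rule noise.price_stopping_value_finite[OF noise[OF that(1) order_refl that(3)] _ \<mu> \<open>0 \<le> r\<close> \<open>0 \<le> K\<close> that(2)])
       (use that in auto)
  have conv: "convex_on {0..} (\<lambda>x. enn2real (v i t x))" if t: "t \<in> {0..T}" and i: "i \<in> {0, 1}" for t i
    unfolding convex_on_def
  proof (intro conjI ballI allI impI)
    fix x y u w :: real
    assume xy: "x \<in> {0..}" "y \<in> {0..}" and u: "0 \<le> u" "0 \<le> w" "u + w = 1"
    have z: "0 \<le> u * x + w * y" using xy u by simp
    have f: "V i t 0 x \<noteq> top" "V i t 0 y \<noteq> top" using fin[OF t _ i, of x] fin[OF t _ i, of y] xy by auto
    have "V i t 0 (u * x + w * y) \<le> ennreal u * V i t 0 x + ennreal w * V i t 0 y"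
      unfolding V_def
      by (rule noise.price_stopping_value_convex[OF noise[OF t order_refl i] _ u]) (use t in auto)
    \<comment> \<open>Passing to real numbers preserves the inequality because the right-hand side
      is finite.\<close>
    then have "enn2real (V i t 0 (u * x + w * y)) \<le> enn2real (ennreal u * V i t 0 x + ennreal w * V i t 0 y)"
      by (rule enn2real_mono) (use f in \<open>auto simp: ennreal_mult_eq_top_iff less_top[symmetric]\<close>)
    also have "\<dots> = u * enn2real (V i t 0 x) + w * enn2real (V i t 0 y)"
      using f u by (subst enn2real_plus) (auto simp: ennreal_mult_eq_top_iff enn2real_mult less_top[symmetric])
    finally show "enn2real (v i t (u *\<^sub>R x + w *\<^sub>R y)) \<le> u * enn2real (v i t x) + w * enn2real (v i t y)"
      using vV[OF t _ i] xy z by simp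
  qed simp
  have mono: "mono_on {0..} (\<lambda>x. v i t x)" if t: "t \<in> {0..T}" and i: "i \<in> {0, 1}" for t i
  proof (rule mono_onI)
    fix x y :: real assume xy: "x \<in> {0..}" "y \<in> {0..}" "x \<le> y"
    have "V i t 0 x \<le> V i t 0 y"
      unfolding V_def by (rule noise.price_stopping_value_mono[OF noise[OF t order_refl i] xy(3)])
    then show "v i t x \<le> v i t y" using vV[OF t _ i] xy by simp
  qed
  have states: "v 1 t x \<le> v 0 t x" if t: "t \<in> {0..T}" and x: "0 \<le> x" for t x
  proof -
    have n0: "noise (P t 0 0) lam t 0 (W t 0 0) (\<theta> t 0 0)" and n1: "noise (P t 0 1) lam t 1 (W t 0 1) (\<theta> t 0 1)"
      using noise[OF t, of 0 0] noise[OF t, of 0 1] by auto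
    \<comment> \<open>The model of state 1 is carried to the space of the model of state 0, where
      \<theta> is replaced by the constant t; there the two can be compared path by path.\<close>
    have "V 1 t 0 x \<le> stopping_value r K T t (P t 0 0) (W t 0 0) (\<lambda>_. ereal t)
        (\<lambda>a \<omega>. x * price_factor \<mu>0 \<mu>1 \<sigma> t (W t 0 0) (\<lambda>_. ereal t) a \<omega>)"
      unfolding V_def
      by (rule stopping_value_transport[OF n1 noise.noise_switched_at_start[OF n0]]) (use t in auto)
    also have "\<dots> \<le> V 0 t 0 x"
      unfolding V_def by (rule noise.stopping_value_switched_le[OF n0 \<mu> x])
    finally show ?thesis using vV[OF t x] by simp
  qed
  have anti: "antimono_on {0..T} (\<lambda>t. v i t x)" if x: "0 \<le> x" and i: "i \<in> {0, 1}" for i x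
  proof (rule monotone_onI)
    fix t t' assume t: "t \<in> {0..T}" "t' \<in> {0..T}" "t \<le> t'"
    show "v i t' x \<le> v i t x"
      unfolding vV[OF t(1) x i] vV[OF t(2) x i] by (rule tr[OF t order_refl order_refl i])
  qed
  have fin': "v i t x < \<infinity>" if "t \<in> {0..T}" "0 \<le> x" "i \<in> {0, 1}" for t x i
    unfolding vV[OF that] by (rule fin[OF that])
  show ?thesis
    by (intro conjI ballI allI impI fin' conv mono states anti)
qed

end
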